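(* There exist universal constants $M,M_5>0$ such that the following holds. Suppose that: (1) the learning rule $\Psi_\alpha$ is an empirical conditional risk minimizer, i.e. $\Psi_\alpha(S)\in\arg\min_{g\in\mathcal G}\widehat{\mathcal R}_\alpha(g,S)$ for every training index set $S$; (2) the class of functions $\{z\mapsto c(g,z):g\in\mathcal G\}$ has finite VC-dimension $\mathcal V_{\mathcal G}$; (3) $0\le c(g,z)\le1$ for all $(g,z)\in\mathcal G\times\mathcal Z$. Let $1\le p<n$ and let $V_{1:K}^{\mathrm{lpo}}$ be the leave-$p$-out validation sets. Then for every $\delta\in(0,1)$, with probability at least $1-17\delta$, $$\Big|\widehat{\mathcal R}_{CV,\alpha}(\Psi_\alpha,V_{1:K}^{\mathrm{lpo}})-\mathcal R_\alpha\big(\Psi_\alpha(S_n)\big)\Big|\le E_{lpo}(n,p,\alpha)+\frac{1}{\delta\sqrt{(n-p)\alpha}}\big(5M\sqrt{\mathcal V_{\mathcal G}}+M_5\big),$$ with $$E_{lpo}(n,p,\alpha)=9M\sqrt{\frac{\mathcal V_{\mathcal G}}{(n-p)\alpha}}+\frac{9}{(n-p)\alpha}.$$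
   Context: Let $\mathcal X\subset\mathbb R^d$, $\mathcal Z=\mathcal X\times\{-1,1\}$, and let $\|\cdot\|$ be a norm on $\mathcal X$. Let $Z=(X,Y)$ be a random element of $\mathcal Z$ and $Z_i=(X_i,Y_i)$, $i=1,\dots,n$, i.i.d. copies of $Z$; $S_n=\{1,\dots,n\}$. Let $\alpha=k/n\in(0,1]$ with $k$ a positive integer, and let $t_\alpha$ be the $(1-\alpha)$-quantile of $\|X\|$, with $\mathbb P(\|X\|\ge t_\alpha)=\alpha$. Let $\mathcal G$ be a class of functions $g:\mathcal X\to\mathbb R$ and $c:\mathcal G\times\mathcal Z\to\mathbb R$ a cost function, with $c(g,(x,y))$ depending on $g$ through $g(x)$ (also written $c(g(x),y)$). The conditional risk is $\mathcal R_\alpha(g)=\mathbb E[c(g,Z)\mid \|X\|\ge t_\alpha]$; for a data-dependent $\hat g$, $\mathcal R_\alpha(\hat g)$ means this function evaluated at $\hat g$. With reverse order statistics $\|X_{(1)}\|\ge\dots\ge\|X_{(n)}\|$ of the full sample, the empirical risk on $S\subset\{1,\dots,n\}$, $n_S=\mathrm{card}(S)$, is $$\widehat{\mathcal R}_\alpha(g,S)=\frac1{\alpha n_S}\sum_{i\in S}c(g,Z_i)\mathbf 1\{\|X_i\|>\|X_{(\lfloor\alpha n\rfloor)}\|\}.$$ A learning rule $\Psi$ maps an index set $S\subset\{1,\dots,n\}$ to an element $\Psi(S)\in\mathcal G$ trained on $\{Z_i:i\in S\}$. For validation sets $V_{1:K}=(V_1,\dots,V_K)$ with training sets $T_j=\{1,\dots,n\}\setminus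 V_j$, the cross-validation estimator is $\widehat{\mathcal R}_{CV,\alpha}(\Psi,V_{1:K})=\frac1K\sum_{j=1}^K\widehat{\mathcal R}_\alpha(\Psi(T_j),V_j)$. In the leave-$p$-out scheme, $V_1,\dots,V_K$ are all the subsets of $\{1,\dots,n\}$ of cardinality $p$, so $K=\binom np$. The VC-dimension of a class of real functions is the VC-dimension of the family of its subgraphs $\{(x,y,t)\in\mathcal Z\times\mathbb R: t<c(g(x),y)\}$, $g\in\mathcal G$. "Universal constant" means not depending on any of the other objects ($n,\alpha,p,\delta,\mathcal G,c$, the law of $Z$).
   Formalization: The law of ‖X‖ is additionally assumed to have no atoms on [t_α,∞), since with ties among the large norms the claim can fail; the cost c(g,·) and the costs of the trained predictors are assumed measurable. *)

theory Defs
  imports "HOL-Probability.Probability" "HOL-Library.Extended_Nat"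
begin

section \<open>Vectors, labels and norms\<close>

text \<open>
  The constants of the theorem must not depend on the dimension \<open>d\<close>, so \<open>d\<close> has to be a
  bound variable rather than a type: a point of \<open>\<real>\<^sup>d\<close> is an extensional function on
  \<open>{..<d}\<close>, that is, an element of the space of the product measure
  \<open>Pi\<^sub>M {..<d} (\<lambda>_. borel)\<close>.
\<close>

type_synonym vec = "nat \<Rightarrow> real"
type_synonym obs = "vec \<times> int"

definition is_norm :: "nat \<Rightarrow> (vec \<Rightarrow> real) \<Rightarrow> bool" where
  "is_norm d N \<longleftrightarrow>
     (\<forall>x\<in>{..<d} \<rightarrow>\<^sub>E UNIV. 0 \<le> N x \<and> (N x = 0 \<longleftrightarrow> (\<forall>i<d. x i = 0))) \<and>
     (\<forall>a. \<forall>x\<in>{..<d} \<rightarrow>\<^sub>E UNIV. N (\<lambda>i\<in>{..<d}. a * x i) = \<bar>a\<bar> * N x) \<and>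
     (\<forall>x\<in>{..<d} \<rightarrow>\<^sub>E UNIV. \<forall>y\<in>{..<d} \<rightarrow>\<^sub>E UNIV. N (\<lambda>i\<in>{..<d}. x i + y i) \<le> N x + N y)"

definition obs_space :: "nat \<Rightarrow> vec set \<Rightarrow> obs measure" where
  "obs_space d X = restrict_space (Pi\<^sub>M {..<d} (\<lambda>_. borel)) X \<Otimes>\<^sub>M count_space {-1, 1}"

section \<open>VC dimension\<close>

definition shatters :: "'a set set \<Rightarrow> 'a set \<Rightarrow> bool" where
  "shatters C A \<longleftrightarrow> (\<forall>B\<subseteq>A. \<exists>S\<in>C. A \<inter> S = B)"

definition vc_dim :: "'a set set \<Rightarrow> enat" where
  "vc_dim C = (SUP A\<in>{A. finite A \<and> shatters C A}. enat (card A))"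

definition subgraph :: "obs set \<Rightarrow> ((vec \<Rightarrow> real) \<Rightarrow> obs \<Rightarrow> real) \<Rightarrow> (vec \<Rightarrow> real)
    \<Rightarrow> (vec \<times> int \<times> real) set" where
  "subgraph \<Z> c g = {(x, y, s). (x, y) \<in> \<Z> \<and> s < c g (x, y)}"

section \<open>Conditional risk, empirical risk, cross-validation\<close>

definition is_quantile :: "'a measure \<Rightarrow> ('a \<Rightarrow> real) \<Rightarrow> real \<Rightarrow> real \<Rightarrow> bool" where
  "is_quantile P f q t \<longleftrightarrow>
     measure P {z \<in> space P. f z < t} \<le> q \<and> q \<le> measure P {z \<in> space P. f z \<le> t}"

text \<open>
  A law \<open>P\<close> of \<open>Z\<close> and a sample \<open>\<omega>\<close> with \<open>\<omega> i = (X\<^sub>i, Y\<^sub>i)\<close> for \<open>i \<in> {1..n}\<close>.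
  The conditional risk is the elementary conditional expectation of \<open>c (g, Z)\<close> given the event
  \<open>\<parallel>X\<parallel> \<ge> t\<close>.
\<close>

definition cond_risk :: "obs measure \<Rightarrow> (vec \<Rightarrow> real) \<Rightarrow> ((vec \<Rightarrow> real) \<Rightarrow> obs \<Rightarrow> real) \<Rightarrow> real
    \<Rightarrow> (vec \<Rightarrow> real) \<Rightarrow> real" where
  "cond_risk P N c t g =
     (LINT z:{z \<in> space P. t \<le> N (fst z)}|P. c g z) / measure P {z \<in> space P. t \<le> N (fst z)}"

definition rev_order_stat :: "(vec \<Rightarrow> real) \<Rightarrow> nat \<Rightarrow> (nat \<Rightarrow> obs) \<Rightarrow> nat \<Rightarrow> real" where
  "rev_order_stat N n \<omega> j = rev (sort (map (\<lambda>i. N (fst (\<omega> i))) [1..<Suc n])) ! (j - 1)"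

definition emp_threshold :: "(vec \<Rightarrow> real) \<Rightarrow> nat \<Rightarrow> real \<Rightarrow> (nat \<Rightarrow> obs) \<Rightarrow> real" where
  "emp_threshold N n \<alpha> \<omega> = rev_order_stat N n \<omega> (nat \<lfloor>\<alpha> * real n\<rfloor>)"

definition emp_risk :: "(vec \<Rightarrow> real) \<Rightarrow> ((vec \<Rightarrow> real) \<Rightarrow> obs \<Rightarrow> real) \<Rightarrow> nat \<Rightarrow> real
    \<Rightarrow> (nat \<Rightarrow> obs) \<Rightarrow> (vec \<Rightarrow> real) \<Rightarrow> nat set \<Rightarrow> real" where
  "emp_risk N c n \<alpha> \<omega> g S =
     1 / (\<alpha> * real (card S)) *
     (\<Sum>i\<in>S. c g (\<omega> i) * of_bool (N (fst (\<omega> i)) > emp_threshold N n \<alpha> \<omega>))"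

text \<open>
  The objective \<open>emp_risk\<close> minimised on \<open>S\<close> involves the observations outside \<open>S\<close> only
  through the threshold computed from the full sample. Accordingly a learning rule trained on
  \<open>S\<close> is a function \<open>\<Psi> S \<tau> s\<close> of the value \<open>\<tau>\<close> of this threshold and of the training
  data \<open>s = (Z\<^sub>i)\<^sub>i\<^sub>\<in>\<^sub>S\<close>; rules that ignore \<open>\<tau>\<close> are a special case. The measurability
  requirement makes the risks of the trained predictors random variables.
\<close>

type_synonym rule = "nat set \<Rightarrow> real \<Rightarrow> (nat \<Rightarrow> obs) \<Rightarrow> (vec \<Rightarrow> real)"

definition learning_rule :: "obs measure \<Rightarrow> ((vec \<Rightarrow> real) \<Rightarrow> obs \<Rightarrow> real) \<Rightarrow> (vec \<Rightarrow> real) set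
    \<Rightarrow> nat \<Rightarrow> rule \<Rightarrow> bool" where
  "learning_rule P c G n \<Psi> \<longleftrightarrow>
     (\<forall>S\<subseteq>{1..n}.
        (\<forall>\<tau>. \<forall>s\<in>space (Pi\<^sub>M S (\<lambda>_. P)). \<Psi> S \<tau> s \<in> G) \<and>
        (\<lambda>(\<tau>, s, z). c (\<Psi> S \<tau> s) z)
          \<in> borel_measurable (borel \<Otimes>\<^sub>M (Pi\<^sub>M S (\<lambda>_. P) \<Otimes>\<^sub>M P)))"

definition trained :: "(vec \<Rightarrow> real) \<Rightarrow> nat \<Rightarrow> real \<Rightarrow> rule \<Rightarrow> (nat \<Rightarrow> obs) \<Rightarrow> nat set
    \<Rightarrow> (vec \<Rightarrow> real)" where
  "trained N n \<alpha> \<Psi> \<omega> S = \<Psi> S (emp_threshold N n \<alpha> \<omega>) (restrict \<omega> S)"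

definition cond_erm :: "obs measure \<Rightarrow> (vec \<Rightarrow> real) \<Rightarrow> ((vec \<Rightarrow> real) \<Rightarrow> obs \<Rightarrow> real)
    \<Rightarrow> (vec \<Rightarrow> real) set \<Rightarrow> nat \<Rightarrow> real \<Rightarrow> rule \<Rightarrow> bool" where
  "cond_erm P N c G n \<alpha> \<Psi> \<longleftrightarrow>
     (\<forall>\<omega>\<in>space (Pi\<^sub>M {1..n} (\<lambda>_. P)). \<forall>S\<subseteq>{1..n}. S \<noteq> {} \<longrightarrow>
        is_arg_min (\<lambda>g. emp_risk N c n \<alpha> \<omega> g S) (\<lambda>g. g \<in> G) (trained N n \<alpha> \<Psi> \<omega> S))"

definition cv_risk :: "(vec \<Rightarrow> real) \<Rightarrow> ((vec \<Rightarrow> real) \<Rightarrow> obs \<Rightarrow> real) \<Rightarrow> nat \<Rightarrow> real \<Rightarrow> rule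
    \<Rightarrow> nat \<Rightarrow> (nat \<Rightarrow> nat set) \<Rightarrow> (nat \<Rightarrow> obs) \<Rightarrow> real" where
  "cv_risk N c n \<alpha> \<Psi> K V \<omega> =
     1 / real K *
     (\<Sum>j=1..K. emp_risk N c n \<alpha> \<omega> (trained N n \<alpha> \<Psi> \<omega> ({1..n} - V j)) (V j))"

definition leave_p_out :: "nat \<Rightarrow> nat \<Rightarrow> nat \<Rightarrow> (nat \<Rightarrow> nat set) \<Rightarrow> bool" where
  "leave_p_out n p K V \<longleftrightarrow>
     K = n choose p \<and> bij_betw V {1..K} {S. S \<subseteq> {1..n} \<and> card S = p}"

definition E_lpo :: "real \<Rightarrow> nat \<Rightarrow> nat \<Rightarrow> nat \<Rightarrow> real \<Rightarrow> real" where
  "E_lpo M v n p \<alpha> =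
     9 * M * sqrt (real v / (real (n - p) * \<alpha>)) + 9 / (real (n - p) * \<alpha>)"

section \<open>Standing assumptions\<close>

text \<open>
  The last assumption, continuity of the law of \<open>\<parallel>X\<parallel>\<close> on \<open>[t, \<infinity>)\<close>, excludes ties among
  the large norms. It does not follow from \<open>P (\<parallel>X\<parallel> \<ge> t) = \<alpha>\<close>: if \<open>\<parallel>X\<parallel>\<close> takes some value
  \<open>a > t\<close> with probability \<open>\<alpha>\<close> and is below \<open>t\<close> otherwise, then with probability close to
  1/2 no observation exceeds the empirical threshold strictly, and all empirical risks vanish.
\<close>

locale extreme_setting = prob_space P
  for P :: "obs measure" +
  fixes d :: nat and X :: "vec set" and N :: "vec \<Rightarrow> real"
    and G :: "(vec \<Rightarrow> real) set" and c :: "(vec \<Rightarrow> real) \<Rightarrow> obs \<Rightarrow> real"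
    and \<alpha> t :: real
  assumes X_subset: "X \<subseteq> {..<d} \<rightarrow>\<^sub>E UNIV"
    and norm: "is_norm d N"
    and sets_P: "sets P = sets (obs_space d X)"
    and cost_measurable: "\<And>g. g \<in> G \<Longrightarrow> c g \<in> borel_measurable P"
    and cost_local: "\<And>g h x y. g \<in> G \<Longrightarrow> h \<in> G \<Longrightarrow> (x, y) \<in> X \<times> {-1, 1} \<Longrightarrow> g x = h x
          \<Longrightarrow> c g (x, y) = c h (x, y)"
    and quantile: "is_quantile P (\<lambda>z. N (fst z)) (1 - \<alpha>) t"
    and tail: "measure P {z \<in> space P. t \<le> N (fst z)} = \<alpha>"
    and no_atom: "\<And>s. t \<le> s \<Longrightarrow> measure P {z \<in> space P. N (fst z) = s} = 0"

end

theory Submission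
  imports Defs
begin

text \<open>
  Write \<open>m = n - p\<close> and let \<open>D\<close> be the difference between the cross-validation estimate and the
  risk of the predictor trained on the whole sample. The theorem follows by Markov's inequality
  from a bound on the mean of \<open>\<bar>D\<bar>\<close> of order \<open>(sqrt v + 1) / sqrt (m * \<alpha>)\<close>, lemma
  \<open>expected_cv_error_rate\<close>. When \<open>m * \<alpha> < 1\<close> the claim is trivial, because the estimate and the
  risk both lie in \<open>[0, 1]\<close>.

  Since \<open>\<bar>D\<bar> = D + 2 * max 0 (- D)\<close>, it is enough to control the negative part of \<open>D\<close> and its mean.

  Negative part. Let \<open>g\<^sub>j\<close> be trained on \<open>T\<^sub>j\<close> and \<open>g\<close> on the whole sample. As \<open>g\<^sub>j\<close> is at least as
  good as \<open>g\<close> on \<open>T\<^sub>j\<close>, and \<open>g\<close> at least as good as \<open>g\<^sub>j\<close> on the whole sample, \<open>g\<^sub>j\<close> is at least as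
  bad as \<open>g\<close> on \<open>V\<^sub>j\<close>. Averaging over \<open>j\<close>, the cross-validation estimate dominates the empirical
  risk of \<open>g\<close> on the whole sample (\<open>cv_sum_ge\<close>), which is close to the risk of \<open>g\<close>.

  Mean. A held-out point \<open>i \<in> V\<^sub>j\<close> would be a fresh observation for \<open>g\<^sub>j\<close>, if \<open>g\<^sub>j\<close> did not depend on
  it through the empirical threshold. But its cost counts only if its norm exceeds the threshold,
  and then the threshold is determined by the other observations
  (\<open>kth_largest_update_exceeding\<close>). Hence the expected cost at \<open>i\<close> is at most, up to the probability
  that the threshold misclassifies \<open>i\<close>, the expected risk of a predictor that minimises
  the empirical risk on \<open>T\<^sub>j\<close> for a threshold free of observation \<open>i\<close>, and this risk exceeds that of
  \<open>g\<close> by at most two deviations of empirical risks on \<open>T\<^sub>j\<close> and the price of a wrong threshold (\<open>expected_held_out_cost_le\<close>).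

  The empirical threshold and the quantile \<open>t\<close> disagree on at most one observation more than the
  number of norms above \<open>t\<close> differs from \<open>k\<close>, which is of order \<open>sqrt k\<close> in the mean
  (\<open>expected_misfit\<close>).

  The deviations are those of a class of VC dimension \<open>v\<close> seen through the tail event of
  probability \<open>\<alpha>\<close>, and have to be of order \<open>sqrt (v * m * \<alpha>)\<close> without a logarithm. They are only
  needed at predictors that are measurable functions of the sample. Symmetrisation with a ghost
  sample therefore applies without a supremum over the class, which need not be measurable
  (\<open>symmetrized_deviation\<close>). What remains is the average over signs for fixed points. Writing a
  function with values in \<open>[0, 1]\<close> as the integral of the indicators of its level sets reduces it
  to families of sets, where Dudley's chaining gives the bound (\<open>rademacher_vc_sets\<close>).
\<close>

section \<open>Packing in families of finite VC dimension\<close>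

lemma shattersD: "shatters C A \<Longrightarrow> B \<subseteq> A \<Longrightarrow> \<exists>S\<in>C. A \<inter> S = B"
  unfolding shatters_def by blast

text \<open>
  Pajor's strengthening of the Sauer-Shelah lemma, which makes the induction on \<open>Q\<close> immediate:
  split \<open>C\<close> by membership of \<open>x\<close>. What either half shatters is shattered by \<open>C\<close>, and what both
  halves shatter stays shattered when \<open>x\<close> is added.
\<close>

lemma card_le_card_shattered:
  assumes "finite Q" "C \<subseteq> Pow Q"
  shows "card C \<le> card {U. U \<subseteq> Q \<and> shatters C U}"
  using assms
proof (induction Q arbitrary: C rule: finite_induct)
  case empty
  show ?case
  proof (cases "C = {}")
    case False
    with empty have "C = {{}}" by auto
    then have "{U. U \<subseteq> {} \<and> shatters C U} = {{}}" by (auto simp: shatters_def)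
    with \<open>C = {{}}\<close> show ?thesis by simp
  qed simp
next
  case (insert x Q)
  define C0 where "C0 = {A \<in> C. x \<notin> A}"
  define C1 where "C1 = (\<lambda>A. A - {x}) ` {A \<in> C. x \<in> A}"
  define Sh where "Sh D = {U. U \<subseteq> Q \<and> shatters D U}" for D :: "'a set set"
  have finC: "finite C" using insert.prems insert.hyps(1) by (meson finite_Pow_iff finite_insert finite_subset)
  have finSh: "finite (Sh D)" for D unfolding Sh_def using insert.hyps(1) by simp
  have C0: "C0 \<subseteq> Pow Q" and C1: "C1 \<subseteq> Pow Q"
    using insert.prems unfolding C0_def C1_def by auto
  have "C = C0 \<union> {A \<in> C. x \<in> A}" by (auto simp: C0_def)
  then have "card C = card C0 + card {A \<in> C. x \<in> A}"
    using finC by (subst \<open>C = _\<close>, subst card_Un_disjoint) (auto simp: C0_def)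
  moreover have "card C1 = card {A \<in> C. x \<in> A}"
    unfolding C1_def by (rule card_image) (auto simp: inj_on_def)
  ultimately have "card C = card C0 + card C1" by simp
  also have "\<dots> \<le> card (Sh C0) + card (Sh C1)"
    using insert.IH[OF C0] insert.IH[OF C1] by (simp add: Sh_def)
  also have "\<dots> = card (Sh C0 \<union> Sh C1) + card (Sh C0 \<inter> Sh C1)"
    by (rule card_Un_Int) (use finSh in auto)
  also have "card (Sh C0 \<inter> Sh C1) = card (insert x ` (Sh C0 \<inter> Sh C1))"
    by (rule card_image[symmetric]) (use insert.hyps(2) in \<open>force simp: inj_on_def Sh_def\<close>)
  also have "card (Sh C0 \<union> Sh C1) + card (insert x ` (Sh C0 \<inter> Sh C1))
      = card ((Sh C0 \<union> Sh C1) \<union> insert x ` (Sh C0 \<inter> Sh C1))"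
    by (rule card_Un_disjoint[symmetric]) (use finSh insert.hyps(2) in \<open>auto simp: Sh_def\<close>)
  also have "\<dots> \<le> card {U. U \<subseteq> insert x Q \<and> shatters C U}"
  proof (rule card_mono)
    show "finite {U. U \<subseteq> insert x Q \<and> shatters C U}" using insert.hyps(1) by simp
    have sub0: "shatters C U" if "U \<in> Sh C0" for U
      using that unfolding Sh_def shatters_def C0_def by blast
    have sub1: "shatters C U" if "U \<in> Sh C1" for U
      unfolding shatters_def
    proof (intro allI impI)
      fix B assume "B \<subseteq> U"
      with that obtain A where A: "A \<in> C1" "U \<inter> A = B" unfolding Sh_def by (blast dest: shattersD)
      then obtain A' where "A' \<in> C" "A = A' - {x}" unfolding C1_def by auto
      moreover have "x \<notin> U" using that insert.hyps(2) by (auto simp: Sh_def)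
      ultimately show "\<exists>S\<in>C. U \<inter> S = B" using A by (intro bexI[of _ A']) auto
    qed
    have sub2: "shatters C (insert x U)" if U: "U \<in> Sh C0" "U \<in> Sh C1" for U
      unfolding shatters_def
    proof (intro allI impI)
      fix B assume B: "B \<subseteq> insert x U"
      have xU: "x \<notin> U" using U insert.hyps(2) by (auto simp: Sh_def)
      show "\<exists>S\<in>C. insert x U \<inter> S = B"
      proof (cases "x \<in> B")
        case True
        have "B - {x} \<subseteq> U" using B by auto
        with U(2) obtain A where A: "A \<in> C1" "U \<inter> A = B - {x}"
          unfolding Sh_def by (blast dest: shattersD)
        then obtain A' where "A' \<in> C" "x \<in> A'" "A = A' - {x}" unfolding C1_def by auto
        then show ?thesis using A True xU by (intro bexI[of _ A']) auto
      next
        case False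
        with B have "B \<subseteq> U" by auto
        with U(1) obtain A where "A \<in> C0" "U \<inter> A = B"
          unfolding Sh_def by (blast dest: shattersD)
        then show ?thesis unfolding C0_def using False xU by (intro bexI[of _ A]) auto
      qed
    qed
    show "Sh C0 \<union> Sh C1 \<union> insert x ` (Sh C0 \<inter> Sh C1) \<subseteq> {U. U \<subseteq> insert x Q \<and> shatters C U}"
      using sub0 sub1 sub2 by (auto simp: Sh_def)
  qed
  finally show ?case .
qed

text \<open>
  Weighting a set \<open>U\<close> by \<open>(1 / u) ^ card U\<close> turns the sum of binomial coefficients below \<open>v\<close> into a
  full binomial expansion. Keeping \<open>u\<close> free allows a choice in which the packing bound below
  absorbs the size of the sample.
\<close>

lemma sauer_exp:
  fixes u :: real
  assumes Q: "finite Q" "C \<subseteq> Pow Q"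
    and v: "\<And>U. U \<subseteq> Q \<Longrightarrow> shatters C U \<Longrightarrow> card U \<le> v" and u: "u \<ge> 1"
  shows "real (card C) \<le> u ^ v * exp (real (card Q) / u)"
proof -
  have "real (card C) \<le> real (card {U. U \<subseteq> Q \<and> card U \<le> v})"
    using card_le_card_shattered[OF Q] card_mono[of "{U. U \<subseteq> Q \<and> card U \<le> v}" "{U. U \<subseteq> Q \<and> shatters C U}"] v Q(1)
    by force
  also have "\<dots> = (\<Sum>U\<in>{U. U \<subseteq> Q \<and> card U \<le> v}. 1)" by simp
  also have "\<dots> \<le> (\<Sum>U\<in>{U. U \<subseteq> Q \<and> card U \<le> v}. u ^ v * (1 / u) ^ card U)"
  proof (rule sum_mono)
    fix U assume "U \<in> {U. U \<subseteq> Q \<and> card U \<le> v}"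
    then have "u ^ card U \<le> u ^ v" using u by (intro power_increasing) auto
    then show "1 \<le> u ^ v * (1 / u) ^ card U" using u by (simp add: power_one_over field_simps)
  qed
  also have "\<dots> \<le> (\<Sum>U\<in>Pow Q. u ^ v * (1 / u) ^ card U)"
    by (rule sum_mono2) (use Q u in auto)
  also have "\<dots> = u ^ v * (\<Sum>U\<in>Pow Q. (\<Prod>x\<in>U. 1 / u) * (\<Prod>x\<in>Q - U. 1))"
    by (simp add: sum_distrib_left)
  also have "(\<Sum>U\<in>Pow Q. (\<Prod>x\<in>U. 1 / u) * (\<Prod>x\<in>Q - U. 1)) = (\<Prod>x\<in>Q. 1 / u + 1)"
    by (rule prod_add[symmetric]) fact
  also have "\<dots> = (1 + 1 / u) ^ card Q" by (simp add: add.commute)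
  also have "\<dots> \<le> exp (1 / u) ^ card Q"
    using u by (intro power_mono exp_ge_add_one_self) auto
  also have "\<dots> = exp (real (card Q) / u)" by (simp add: exp_of_nat_mult[symmetric])
  finally show ?thesis using u by simp
qed

text \<open>
  Probabilistic method: \<open>m\<close> points drawn from \<open>Q\<close> miss the symmetric difference of a given pair
  with probability at most \<open>exp (- e * m)\<close>, and there are fewer than \<open>(card C)\<^sup>2\<close> ordered pairs of
  distinct members, so some draw separates all of them.
\<close>

lemma separating_sample:
  fixes e :: real
  assumes Q: "finite Q" "Q \<noteq> {}" "C \<subseteq> Pow Q" "C \<noteq> {}" and e: "0 < e" "e \<le> 1"
    and sep: "\<And>A B. A \<in> C \<Longrightarrow> B \<in> C \<Longrightarrow> A \<noteq> B \<Longrightarrow> e * card Q \<le> card ((A - B) \<union> (B - A))"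
    and m: "2 * ln (card C) \<le> e * real m"
  obtains U where "U \<subseteq> Q" "card U \<le> m" "inj_on (\<lambda>A. A \<inter> U) C"
proof -
  define F where "F = {..<m} \<rightarrow>\<^sub>E Q"
  define bad where "bad = (\<lambda>(A, B). {..<m} \<rightarrow>\<^sub>E (Q - ((A - B) \<union> (B - A))))"
  define D where "D = {(A, B). A \<in> C \<and> B \<in> C \<and> A \<noteq> B}"
  have finC: "finite C" using Q by (meson finite_Pow_iff finite_subset)
  have finD: "finite D" by (rule finite_subset[of _ "C \<times> C"]) (use finC in \<open>auto simp: D_def\<close>)
  have cC: "card C > 0" using finC Q by (simp add: card_gt_0_iff)
  have D_eq: "D = C \<times> C - (\<lambda>A. (A, A)) ` C" by (auto simp: D_def)
  have "card D = card C * card C - card C"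
    unfolding D_eq by (subst card_Diff_subset) (use finC in \<open>auto simp: card_cartesian_product card_image inj_on_def\<close>)
  with cC have cD: "real (card D) < real (card C) ^ 2"
    by (metis diff_less nat_0_less_mult_iff of_nat_less_iff of_nat_power power2_eq_square)
  have cbad: "real (card (bad x)) \<le> (real (card Q) * exp (- e)) ^ m" if "x \<in> D" for x
  proof -
    obtain A B where x: "x = (A, B)" "A \<in> C" "B \<in> C" "A \<noteq> B" using \<open>x \<in> D\<close> by (auto simp: D_def)
    define S where "S = (A - B) \<union> (B - A)"
    have S: "S \<subseteq> Q" using x Q by (auto simp: S_def)
    have "real (card (Q - S)) = real (card Q) - real (card S)"
      using S Q(1) by (simp add: card_Diff_subset finite_subset card_mono of_nat_diff)
    also have "\<dots> \<le> real (card Q) * (1 - e)"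
      using sep[OF x(2-4)] by (simp add: S_def algebra_simps)
    also have "\<dots> \<le> real (card Q) * exp (- e)"
      using exp_ge_add_one_self[of "- e"] by (intro mult_left_mono) auto
    finally show ?thesis
      unfolding x(1) bad_def by (simp add: card_PiE S_def[symmetric] power_mono)
  qed
  have "real (card (\<Union>x\<in>D. bad x)) \<le> (\<Sum>x\<in>D. real (card (bad x)))"
    using card_UN_le[OF finD, of bad] by (simp flip: of_nat_sum)
  also have "\<dots> \<le> (\<Sum>x\<in>D. (real (card Q) * exp (- e)) ^ m)" by (intro sum_mono cbad)
  also have "\<dots> = real (card D) * exp (- (e * m)) * real (card Q) ^ m"
    by (simp add: power_mult_distrib exp_of_nat_mult[symmetric] mult.commute)
  also have "\<dots> < real (card C) ^ 2 * exp (- (e * m)) * real (card Q) ^ m"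
    using cD Q by (intro mult_strict_right_mono) (auto simp: card_gt_0_iff)
  also have "\<dots> \<le> real (card Q) ^ m"
  proof -
    have "real (card C) ^ 2 = exp (2 * ln (card C))"
      using cC by (metis exp_ln exp_of_nat_mult of_nat_0_less_iff of_nat_numeral)
    also have "\<dots> \<le> exp (e * m)" using m by simp
    finally have "real (card C) ^ 2 * exp (- (e * m)) \<le> exp (e * m) * exp (- (e * m))"
      by (intro mult_right_mono) auto
    also have "\<dots> = 1" by (simp flip: exp_add)
    finally show ?thesis using mult_right_mono[of _ 1 "real (card Q) ^ m"] by fastforce
  qed
  also have "\<dots> = real (card F)" by (simp add: F_def card_PiE)
  finally have "card (\<Union>x\<in>D. bad x) < card F" by simp
  moreover have "finite (\<Union>x\<in>D. bad x)" using finD Q by (auto simp: bad_def intro!: finite_PiE)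
  ultimately have "\<not> F \<subseteq> (\<Union>x\<in>D. bad x)" by (meson card_mono linorder_not_less)
  then obtain f where f: "f \<in> F" "\<And>x. x \<in> D \<Longrightarrow> f \<notin> bad x" by blast
  show ?thesis
  proof
    show "f ` {..<m} \<subseteq> Q" using f(1) by (auto simp: F_def)
    show "card (f ` {..<m}) \<le> m" using card_image_le[of "{..<m}" f] by simp
    show "inj_on (\<lambda>A. A \<inter> f ` {..<m}) C"
    proof (rule inj_onI, rule ccontr)
      fix A B assume AB: "A \<in> C" "B \<in> C" "A \<inter> f ` {..<m} = B \<inter> f ` {..<m}" "A \<noteq> B"
      then have "f \<in> bad (A, B)" using f(1) by (fastforce simp: bad_def F_def PiE_iff)
      moreover have "(A, B) \<in> D" using AB by (simp add: D_def)
      ultimately show False using f(2) by blast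
    qed
  qed
qed

text \<open>
  A separating sample of about \<open>2 * ln (card C) / e\<close> points embeds \<open>C\<close> into its traces, which the
  Sauer-Shelah bound counts. The result has the order of Haussler's packing bound, up to a constant
  factor in the exponent.
\<close>

lemma ln_card_packing:
  fixes e :: real
  assumes Q: "finite Q" "Q \<noteq> {}" "C \<subseteq> Pow Q" "C \<noteq> {}" and e: "0 < e" "e \<le> 1"
    and sep: "\<And>A B. A \<in> C \<Longrightarrow> B \<in> C \<Longrightarrow> A \<noteq> B \<Longrightarrow> e * card Q \<le> card ((A - B) \<union> (B - A))"
    and v: "\<And>U. U \<subseteq> Q \<Longrightarrow> shatters C U \<Longrightarrow> card U \<le> v"
  shows "ln (card C) \<le> 2 * real v * ln (4 / e) + 1 / 2"
proof -
  define L where "L = ln (real (card C))"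
  define m where "m = nat \<lceil>2 * L / e\<rceil>"
  (* With this u the term m / u is at most L / 2 + e / 4, and L can be absorbed on the left. *)
  define u where "u = 4 / e"
  have finC: "finite C" using Q by (meson finite_Pow_iff finite_subset)
  have cC: "card C > 0" using finC Q by (simp add: card_gt_0_iff)
  have L: "L \<ge> 0" using cC by (simp add: L_def)
  have m1: "2 * L / e \<le> m" unfolding m_def by (rule real_nat_ceiling_ge)
  have m2: "m \<le> 2 * L / e + 1" 
  proof -
    have "0 \<le> 2 * L / e" using L e by simp
    then show ?thesis unfolding m_def by linarith
  qed
  have u: "u \<ge> 1" using e by (simp add: u_def)
  have "2 * ln (card C) \<le> e * real m" using m1 e by (simp add: L_def field_simps)
  from separating_sample[OF Q e sep this] obtain U
    where U: "U \<subseteq> Q" "card U \<le> m" "inj_on (\<lambda>A. A \<inter> U) C" by blast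
  define C' where "C' = (\<lambda>A. A \<inter> U) ` C"
  have "shatters C W" if W: "W \<subseteq> U" "shatters C' W" for W
    unfolding shatters_def
  proof (intro allI impI)
    fix B assume "B \<subseteq> W"
    then obtain A where "A \<in> C" "W \<inter> (A \<inter> U) = B"
      using shattersD[OF W(2)] unfolding C'_def by blast
    then show "\<exists>S\<in>C. W \<inter> S = B" using W(1) by (intro bexI[of _ A]) auto
  qed
  then have "real (card C') \<le> u ^ v * exp (real (card U) / u)"
    using U Q(1) v by (intro sauer_exp u) (auto simp: C'_def intro: finite_subset)
  also have "\<dots> \<le> u ^ v * exp (real m / u)" using U(2) u by (simp add: divide_right_mono)
  finally have "exp L \<le> u ^ v * exp (real m / u)"
    using U(3) cC by (simp add: C'_def card_image L_def)
  also have "\<dots> = exp (v * ln u + m / u)"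
    using u by (simp add: exp_add exp_of_nat_mult)
  finally have "L \<le> v * ln u + m / u" by simp
  also have "m / u \<le> (2 * L / e + 1) / u" using m2 u by (intro divide_right_mono) auto
  also have "\<dots> = L / 2 + e / 4" using e by (simp add: u_def field_simps)
  finally have "L \<le> 2 * v * ln u + e / 2" by simp
  also have "\<dots> \<le> 2 * real v * ln (4 / e) + 1 / 2" using e by (simp add: u_def)
  finally show ?thesis by (simp add: L_def)
qed

section \<open>Rademacher averages of families of sets\<close>

lemma shatters_mono:
  assumes "C \<subseteq> D" "shatters C A"
  shows "shatters D A"
  unfolding shatters_def
proof (intro allI impI)
  fix B assume "B \<subseteq> A"
  with shattersD[OF assms(2)] show "\<exists>S\<in>D. A \<inter> S = B" using assms(1) by blast
qed

text \<open>
  A sign vector is encoded by the set \<open>E\<close> of its positive positions. Averages over signs become sums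
  over \<open>Pow T\<close> divided by \<open>2 ^ card T\<close>.
\<close>

definition rsign :: "'i set \<Rightarrow> 'i \<Rightarrow> real" where
  "rsign E l = (if l \<in> E then 1 else - 1)"

lemma cosh_le_exp_half_square:
  fixes x :: real
  shows "cosh x \<le> exp (x\<^sup>2 / 2)"
proof -
  have tanh_le: "tanh y \<le> y" if "0 \<le> y" for y :: real
  proof -
    have "0 - tanh 0 \<le> y - tanh y"
    proof (rule DERIV_nonneg_imp_nondecreasing[OF that, where f = "\<lambda>y. y - tanh y"])
      fix z :: real
      have "((\<lambda>y. y - tanh y) has_real_derivative (tanh z)\<^sup>2) (at z)"
        by (auto intro!: derivative_eq_intros)
      then show "\<exists>d. ((\<lambda>y. y - tanh y) has_real_derivative d) (at z) \<and> 0 \<le> d"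
        by (intro exI[of _ "(tanh z)\<^sup>2"]) auto
    qed
    then show ?thesis by simp
  qed
  have pos: "cosh y \<le> exp (y\<^sup>2 / 2)" if "0 \<le> y" for y :: real
  proof -
    have "0\<^sup>2 / 2 - ln (cosh 0) \<le> y\<^sup>2 / 2 - ln (cosh y)"
    proof (rule DERIV_nonneg_imp_nondecreasing[OF that, where f = "\<lambda>y. y\<^sup>2 / 2 - ln (cosh y)"])
      fix z :: real assume "0 \<le> z"
      have "((\<lambda>y. y\<^sup>2 / 2 - ln (cosh y)) has_real_derivative (z - tanh z)) (at z)"
        by (auto intro!: derivative_eq_intros simp: tanh_def cosh_real_pos)
      then show "\<exists>d. ((\<lambda>y. y\<^sup>2 / 2 - ln (cosh y)) has_real_derivative d) (at z) \<and> 0 \<le> d"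
        using tanh_le[OF \<open>0 \<le> z\<close>] by (intro exI[of _ "z - tanh z"]) auto
    qed
    then have "ln (cosh y) \<le> y\<^sup>2 / 2" by simp
    then show ?thesis by (metis cosh_real_pos exp_le_cancel_iff exp_ln)
  qed
  show ?thesis
  proof (cases "0 \<le> x")
    case False
    then show ?thesis using pos[of "- x"] by simp
  qed (rule pos)
qed

text \<open>
  The moment generating function of a Rademacher sum, by independence of the signs and
  \<open>cosh x \<le> exp (x\<^sup>2 / 2)\<close>.
\<close>

lemma sum_sign_exp_le:
  fixes a :: "'i \<Rightarrow> real"
  assumes "finite T"
  shows "(\<Sum>E\<in>Pow T. exp (\<Sum>l\<in>T. rsign E l * a l)) \<le> 2 ^ card T * exp ((\<Sum>l\<in>T. (a l)\<^sup>2) / 2)"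
proof -
  have "exp (\<Sum>l\<in>T. rsign E l * a l) = (\<Prod>l\<in>E. exp (a l)) * (\<Prod>l\<in>T - E. exp (- a l))"
    if "E \<in> Pow T" for E
  proof -
    have "(\<Sum>l\<in>T. rsign E l * a l) = (\<Sum>l\<in>E. rsign E l * a l) + (\<Sum>l\<in>T - E. rsign E l * a l)"
      using that assms by (subst sum.subset_diff[of E]) (auto simp: add.commute)
    also have "(\<Sum>l\<in>E. rsign E l * a l) = (\<Sum>l\<in>E. a l)"
      by (rule sum.cong) (auto simp: rsign_def)
    also have "(\<Sum>l\<in>T - E. rsign E l * a l) = (\<Sum>l\<in>T - E. - a l)"
      by (rule sum.cong) (auto simp: rsign_def)
    finally show ?thesis using that assms by (simp add: exp_add exp_sum finite_subset)
  qed
  then have "(\<Sum>E\<in>Pow T. exp (\<Sum>l\<in>T. rsign E l * a l)) = (\<Prod>l\<in>T. exp (a l) + exp (- a l))"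
    using assms by (simp add: prod_add)
  also have "\<dots> \<le> (\<Prod>l\<in>T. 2 * exp ((a l)\<^sup>2 / 2))"
  proof (intro prod_mono conjI)
    fix i
    show "0 \<le> exp (a i) + exp (- a i)" by (simp add: add_nonneg_nonneg)
    show "exp (a i) + exp (- a i) \<le> 2 * exp ((a i)\<^sup>2 / 2)"
      using cosh_le_exp_half_square[of "a i"] by (simp add: cosh_def)
  qed
  also have "\<dots> = 2 ^ card T * exp ((\<Sum>l\<in>T. (a l)\<^sup>2) / 2)"
    using assms by (simp add: prod.distrib exp_sum sum_divide_distrib)
  finally show ?thesis .
qed

text \<open>
  Massart's finite class lemma. The maximum over \<open>W\<close> is expressed by an arbitrary choice \<open>w E \<in> W\<close>
  for every sign pattern \<open>E\<close>; this form survives chaining and needs no attained suprema.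
\<close>

lemma massart_choice:
  fixes a :: "'w \<Rightarrow> 'i \<Rightarrow> real"
  assumes T: "finite T" and W: "finite W" and lam: "lam > 0"
    and R: "\<And>w. w \<in> W \<Longrightarrow> (\<Sum>l\<in>T. (a w l)\<^sup>2) \<le> R"
    and pick: "\<And>E. E \<subseteq> T \<Longrightarrow> w E \<in> W"
  shows "(\<Sum>E\<in>Pow T. \<bar>\<Sum>l\<in>T. rsign E l * a (w E) l\<bar>)
      \<le> 2 ^ card T * (ln (2 * card W) / lam + lam * R / 2)"
proof -
  define X where "X E u = (\<Sum>l\<in>T. rsign E l * a u l)" for E u
  (* The tangent of ln at y bounds lam * |X| linearly in exp (lam * |X|), so that averaging over E
     replaces Jensen's inequality. This y is the bound for the averaged exponential, which makes
     the tangent step lossless. *)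
  define y where "y = 2 * card W * exp (lam\<^sup>2 * R / 2)"
  have "W \<noteq> {}" using pick by auto
  then have cW: "card W > 0" using W by (simp add: card_gt_0_iff)
  then have y: "y > 0" by (simp add: y_def)
  have 1: "lam * \<bar>X E (w E)\<bar> \<le> ln y - 1 + (\<Sum>u\<in>W. exp (lam * X E u) + exp (- (lam * X E u))) / y"
    if "E \<in> Pow T" for E
  proof -
    have "exp (lam * \<bar>X E (w E)\<bar>) \<le> exp (lam * X E (w E)) + exp (- (lam * X E (w E)))"
      by (cases "X E (w E) \<ge> 0") auto
    also have "\<dots> \<le> (\<Sum>u\<in>W. exp (lam * X E u) + exp (- (lam * X E u)))"
      using pick that W
      by (intro member_le_sum[where f = "\<lambda>u. exp (lam * X E u) + exp (- (lam * X E u))"])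
        (auto simp: add_nonneg_nonneg)
    finally have "exp (lam * \<bar>X E (w E)\<bar>) / y
        \<le> (\<Sum>u\<in>W. exp (lam * X E u) + exp (- (lam * X E u))) / y"
      using y by (intro divide_right_mono) auto
    moreover have "ln (exp (lam * \<bar>X E (w E)\<bar>) / y) \<le> exp (lam * \<bar>X E (w E)\<bar>) / y - 1"
      using y by (intro ln_le_minus_one) auto
    ultimately show ?thesis using y by (simp add: ln_div)
  qed
  have 2: "(\<Sum>E\<in>Pow T. exp (lam * X E u) + exp (- (lam * X E u)))
      \<le> 2 ^ card T * (2 * exp (lam\<^sup>2 * R / 2))" if "u \<in> W" for u
  proof -
    have *: "(\<Sum>E\<in>Pow T. exp (c * X E u)) \<le> 2 ^ card T * exp (lam\<^sup>2 * R / 2)"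
      if "c\<^sup>2 = lam\<^sup>2" for c
    proof -
      have "(\<Sum>E\<in>Pow T. exp (c * X E u)) = (\<Sum>E\<in>Pow T. exp (\<Sum>l\<in>T. rsign E l * (c * a u l)))"
        by (simp add: X_def sum_distrib_left mult_ac)
      also have "\<dots> \<le> 2 ^ card T * exp ((\<Sum>l\<in>T. (c * a u l)\<^sup>2) / 2)"
        by (rule sum_sign_exp_le) fact
      also have "(\<Sum>l\<in>T. (c * a u l)\<^sup>2) = lam\<^sup>2 * (\<Sum>l\<in>T. (a u l)\<^sup>2)"
        using that by (simp add: power_mult_distrib sum_distrib_left)
      also have "2 ^ card T * exp (lam\<^sup>2 * (\<Sum>l\<in>T. (a u l)\<^sup>2) / 2) \<le> 2 ^ card T * exp (lam\<^sup>2 * R / 2)"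
        using R[OF \<open>u \<in> W\<close>] by (simp add: mult_left_mono)
      finally show ?thesis .
    qed
    from *[of lam] *[of "- lam"] show ?thesis by (simp add: sum.distrib)
  qed
  have "lam * (\<Sum>E\<in>Pow T. \<bar>X E (w E)\<bar>)
      \<le> (\<Sum>E\<in>Pow T. ln y - 1 + (\<Sum>u\<in>W. exp (lam * X E u) + exp (- (lam * X E u))) / y)"
    unfolding sum_distrib_left by (intro sum_mono 1)
  also have "\<dots> = 2 ^ card T * (ln y - 1)
      + (\<Sum>u\<in>W. \<Sum>E\<in>Pow T. exp (lam * X E u) + exp (- (lam * X E u))) / y"
    by (subst sum.swap) (simp add: sum.distrib card_Pow T flip: sum_divide_distrib)
  also have "\<dots> \<le> 2 ^ card T * (ln y - 1) + (\<Sum>u\<in>W. 2 ^ card T * (2 * exp (lam\<^sup>2 * R / 2))) / y"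
    using y by (intro add_left_mono divide_right_mono sum_mono 2) auto
  also have "\<dots> = 2 ^ card T * ln y" using cW by (simp add: y_def field_simps)
  also have "ln y = ln (2 * card W) + lam\<^sup>2 * R / 2"
    using cW by (simp add: y_def ln_mult)
  finally have "(\<Sum>E\<in>Pow T. \<bar>X E (w E)\<bar>) \<le> 2 ^ card T * (ln (2 * card W) + lam\<^sup>2 * R / 2) / lam"
    using lam by (simp add: field_simps)
  also have "\<dots> = 2 ^ card T * (ln (2 * card W) / lam + lam * R / 2)"
    using lam by (simp add: field_simps power2_eq_square)
  finally show ?thesis by (simp add: X_def)
qed

lemma maximal_separated:
  assumes C: "finite C" and refl: "\<And>x. x \<in> C \<Longrightarrow> near x x"
    and sym: "\<And>x y. near x y \<Longrightarrow> near y x"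
  shows "\<exists>D\<subseteq>C. (\<forall>x\<in>D. \<forall>y\<in>D. x \<noteq> y \<longrightarrow> \<not> near x y) \<and> (\<forall>x\<in>C. \<exists>y\<in>D. near x y)"
proof -
  define S where "S = {D. D \<subseteq> C \<and> (\<forall>x\<in>D. \<forall>y\<in>D. x \<noteq> y \<longrightarrow> \<not> near x y)}"
  have "finite S" by (rule finite_subset[of _ "Pow C"]) (use C in \<open>auto simp: S_def\<close>)
  moreover have "{} \<in> S" by (simp add: S_def)
  ultimately obtain D where D: "D \<in> S" "\<And>D'. D' \<in> S \<Longrightarrow> D \<subseteq> D' \<Longrightarrow> D = D'"
    using finite_has_maximal[of S] by blast
  have "\<exists>y\<in>D. near x y" if x: "x \<in> C" for x
  proof (rule ccontr)
    assume *: "\<not> (\<exists>y\<in>D. near x y)"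
    then have "insert x D \<in> S" using D(1) x sym by (auto simp: S_def)
    then have "x \<in> D" using D(2) by blast
    with * refl[OF x] show False by blast
  qed
  with D(1) show ?thesis by (auto simp: S_def intro!: exI[of _ D])
qed

lemma chaining_level:
  assumes "finite Q" "Q \<noteq> {}" "D \<subseteq> Pow Q" "D \<noteq> {}"
    and sep: "\<And>A B. A \<in> D \<Longrightarrow> B \<in> D \<Longrightarrow> A \<noteq> B \<Longrightarrow>
      (1 / 4) ^ j * card Q \<le> card ((A - B) \<union> (B - A))"
    and vc: "\<And>U. U \<subseteq> Q \<Longrightarrow> shatters D U \<Longrightarrow> card U \<le> v" and v: "1 \<le> v"
  shows "ln (2 * card D) \<le> 4 * real v * (j + 1)"
proof -
  have "finite D" using assms by (meson finite_Pow_iff finite_subset)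
  then have cD: "card D > 0" using assms by (simp add: card_gt_0_iff)
  have "ln (card D) \<le> 2 * real v * ln (4 / (1 / 4) ^ j) + 1 / 2"
    by (rule ln_card_packing[OF assms(1-4) _ _ sep vc]) (auto simp: power_le_one)
  also have "(4::real) / (1 / 4) ^ j = 4 ^ (j + 1)" by (simp add: power_one_over)
  also have "ln ((4::real) ^ (j + 1)) = (j + 1) * ln 4" by (rule ln_realpow)
  also have "ln (4::real) = 2 * ln 2" using ln_realpow[of "2::real" 2] by simp
  finally have *: "ln (card D) \<le> 2 * real v * ((j + 1) * (2 * ln 2)) + 1 / 2" .
  define w where "w = real v * real (j + 1)"
  have "ln (2 * card D) = ln 2 + ln (card D)" using cD by (simp add: ln_mult)
  also have "\<dots> \<le> ln 2 + (4 * (ln 2 * w) + 1 / 2)"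
    using * by (simp add: w_def mult_ac)
  finally have "ln (2 * card D) \<le> ln 2 + (4 * (ln 2 * w) + 1 / 2)" .
  moreover have w: "1 \<le> w" unfolding w_def using v mult_mono[of 1 "real v" 1 "real (j + 1)"] by simp
  moreover have "ln 2 * w \<le> 25 / 36 * w"
    using w ln2_le_25_over_36 by (intro mult_right_mono) auto
  ultimately have "ln (2 * card D) \<le> 4 * w" using ln2_le_25_over_36 by argo
  then show ?thesis by (simp add: w_def mult.assoc add.commute)
qed

text \<open>
  Chaining. For every \<open>j\<close> let \<open>D j\<close> be a maximal subfamily with distances at least
  \<open>(1 / 4) ^ j * card Q\<close>. Passing from a member of \<open>D (Suc i)\<close> to a near one in \<open>D i\<close> costs, by
  Massart's lemma and the packing bound, of order \<open>(1 / 2) ^ i * (i + 1) * sqrt (v * card Q)\<close>, which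
  is summable, and \<open>D j\<close> is the whole family once the distances drop below 1.
\<close>

lemma rademacher_vc_sets:
  assumes T: "finite T" "Q \<subseteq> T" and C: "C \<subseteq> Pow Q"
    and vc: "\<And>U. U \<subseteq> Q \<Longrightarrow> shatters C U \<Longrightarrow> card U \<le> v" and v: "1 \<le> v"
    and pick: "\<And>E. E \<subseteq> T \<Longrightarrow> A E \<in> C"
  shows "(\<Sum>E\<in>Pow T. \<bar>\<Sum>l\<in>T. rsign E l * of_bool (l \<in> A E)\<bar>) \<le> 2 ^ card T * (20 * sqrt (v * card Q))"
proof (cases "Q = {}")
  case True
  have "(\<Sum>l\<in>T. rsign E l * of_bool (l \<in> A E)) = 0" if "E \<in> Pow T" for E
    using pick[of E] C that True by (intro sum.neutral) auto
  then show ?thesis by simp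
next
  case False
  define q where "q = real (card Q)"
  define s where "s = sqrt (v * q)"
  define dist where "dist A B = card ((A - B) \<union> (B - A))" for A B :: "'a set"
  define near where "near j A B \<longleftrightarrow> real (dist A B) < (1 / 4) ^ j * q" for j :: nat and A B :: "'a set"
  have finQ: "finite Q" using T finite_subset by blast
  have finC: "finite C" using C finQ by (meson finite_Pow_iff finite_subset)
  have Cne: "C \<noteq> {}" using pick by blast
  have q: "q > 0" using False finQ by (simp add: q_def card_gt_0_iff)
  have s: "s > 0" using v q by (simp add: s_def)
  have "\<forall>j. \<exists>D. D \<subseteq> C \<and> (\<forall>A\<in>D. \<forall>B\<in>D. A \<noteq> B \<longrightarrow> \<not> near j A B) \<and> (\<forall>A\<in>C. \<exists>B\<in>D. near j A B)"
  proof
    fix j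
    have "near j A A" if "A \<in> C" for A using q by (simp add: near_def dist_def)
    moreover have "near j B A" if "near j A B" for A B
      using that by (simp add: near_def dist_def Un_commute)
    ultimately show "\<exists>D. D \<subseteq> C \<and> (\<forall>A\<in>D. \<forall>B\<in>D. A \<noteq> B \<longrightarrow> \<not> near j A B) \<and> (\<forall>A\<in>C. \<exists>B\<in>D. near j A B)"
      by (intro maximal_separated finC)
  qed
  then obtain D where D0: "\<forall>j. D j \<subseteq> C \<and> (\<forall>A\<in>D j. \<forall>B\<in>D j. A \<noteq> B \<longrightarrow> \<not> near j A B)
      \<and> (\<forall>A\<in>C. \<exists>B\<in>D j. near j A B)"
    by (rule choice[THEN exE])
  then have D: "\<And>j. D j \<subseteq> C"
    "\<And>j A B. A \<in> D j \<Longrightarrow> B \<in> D j \<Longrightarrow> A \<noteq> B \<Longrightarrow> \<not> near j A B"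
    "\<And>j A. A \<in> C \<Longrightarrow> \<exists>B\<in>D j. near j A B"
    by simp_all
  have finD: "finite (D j)" for j using D(1) finC finite_subset by blast
  have lnD: "ln (2 * card (D j)) \<le> 4 * real v * (j + 1)" for j
  proof (rule chaining_level[OF finQ False _ _ _ _ v])
    show "D j \<subseteq> Pow Q" using D(1) C by blast
    show "D j \<noteq> {}" using D(3) Cne by blast
    show "(1 / 4) ^ j * real (card Q) \<le> card ((A - B) \<union> (B - A))"
      if "A \<in> D j" "B \<in> D j" "A \<noteq> B" for A B
      using D(2)[OF that] by (simp add: near_def dist_def q_def)
    show "card U \<le> v" if "U \<subseteq> Q" "shatters (D j) U" for U
      using vc[OF that(1) shatters_mono[OF D(1) that(2)]] .
  qed
  have sq: "(\<Sum>l\<in>T. (of_bool (l \<in> A) - of_bool (l \<in> B))\<^sup>2) = real (dist A B)"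
    if "A \<subseteq> T" "B \<subseteq> T" for A B
  proof -
    have "(\<Sum>l\<in>T. (of_bool (l \<in> A) - of_bool (l \<in> B))\<^sup>2) = (\<Sum>l\<in>T. of_bool (l \<in> (A - B) \<union> (B - A)) :: real)"
      by (intro sum.cong) (auto simp: of_bool_def)
    also have "\<dots> = (\<Sum>l\<in>(A - B) \<union> (B - A). 1)"
      by (rule sum.mono_neutral_cong_right) (use T that in auto)
    also have "\<dots> = real (dist A B)" by (simp add: dist_def)
    finally show ?thesis .
  qed
  have vq: "real v / (2 ^ i * sqrt (v / q)) = s * (1 / 2) ^ i"
    "2 ^ i * sqrt (v / q) * q = 2 ^ i * s" for i :: nat
  proof -
    have "sqrt (v / q) * s = sqrt (v / q * (v * q))" unfolding s_def by (rule real_sqrt_mult[symmetric])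
    also have "v / q * (v * q) = (real v)\<^sup>2" using q by (simp add: power2_eq_square)
    finally have 1: "sqrt (v / q) * s = v" by simp
    have "sqrt (v / q) * q = sqrt (v / q) * sqrt (q\<^sup>2)" using q by simp
    also have "\<dots> = sqrt (v / q * q\<^sup>2)" by (rule real_sqrt_mult[symmetric])
    also have "v / q * q\<^sup>2 = v * q" using q by (simp add: power2_eq_square)
    finally have 2: "sqrt (v / q) * q = s" by (simp add: s_def)
    have "sqrt (v / q) > 0" using q v by simp
    then show "real v / (2 ^ i * sqrt (v / q)) = s * (1 / 2) ^ i"
      using q v by (subst 1[symmetric]) (simp add: power_one_over)
    show "2 ^ i * sqrt (v / q) * q = 2 ^ i * s" using 2 by simp
  qed
  have step: "(\<Sum>E\<in>Pow T. \<bar>\<Sum>l\<in>T. rsign E l * a (F E) l\<bar>) \<le> 2 ^ card T * (s * (1 / 2) ^ i * (4 * i + 6))"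
    if F: "\<And>E. E \<subseteq> T \<Longrightarrow> F E \<in> D i"
      and a: "\<And>B. B \<in> D i \<Longrightarrow> (\<Sum>l\<in>T. (a B l)\<^sup>2) \<le> 4 * (1 / 4) ^ i * q" for i :: nat and F a
  proof -
    (* Balances the entropy term v / lam against the variance term lam * (1 / 4) ^ i * q. *)
    define lam where "lam = 2 ^ i * sqrt (v / q)"
    have lam: "lam > 0" using v q by (simp add: lam_def)
    have "(\<Sum>E\<in>Pow T. \<bar>\<Sum>l\<in>T. rsign E l * a (F E) l\<bar>)
        \<le> 2 ^ card T * (ln (2 * card (D i)) / lam + lam * (4 * (1 / 4) ^ i * q) / 2)"
      by (rule massart_choice[OF T(1) finD lam a F])
    also have "\<dots> \<le> 2 ^ card T * (4 * real v * (i + 1) / lam + lam * (4 * (1 / 4) ^ i * q) / 2)"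
      using lnD[of i] lam by (intro mult_left_mono add_right_mono divide_right_mono) (auto simp: add.commute)
    also have "4 * real v * (i + 1) / lam + lam * (4 * (1 / 4) ^ i * q) / 2
        = 4 * (i + 1) * (v / lam) + 2 * (1 / 4) ^ i * (lam * q)"
      by (simp add: algebra_simps add_divide_distrib)
    also have "\<dots> = 4 * (i + 1) * (s * (1 / 2) ^ i) + 2 * (1 / 4) ^ i * (2 ^ i * s)"
      by (simp only: lam_def vq)
    also have "\<dots> = s * (1 / 2) ^ i * (4 * i + 6)"
    proof -
      have "(1 / 4) ^ i * 2 ^ i = ((1 / 2) ^ i :: real)"
        unfolding power_mult_distrib[symmetric] by simp
      then have "2 * (1 / 4) ^ i * (2 ^ i * s) = 2 * (1 / 2) ^ i * s" by (simp only: mult.assoc[symmetric]) (simp add: mult.assoc)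
      then show ?thesis by (simp add: algebra_simps)
    qed
    finally show ?thesis .
  qed
  (* 20 - (1 / 2) ^ i * (4 * i + 14) is the sum of (1 / 2) ^ l * (4 * l + 6) over l <= i. *)
  have chain: "(\<Sum>E\<in>Pow T. \<bar>\<Sum>l\<in>T. rsign E l * of_bool (l \<in> F E)\<bar>)
      \<le> 2 ^ card T * (s * (20 - (1 / 2) ^ i * (4 * i + 14)))"
    if "\<And>E. E \<subseteq> T \<Longrightarrow> F E \<in> D i" for i :: nat and F
    using that
  proof (induction i arbitrary: F)
    case 0
    have "(\<Sum>l\<in>T. (of_bool (l \<in> B))\<^sup>2) \<le> 4 * (1 / 4) ^ 0 * q" if "B \<in> D 0" for B
    proof -
      have B: "B \<subseteq> Q" using that D(1)[of 0] C by auto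
      have "(\<Sum>l\<in>T. (of_bool (l \<in> B))\<^sup>2) = real (card B)"
        using sq[of B "{}"] B T by (auto simp: dist_def)
      also have "\<dots> \<le> q" using card_mono[OF finQ B] by (simp add: q_def)
      finally show ?thesis using q by simp
    qed
    from step[of F 0 "\<lambda>B l. of_bool (l \<in> B)", OF 0 this] show ?case
      by (simp add: mult.commute)
  next
    case (Suc i)
    define pr where "pr A = (SOME B. B \<in> D i \<and> near i A B)" for A
    have pr: "pr A \<in> D i" "near i A (pr A)" if "A \<in> C" for A
      using D(3)[OF that, of i] someI_ex[of "\<lambda>B. B \<in> D i \<and> near i A B"] by (auto simp: pr_def)
    have "(\<Sum>E\<in>Pow T. \<bar>\<Sum>l\<in>T. rsign E l * of_bool (l \<in> F E)\<bar>)
       \<le> (\<Sum>E\<in>Pow T. \<bar>\<Sum>l\<in>T. rsign E l * of_bool (l \<in> pr (F E))\<bar>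
           + \<bar>\<Sum>l\<in>T. rsign E l * (of_bool (l \<in> F E) - of_bool (l \<in> pr (F E)))\<bar>)"
      by (intro sum_mono) (simp add: right_diff_distrib sum_subtractf)
    also have "\<dots> = (\<Sum>E\<in>Pow T. \<bar>\<Sum>l\<in>T. rsign E l * of_bool (l \<in> pr (F E))\<bar>)
      + (\<Sum>E\<in>Pow T. \<bar>\<Sum>l\<in>T. rsign E l * (of_bool (l \<in> F E) - of_bool (l \<in> pr (F E)))\<bar>)"
      by (rule sum.distrib)
    also have "\<dots> \<le> 2 ^ card T * (s * (20 - (1 / 2) ^ i * (4 * i + 14)))
      + 2 ^ card T * (s * (1 / 2) ^ Suc i * (4 * Suc i + 6))"
    proof (intro add_mono)
      show "(\<Sum>E\<in>Pow T. \<bar>\<Sum>l\<in>T. rsign E l * of_bool (l \<in> pr (F E))\<bar>)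
        \<le> 2 ^ card T * (s * (20 - (1 / 2) ^ i * (4 * i + 14)))"
        using Suc.prems D(1) by (intro Suc.IH pr(1)) blast
      have "(\<Sum>l\<in>T. (of_bool (l \<in> B) - of_bool (l \<in> pr B))\<^sup>2) \<le> 4 * (1 / 4) ^ Suc i * q"
        if "B \<in> D (Suc i)" for B
      proof -
        have BC: "B \<in> C" using that D(1) by blast
        have "B \<subseteq> T" "pr B \<subseteq> T" using BC pr(1)[OF BC] D(1) C T(2) by blast+
        then show ?thesis using pr(2)[OF BC] by (simp add: sq near_def)
      qed
      from step[of F "Suc i" "\<lambda>B l. of_bool (l \<in> B) - of_bool (l \<in> pr B)", OF Suc.prems this]
      show "(\<Sum>E\<in>Pow T. \<bar>\<Sum>l\<in>T. rsign E l * (of_bool (l \<in> F E) - of_bool (l \<in> pr (F E)))\<bar>)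
        \<le> 2 ^ card T * (s * (1 / 2) ^ Suc i * (4 * Suc i + 6))" by simp
    qed
    also have "\<dots> = 2 ^ card T * (s * (20 - (1 / 2) ^ Suc i * (4 * Suc i + 14)))"
      by (simp add: field_simps)
    finally show ?case .
  qed
  obtain J where J: "(1 / 4 :: real) ^ J < 1 / q"
    using real_arch_pow_inv[of "1 / q" "1 / 4 :: real"] q by auto
  have "C \<subseteq> D J"
  proof
    fix B assume "B \<in> C"
    then obtain B' where B': "B' \<in> D J" "near J B B'" using D(3) by blast
    have "(1 / 4) ^ J * q < 1" using J q by (simp add: field_simps)
    with B'(2) have "dist B B' = 0" by (simp add: near_def)
    moreover have "B \<subseteq> Q" "B' \<subseteq> Q" using \<open>B \<in> C\<close> B'(1) D(1)[of J] C by auto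
    then have "finite B" "finite B'" using finQ by (simp_all add: finite_subset)
    ultimately have "B = B'" by (auto simp: dist_def)
    with B'(1) show "B \<in> D J" by simp
  qed
  then have "(\<Sum>E\<in>Pow T. \<bar>\<Sum>l\<in>T. rsign E l * of_bool (l \<in> A E)\<bar>)
      \<le> 2 ^ card T * (s * (20 - (1 / 2) ^ J * (4 * J + 14)))"
    using pick by (intro chain) blast
  also have "\<dots> \<le> 2 ^ card T * (20 * s)" using s by (intro mult_left_mono) (auto simp: algebra_simps)
  finally show ?thesis by (simp add: s_def q_def)
qed

section \<open>Rademacher averages of function classes\<close>

text \<open>
  The VC dimension is bounded separately at each level \<open>s\<close>. The subgraphs, whose points may
  have different heights, have at least this dimension.
\<close>

definition level_vc :: "'a set \<Rightarrow> ('a \<Rightarrow> real) set \<Rightarrow> nat \<Rightarrow> bool" where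
  "level_vc Z F v \<longleftrightarrow>
     (\<forall>s A. finite A \<longrightarrow> shatters ((\<lambda>f. {z \<in> Z. s < f z}) ` F) A \<longrightarrow> card A \<le> v)"

text \<open>
  Points may coincide, so the family lives on the index set. An index set shattered by level sets
  has distinct points, since equal points are always picked together.
\<close>

lemma rademacher_level_sets:
  assumes T: "finite T" "Q \<subseteq> T" and F: "level_vc Z F v" and v: "1 \<le> v"
    and z: "\<And>l. l \<in> T \<Longrightarrow> z l \<in> Z"
    and pick: "\<And>E. E \<subseteq> T \<Longrightarrow> f E \<in> F"
  shows "(\<Sum>E\<in>Pow T. \<bar>\<Sum>l\<in>T. rsign E l * of_bool (l \<in> Q \<and> s < f E (z l))\<bar>)
      \<le> 2 ^ card T * (20 * sqrt (v * card Q))"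
proof -
  define C where "C = (\<lambda>g. {l \<in> Q. s < g (z l)}) ` F"
  have vc: "card U \<le> v" if U: "U \<subseteq> Q" "shatters C U" for U
  proof -
    have finU: "finite U" by (rule finite_subset[OF U(1) finite_subset[OF T(2,1)]])
    have trace: "\<exists>g\<in>F. \<forall>l\<in>U. s < g (z l) \<longleftrightarrow> l \<in> B" if "B \<subseteq> U" for B
    proof -
      from shattersD[OF U(2) that] obtain g where "g \<in> F" "U \<inter> {l \<in> Q. s < g (z l)} = B"
        by (auto simp: C_def)
      then show ?thesis using U(1) by (intro bexI[of _ g]) auto
    qed
    have "inj_on z U"
    proof (rule inj_onI)
      fix x y assume xy: "x \<in> U" "y \<in> U" "z x = z y"
      from trace[of "{x}"] xy obtain g where g: "\<forall>l\<in>U. s < g (z l) \<longleftrightarrow> l \<in> {x}" by auto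
      have "s < g (z x)" using bspec[OF g xy(1)] by simp
      then show "x = y" using bspec[OF g xy(2)] unfolding xy(3) by simp
    qed
    then have "card U = card (z ` U)" by (simp add: card_image)
    also have "\<dots> \<le> v"
    proof -
      have "shatters ((\<lambda>f. {z \<in> Z. s < f z}) ` F) (z ` U)"
        unfolding shatters_def
      proof (intro allI impI)
        fix B' assume B': "B' \<subseteq> z ` U"
        from trace[of "{l \<in> U. z l \<in> B'}"] obtain g
          where g: "g \<in> F" "\<forall>l\<in>U. s < g (z l) \<longleftrightarrow> z l \<in> B'" by auto
        have "z ` U \<subseteq> Z" using z U(1) T(2) by blast
        then have "z ` U \<inter> {x \<in> Z. s < g x} = B'" using B' g(2) by auto
        then show "\<exists>S\<in>(\<lambda>f. {z \<in> Z. s < f z}) ` F. z ` U \<inter> S = B'" using g(1) by blast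
      qed
      then show ?thesis using F finU by (simp add: level_vc_def)
    qed
    finally show ?thesis .
  qed
  have "(\<Sum>E\<in>Pow T. \<bar>\<Sum>l\<in>T. rsign E l * of_bool (l \<in> {l \<in> Q. s < f E (z l)})\<bar>)
      \<le> 2 ^ card T * (20 * sqrt (v * card Q))"
    by (rule rademacher_vc_sets[where C = C, OF T _ vc v]) (use pick in \<open>auto simp: C_def\<close>)
  then show ?thesis by simp
qed

lemma lborel_integrable_indicator_ico: "integrable lborel (indicator {a..<b::real} :: real \<Rightarrow> real)"
  by (intro integrable_real_indicator) (cases "a \<le> b"; simp)+

text \<open>
  Layer cake: \<open>f z\<close> is the integral over \<open>s\<close> of the indicator of \<open>s < f z\<close>, so the average for
  functions is at most the integral over \<open>s\<close> of the averages for the level sets.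
\<close>

lemma rademacher_vc_functions:
  assumes T: "finite T" "Q \<subseteq> T" and F: "level_vc Z F v" and v: "1 \<le> v"
    and z: "\<And>l. l \<in> T \<Longrightarrow> z l \<in> Z"
    and pick: "\<And>E. E \<subseteq> T \<Longrightarrow> f E \<in> F"
    and range: "\<And>g x. g \<in> F \<Longrightarrow> x \<in> Z \<Longrightarrow> 0 \<le> g x \<and> g x \<le> 1"
  shows "(\<Sum>E\<in>Pow T. \<bar>\<Sum>l\<in>T. rsign E l * (f E (z l) * of_bool (l \<in> Q))\<bar>)
      \<le> 2 ^ card T * (20 * sqrt (v * card Q))"
proof -
  define c where "c = 2 ^ card T * (20 * sqrt (v * card Q))"
  define J where "J E l s = rsign E l * (of_bool (l \<in> Q) * indicator {0..<f E (z l)} s)" for E l and s :: real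
  have int_J: "integrable lborel (J E l)" for E l
    unfolding J_def using lborel_integrable_indicator_ico by (intro integrable_mult_right) auto
  have val: "rsign E l * (f E (z l) * of_bool (l \<in> Q)) = (LINT s|lborel. J E l s)"
    if "E \<subseteq> T" "l \<in> T" for E l
    unfolding J_def using range[OF pick[OF that(1)] z[OF that(2)]] by (simp add: mult_ac)
  have int_abs: "integrable lborel (\<lambda>s. \<bar>\<Sum>l\<in>T. J E l s\<bar>)" for E
    using int_J by (intro integrable_abs Bochner_Integration.integrable_sum) auto
  have "(\<Sum>E\<in>Pow T. \<bar>\<Sum>l\<in>T. rsign E l * (f E (z l) * of_bool (l \<in> Q))\<bar>)
      = (\<Sum>E\<in>Pow T. \<bar>\<Sum>l\<in>T. LINT s|lborel. J E l s\<bar>)"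
    using val by (intro sum.cong arg_cong[where f = abs]) auto
  also have "\<dots> = (\<Sum>E\<in>Pow T. \<bar>LINT s|lborel. (\<Sum>l\<in>T. J E l s)\<bar>)"
    using int_J by (simp add: Bochner_Integration.integral_sum)
  also have "\<dots> \<le> (\<Sum>E\<in>Pow T. LINT s|lborel. \<bar>\<Sum>l\<in>T. J E l s\<bar>)"
    by (intro sum_mono integral_abs_bound)
  also have "\<dots> = (LINT s|lborel. (\<Sum>E\<in>Pow T. \<bar>\<Sum>l\<in>T. J E l s\<bar>))"
    using int_abs by (simp add: Bochner_Integration.integral_sum)
  also have "\<dots> \<le> (LINT s|lborel. indicator {0..<1::real} s * c)"
  proof (rule Bochner_Integration.integral_mono)
    show "integrable lborel (\<lambda>s. \<Sum>E\<in>Pow T. \<bar>\<Sum>l\<in>T. J E l s\<bar>)"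
      using int_abs by (intro Bochner_Integration.integrable_sum) auto
    show "integrable lborel (\<lambda>s. indicator {0..<1::real} s * c)" by simp
    fix s :: real
    show "(\<Sum>E\<in>Pow T. \<bar>\<Sum>l\<in>T. J E l s\<bar>) \<le> indicator {0..<1} s * c"
    proof (cases "0 \<le> s \<and> s < 1")
      case True
      then have "J E l s = rsign E l * of_bool (l \<in> Q \<and> s < f E (z l))" for E l
        by (simp add: J_def indicator_def)
      then show ?thesis
        using rademacher_level_sets[where s = s, OF T F v z pick] True by (simp add: c_def)
    next
      case False
      have "J E l s = 0" if "E \<subseteq> T" "l \<in> T" for E l
        using range[OF pick[OF that(1)] z[OF that(2)]] False by (auto simp: J_def indicator_def)
      then have "(\<Sum>E\<in>Pow T. \<bar>\<Sum>l\<in>T. J E l s\<bar>) = 0" by simp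
      then show ?thesis using False by (auto simp: indicator_def)
    qed
  qed
  also have "\<dots> = c" by simp
  finally show ?thesis by (simp add: c_def)
qed

lemma (in finite_measure) integrable_bounded:
  fixes f :: "'a \<Rightarrow> real"
  assumes "f \<in> borel_measurable M" "\<And>x. x \<in> space M \<Longrightarrow> \<bar>f x\<bar> \<le> C"
  shows "integrable M f"
  using assms by (intro integrable_const_bound[of f C]) auto

context prob_space
begin

lemma prob_space_power: "prob_space (Pi\<^sub>M K (\<lambda>_. M))"
  by (intro prob_space_PiM prob_space_axioms)

lemma integral_PiM_component:
  fixes h :: "'a \<Rightarrow> real"
  assumes "i \<in> K" "h \<in> borel_measurable M"
  shows "(LINT w|Pi\<^sub>M K (\<lambda>_. M). h (w i)) = (LINT z|M. h z)"
proof -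
  have "(LINT z|M. h z) = (LINT z|distr (Pi\<^sub>M K (\<lambda>_. M)) M (\<lambda>w. w i). h z)"
    using distr_PiM_component[of K "\<lambda>_. M" i] prob_space_axioms assms(1) by simp
  also have "\<dots> = (LINT w|Pi\<^sub>M K (\<lambda>_. M). h (w i))"
    using assms by (intro integral_distr) auto
  finally show ?thesis by simp
qed

lemma integral_PiM_permute:
  fixes \<Phi> :: "('i \<Rightarrow> 'a) \<Rightarrow> real"
  assumes "inj_on \<pi> K" "\<pi> \<in> K \<rightarrow> K" "\<Phi> \<in> borel_measurable (Pi\<^sub>M K (\<lambda>_. M))"
  shows "(LINT w|Pi\<^sub>M K (\<lambda>_. M). \<Phi> (\<lambda>i\<in>K. w (\<pi> i))) = (LINT w|Pi\<^sub>M K (\<lambda>_. M). \<Phi> w)"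
proof -
  have meas: "(\<lambda>w. \<lambda>i\<in>K. w (\<pi> i)) \<in> Pi\<^sub>M K (\<lambda>_. M) \<rightarrow>\<^sub>M Pi\<^sub>M K (\<lambda>_. M)"
    using assms(2) by (intro measurable_restrict measurable_component_singleton) auto
  have "(LINT w|Pi\<^sub>M K (\<lambda>_. M). \<Phi> w)
      = (LINT w|distr (Pi\<^sub>M K (\<lambda>_. M)) (Pi\<^sub>M K (\<lambda>_. M)) (\<lambda>w. \<lambda>i\<in>K. w (\<pi> i)). \<Phi> w)"
    using distr_PiM_reindex[of K "\<lambda>_. M" \<pi> K] prob_space_axioms assms(1,2) by simp
  also have "\<dots> = (LINT w|Pi\<^sub>M K (\<lambda>_. M). \<Phi> (\<lambda>i\<in>K. w (\<pi> i)))"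
    using meas assms(3) by (rule integral_distr)
  finally show ?thesis by simp
qed

lemma measurable_resample:
  assumes "i \<in> K"
  shows "(\<lambda>(w, z). w(i := z)) \<in> Pi\<^sub>M K (\<lambda>_. M) \<Otimes>\<^sub>M M \<rightarrow>\<^sub>M Pi\<^sub>M K (\<lambda>_. M)"
  unfolding case_prod_beta
  by (rule measurable_fun_upd[where J = K]) (use assms in auto)

lemma integral_PiM_resample:
  fixes \<Phi> :: "('i \<Rightarrow> 'a) \<Rightarrow> real"
  assumes K: "finite K" "i \<in> K" and meas: "\<Phi> \<in> borel_measurable (Pi\<^sub>M K (\<lambda>_. M))"
    and bound: "\<And>w. w \<in> space (Pi\<^sub>M K (\<lambda>_. M)) \<Longrightarrow> \<bar>\<Phi> w\<bar> \<le> C"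
  shows "(LINT w|Pi\<^sub>M K (\<lambda>_. M). \<Phi> w) = (LINT w|Pi\<^sub>M K (\<lambda>_. M). (LINT z|M. \<Phi> (w(i := z))))"
proof -
  interpret PK: prob_space "Pi\<^sub>M K (\<lambda>_. M)" by (rule prob_space_power)
  interpret PP: product_prob_space "\<lambda>_. M" K by unfold_locales
  define K' where "K' = K - {i}"
  have K': "finite K'" "i \<notin> K'" "insert i K' = K" using K by (auto simp: K'_def)
  define \<Psi> where "\<Psi> w = (LINT z|M. \<Phi> (w(i := z)))" for w
  have meas2: "(\<lambda>(w, z). \<Phi> (w(i := z))) \<in> borel_measurable (Pi\<^sub>M K (\<lambda>_. M) \<Otimes>\<^sub>M M)"
    using measurable_compose[OF measurable_resample[OF K(2)] meas] by (simp add: case_prod_beta)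
  have measPsi: "\<Psi> \<in> borel_measurable (Pi\<^sub>M K (\<lambda>_. M))"
    unfolding \<Psi>_def by (rule borel_measurable_lebesgue_integral) (use meas2 in simp)
  have C: "\<bar>\<Psi> w\<bar> \<le> C" if "w \<in> space (Pi\<^sub>M K (\<lambda>_. M))" for w
  proof -
    have upd: "w(i := z) \<in> space (Pi\<^sub>M K (\<lambda>_. M))" if "z \<in> space M" for z
      using \<open>w \<in> _\<close> that K(2) by (auto simp: space_PiM PiE_def extensional_def Pi_def)
    have "(\<lambda>z. \<Phi> (w(i := z))) \<in> borel_measurable M"
      using measurable_Pair2[OF meas2 that] by simp
    then have int: "integrable M (\<lambda>z. \<Phi> (w(i := z)))"
      using bound upd by (intro integrable_bounded[of _ C]) auto
    have "\<bar>\<Psi> w\<bar> \<le> (LINT z|M. \<bar>\<Phi> (w(i := z))\<bar>)" unfolding \<Psi>_def by (rule integral_abs_bound)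
    also have "\<dots> \<le> (LINT z|M. C)"
      using int bound upd by (intro Bochner_Integration.integral_mono integrable_abs) auto
    finally show ?thesis by (simp add: prob_space)
  qed
  have intPhi: "integrable (Pi\<^sub>M (insert i K') (\<lambda>_. M)) \<Phi>"
    unfolding K'(3) using meas bound by (rule PK.integrable_bounded)
  have intPsi: "integrable (Pi\<^sub>M (insert i K') (\<lambda>_. M)) \<Psi>"
    unfolding K'(3) using measPsi C by (rule PK.integrable_bounded)
  have "(LINT w|Pi\<^sub>M K (\<lambda>_. M). \<Psi> w) = (LINT x|Pi\<^sub>M K' (\<lambda>_. M). (LINT y|M. \<Psi> (x(i := y))))"
    using PP.product_integral_insert[OF K'(1,2) intPsi] by (simp add: K'(3))
  also have "\<dots> = (LINT x|Pi\<^sub>M K' (\<lambda>_. M). (LINT z|M. \<Phi> (x(i := z))))"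
    by (simp add: \<Psi>_def prob_space)
  also have "\<dots> = (LINT w|Pi\<^sub>M K (\<lambda>_. M). \<Phi> w)"
    using PP.product_integral_insert[OF K'(1,2) intPhi] by (simp add: K'(3))
  finally show ?thesis by (simp add: \<Psi>_def)
qed

end

section \<open>Symmetrisation\<close>

context prob_space
begin

text \<open>
  The function \<open>f w\<close> may depend on the whole sample \<open>w\<close>, in particular on the points \<open>w l\<close> at which
  it is evaluated. A ghost sample with indices \<open>{n + 1..2 * n}\<close> replaces its integral by an average
  over independent points. Exchanging \<open>l\<close> with \<open>n + l\<close> for all \<open>l\<close> in a set \<open>E\<close> preserves the joint
  law, so the mean may be averaged over all \<open>E \<subseteq> T\<close>, that is, over signs, for fixed points. There
  the function varies with \<open>E\<close> but stays in \<open>F\<close>.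
\<close>

lemma symmetrized_deviation:
  fixes f :: "(nat \<Rightarrow> 'a) \<Rightarrow> 'a \<Rightarrow> real"
  assumes T: "T \<subseteq> {1..n}" "T \<noteq> {}" and B: "B \<in> events" "0 < prob B"
    and meas: "(\<lambda>(w, z). f w z) \<in> borel_measurable (Pi\<^sub>M {1..n} (\<lambda>_. M) \<Otimes>\<^sub>M M)"
    and inF: "\<And>w. w \<in> space (Pi\<^sub>M {1..n} (\<lambda>_. M)) \<Longrightarrow> f w \<in> F"
    and range: "\<And>g z. g \<in> F \<Longrightarrow> z \<in> space M \<Longrightarrow> 0 \<le> g z \<and> g z \<le> 1"
    and vc: "level_vc (space M) F v" and v: "1 \<le> v"
  shows "(LINT w|Pi\<^sub>M {1..n} (\<lambda>_. M).
      \<bar>(\<Sum>l\<in>T. f w (w l) * indicator B (w l)) - card T * (LINT z|M. f w z * indicator B z)\<bar>)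
      \<le> 40 * sqrt (v * card T * prob B)"
proof -
  define I where "I = {1..n}"
  define J where "J = {n + 1..2 * n}"
  define K where "K = I \<union> J"
  define PI where "PI = Pi\<^sub>M I (\<lambda>_. M)"
  define PJ where "PJ = Pi\<^sub>M J (\<lambda>_. M)"
  define PK where "PK = Pi\<^sub>M K (\<lambda>_. M)"
  define h where "h w z = f w z * indicator B z" for w z
  define \<Phi> where "\<Phi> W = \<bar>\<Sum>l\<in>T. h (restrict W I) (W l) - h (restrict W I) (W (n + l))\<bar>" for W
  have disj: "I \<inter> J = {}" by (auto simp: I_def J_def)
  have finT: "finite T" using T(1) by (rule finite_subset) simp
  have finIJ: "finite I" "finite J" by (auto simp: I_def J_def)
  have TI: "l \<in> I" "l \<in> K" "n + l \<in> J" "n + l \<in> K" if "l \<in> T" for l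
    using that T(1) by (auto simp: I_def J_def K_def)
  interpret PI: prob_space PI unfolding PI_def by (rule prob_space_power)
  interpret PJ: prob_space PJ unfolding PJ_def by (rule prob_space_power)
  interpret PK: prob_space PK unfolding PK_def by (rule prob_space_power)
  interpret PP: product_prob_space "\<lambda>_. M" K by unfold_locales
  have hm: "(\<lambda>x. h (fst x) (snd x)) \<in> borel_measurable (PI \<Otimes>\<^sub>M M)"
    using meas B(1) unfolding h_def PI_def I_def by (simp add: case_prod_beta)
  have hb: "0 \<le> h w z" "h w z \<le> 1" if "w \<in> space PI" "z \<in> space M" for w z
    using range[OF inF that(2), of w] that(1) by (auto simp: h_def PI_def I_def indicator_def)
  have spK: "restrict W I \<in> space PI" "i \<in> K \<Longrightarrow> W i \<in> space M" if "W \<in> space PK" for W i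
    using that by (auto simp: PK_def PI_def space_PiM K_def)
  have hz: "(\<lambda>z. h w z) \<in> borel_measurable M" if "w \<in> space PI" for w
    using measurable_Pair2[OF hm that] by simp
  have hmK: "(\<lambda>W. h (restrict W I) (W i)) \<in> borel_measurable PK" if "i \<in> K" for i
  proof -
    have "(\<lambda>W. (restrict W I, W i)) \<in> PK \<rightarrow>\<^sub>M PI \<Otimes>\<^sub>M M"
      unfolding PK_def PI_def using that
      by (intro measurable_Pair measurable_restrict_subset measurable_component_singleton)
        (auto simp: K_def)
    from measurable_compose[OF this hm] show ?thesis by simp
  qed
  have measPhi: "\<Phi> \<in> borel_measurable PK"
    unfolding \<Phi>_def using hmK TI by (intro borel_measurable_abs borel_measurable_sum borel_measurable_diff) auto
  have boundPhi: "\<bar>\<Phi> W\<bar> \<le> card T" if "W \<in> space PK" for W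
  proof -
    have "\<bar>\<Phi> W\<bar> \<le> (\<Sum>l\<in>T. \<bar>h (restrict W I) (W l) - h (restrict W I) (W (n + l))\<bar>)"
      unfolding \<Phi>_def by (simp add: sum_abs)
    also have "\<dots> \<le> (\<Sum>l\<in>T. 1)"
    proof (rule sum_mono)
      fix l assume "l \<in> T"
      then show "\<bar>h (restrict W I) (W l) - h (restrict W I) (W (n + l))\<bar> \<le> 1"
        using hb[OF spK(1)[OF that] spK(2)[OF that TI(2)]] hb[OF spK(1)[OF that] spK(2)[OF that TI(4)]]
        by (smt (verit))
    qed
    finally show ?thesis by simp
  qed
  have intPhi: "integrable PK \<Phi>" using measPhi boundPhi by (rule PK.integrable_bounded)
  define m where "m w = (LINT z|M. h w z)" for w
  have mb: "0 \<le> m w" "m w \<le> 1" if "w \<in> space PI" for w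
  proof -
    have "integrable M (h w)" using hz[OF that] hb[OF that] by (intro integrable_bounded[of _ 1]) auto
    then show "0 \<le> m w" "m w \<le> 1"
      unfolding m_def using hb[OF that] by (auto intro!: integral_ge_const integral_le_const)
  qed
  have measm: "m \<in> borel_measurable PI"
    unfolding m_def by (rule borel_measurable_lebesgue_integral) (use hm in \<open>simp add: case_prod_beta\<close>)
  (* Averaging over the ghost half of the sample turns the integral m w into ghost points. *)
  have ghost: "(LINT w|PI. \<bar>(\<Sum>l\<in>T. h w (w l)) - card T * m w\<bar>) \<le> (LINT W|PK. \<Phi> W)"
  proof -
    have merge: "merge I J (w, w') l = w l" "merge I J (w, w') (n + l) = w' (n + l)" if "l \<in> T" for w w' l
      using TI[OF that] disj by (auto simp: merge_def)
    have rest: "restrict (merge I J (w, w')) I = w" if "w \<in> space PI" for w w'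
      using that disj by (simp add: PI_def space_PiM PiE_restrict)
    have pointwise: "\<bar>(\<Sum>l\<in>T. h w (w l)) - card T * m w\<bar> \<le> (LINT w'|PJ. \<Phi> (merge I J (w, w')))"
      if w: "w \<in> space PI" for w
    proof -
      have meas': "(\<lambda>w'. h w (w' (n + l))) \<in> borel_measurable PJ" if "l \<in> T" for l
      proof -
        have "(\<lambda>w'. w' (n + l)) \<in> PJ \<rightarrow>\<^sub>M M"
          unfolding PJ_def using TI(3)[OF that] by (rule measurable_component_singleton)
        from measurable_compose[OF this hz[OF w]] show ?thesis .
      qed
      have int': "integrable PJ (\<lambda>w'. h w (w' (n + l)))" if "l \<in> T" for l
      proof (rule PJ.integrable_bounded[OF meas'[OF that], where C = 1])
        fix w' assume "w' \<in> space PJ"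
        then have "w' (n + l) \<in> space M" using TI(3)[OF that] by (auto simp: PJ_def space_PiM)
        then show "\<bar>h w (w' (n + l))\<bar> \<le> 1" using hb[OF w] by simp
      qed
      have int'': "integrable PJ (\<lambda>w'. \<Sum>l\<in>T. h w (w l) - h w (w' (n + l)))"
        using int' by (intro Bochner_Integration.integrable_sum Bochner_Integration.integrable_diff PJ.integrable_const) auto
      have "(LINT w'|PJ. (\<Sum>l\<in>T. h w (w l) - h w (w' (n + l))))
          = (\<Sum>l\<in>T. LINT w'|PJ. h w (w l) - h w (w' (n + l)))"
        using int' by (intro Bochner_Integration.integral_sum) auto
      also have "\<dots> = (\<Sum>l\<in>T. h w (w l) - m w)"
      proof (rule sum.cong[OF refl])
        fix l assume l: "l \<in> T"
        have "(LINT w'|PJ. h w (w' (n + l))) = m w"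
          unfolding PJ_def m_def using TI(3)[OF l] hz[OF w] by (rule integral_PiM_component)
        then show "(LINT w'|PJ. h w (w l) - h w (w' (n + l))) = h w (w l) - m w"
          using int'[OF l] by (simp add: PJ.prob_space)
      qed
      also have "\<dots> = (\<Sum>l\<in>T. h w (w l)) - card T * m w" by (simp add: sum_subtractf)
      finally have "\<bar>(\<Sum>l\<in>T. h w (w l)) - card T * m w\<bar>
          \<le> (LINT w'|PJ. \<bar>\<Sum>l\<in>T. h w (w l) - h w (w' (n + l))\<bar>)"
        using integral_abs_bound[of PJ "\<lambda>w'. \<Sum>l\<in>T. h w (w l) - h w (w' (n + l))"] by simp
      also have "(\<lambda>w'. \<bar>\<Sum>l\<in>T. h w (w l) - h w (w' (n + l))\<bar>) = (\<lambda>w'. \<Phi> (merge I J (w, w')))"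
        unfolding \<Phi>_def rest[OF w]
        by (intro ext arg_cong[where f = abs] sum.cong) (simp_all add: merge)
      finally show ?thesis .
    qed
    have fold: "(LINT W|PK. \<Phi> W) = (LINT w|PI. LINT w'|PJ. \<Phi> (merge I J (w, w')))"
      unfolding PK_def PI_def PJ_def K_def using disj finIJ intPhi[unfolded PK_def K_def]
      by (rule PP.product_integral_fold)
    have measfold: "(\<lambda>w. LINT w'|PJ. \<Phi> (merge I J (w, w'))) \<in> borel_measurable PI"
    proof (rule PJ.borel_measurable_lebesgue_integral)
      have "merge I J \<in> PI \<Otimes>\<^sub>M PJ \<rightarrow>\<^sub>M PK"
        unfolding PI_def PJ_def PK_def K_def by (rule measurable_merge)
      from measurable_compose[OF this measPhi]
      show "(\<lambda>(w, w'). \<Phi> (merge I J (w, w'))) \<in> borel_measurable (PI \<Otimes>\<^sub>M PJ)"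
        by (simp add: case_prod_beta)
    qed
    show ?thesis
      unfolding fold
    proof (rule Bochner_Integration.integral_mono)
      show "integrable PI (\<lambda>w. \<bar>(\<Sum>l\<in>T. h w (w l)) - card T * m w\<bar>)"
      proof (rule PI.integrable_bounded[where C = "2 * card T"])
        have "(\<lambda>w. h w (w l)) \<in> borel_measurable PI" if "l \<in> T" for l
        proof -
          have "(\<lambda>w. w l) \<in> PI \<rightarrow>\<^sub>M M"
            unfolding PI_def using TI(1)[OF that] by (rule measurable_component_singleton)
          then have "(\<lambda>w. (w, w l)) \<in> PI \<rightarrow>\<^sub>M PI \<Otimes>\<^sub>M M" by simp
          from measurable_compose[OF this hm] show ?thesis by simp
        qed
        then show "(\<lambda>w. \<bar>(\<Sum>l\<in>T. h w (w l)) - card T * m w\<bar>) \<in> borel_measurable PI"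
          using measm by (intro borel_measurable_abs borel_measurable_diff borel_measurable_sum borel_measurable_times) auto
        fix w assume w: "w \<in> space PI"
        have "\<bar>\<Sum>l\<in>T. h w (w l)\<bar> \<le> (\<Sum>l\<in>T. 1)"
        proof (rule order_trans[OF sum_abs sum_mono])
          fix l assume "l \<in> T"
          then have "w l \<in> space M" using w TI(1) by (auto simp: PI_def space_PiM)
          then show "\<bar>h w (w l)\<bar> \<le> 1" using hb[OF w] by simp
        qed
        moreover have "\<bar>card T * m w\<bar> \<le> card T" using mb[OF w] by (simp add: abs_mult mult_left_le)
        ultimately show "\<bar>\<bar>(\<Sum>l\<in>T. h w (w l)) - card T * m w\<bar>\<bar> \<le> 2 * card T" by simp
      qed
      show "integrable PI (\<lambda>w. LINT w'|PJ. \<Phi> (merge I J (w, w')))"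
      proof (rule PI.integrable_bounded[OF measfold, where C = "card T"])
        fix w assume w: "w \<in> space PI"
        have sp: "merge I J (w, w') \<in> space PK" if "w' \<in> space PJ" for w'
          using w that by (auto simp: PI_def PJ_def PK_def K_def space_PiM merge_def PiE_def extensional_def)
        have "\<bar>LINT w'|PJ. \<Phi> (merge I J (w, w'))\<bar> \<le> (LINT w'|PJ. \<bar>\<Phi> (merge I J (w, w'))\<bar>)"
          by (rule integral_abs_bound)
        also have "\<dots> \<le> (LINT w'|PJ. card T)"
        proof (rule integral_mono_AE')
          show "integrable PJ (\<lambda>_. real (card T))" by simp
          show "AE w' in PJ. \<bar>\<Phi> (merge I J (w, w'))\<bar> \<le> real (card T)" using sp boundPhi by auto
          show "AE w' in PJ. 0 \<le> real (card T)" by simp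
        qed
        also have "\<dots> = card T" by (simp add: PJ.prob_space)
        finally show "\<bar>LINT w'|PJ. \<Phi> (merge I J (w, w'))\<bar> \<le> card T" .
      qed
    qed (rule pointwise)
  qed
  define perm where "perm E i = (if i \<in> E then n + i else if i \<in> (+) n ` E then i - n else i)" for E and i :: nat
  define sw where "sw E W = (\<lambda>i\<in>K. W (perm E i))" for E and W :: "nat \<Rightarrow> 'a"
  have perm: "inj_on (perm E) K" "perm E \<in> K \<rightarrow> K" if "E \<subseteq> T" for E
  proof -
    have EI: "E \<subseteq> I" using that TI(1) by auto
    then have rng: "1 \<le> j \<and> j \<le> n" if "j \<in> E" for j using that by (auto simp: I_def)
    have a: "n + j \<notin> E" if "j \<in> E" for j using rng[of j] rng[of "n + j"] that by auto
    have cs: "i \<in> E \<or> (\<exists>j\<in>E. i = n + j) \<or> (i \<notin> E \<and> i \<notin> (+) n ` E)" for i by blast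
    have "perm E (perm E i) = i" for i
      using cs[of i] a by (auto simp: perm_def)
    then show "inj_on (perm E) K" by (metis inj_onI)
    show "perm E \<in> K \<rightarrow> K"
    proof
      fix i assume i: "i \<in> K"
      have KI: "K = {1..2 * n}" by (auto simp: K_def I_def J_def)
      show "perm E i \<in> K"
        using cs[of i]
      proof (elim disjE bexE conjE)
        assume "i \<in> E"
        then show ?thesis using rng[of i] KI by (simp add: perm_def)
      next
        fix j assume "j \<in> E" "i = n + j"
        then show ?thesis using rng[of j] a[of j] KI by (simp add: perm_def)
      qed (use i in \<open>simp add: perm_def\<close>)
    qed
  qed
  have sw_space: "sw E W \<in> space PK" if "E \<subseteq> T" "W \<in> space PK" for E W
    using perm(2)[OF that(1)] that(2) by (auto simp: sw_def PK_def space_PiM)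
  have sw_meas: "(\<lambda>W. \<Phi> (sw E W)) \<in> borel_measurable PK" if "E \<subseteq> T" for E
  proof -
    have "sw E \<in> PK \<rightarrow>\<^sub>M PK"
      unfolding sw_def PK_def using perm(2)[OF that]
      by (intro measurable_restrict measurable_component_singleton) auto
    from measurable_compose[OF this measPhi] show ?thesis .
  qed
  have swap: "(LINT W|PK. \<Phi> (sw E W)) = (LINT W|PK. \<Phi> W)" if "E \<subseteq> T" for E
    unfolding sw_def PK_def using perm[OF that] measPhi[unfolded PK_def] by (rule integral_PiM_permute)
  have intsw: "integrable PK (\<lambda>W. \<Phi> (sw E W))" if "E \<subseteq> T" for E
    using sw_meas[OF that] boundPhi[OF sw_space[OF that]] by (rule PK.integrable_bounded)
  define q where "q W = real (card {l \<in> T. W l \<in> B})" for W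
  define q' where "q' W = real (card {l \<in> T. W (n + l) \<in> B})" for W
  have rad: "(\<Sum>E\<in>Pow T. \<Phi> (sw E W)) \<le> 2 ^ card T * (20 * (sqrt (v * q W) + sqrt (v * q' W)))"
    if W: "W \<in> space PK" for W
  proof -
    define g where "g E = f (restrict (sw E W) I)" for E
    have g: "g E \<in> F" if "E \<subseteq> T" for E
      unfolding g_def using spK(1)[OF sw_space[OF that W]] by (intro inF) (simp add: PI_def I_def)
    have R: "(\<Sum>E\<in>Pow T. \<bar>\<Sum>l\<in>T. rsign E l * (g E (z l) * of_bool (l \<in> Q))\<bar>)
        \<le> 2 ^ card T * (20 * sqrt (real (v * card Q)))"
      if "Q \<subseteq> T" "\<And>l. l \<in> T \<Longrightarrow> z l \<in> space M" for Q z
      using finT that(1) vc v that(2) g range by (rule rademacher_vc_functions)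
    have "\<Phi> (sw E W) = \<bar>\<Sum>l\<in>T. rsign E l * (g E (W (n + l)) * of_bool (l \<in> {l \<in> T. W (n + l) \<in> B}))
        - rsign E l * (g E (W l) * of_bool (l \<in> {l \<in> T. W l \<in> B}))\<bar>" if E: "E \<subseteq> T" for E
    proof -
      have "h (restrict (sw E W) I) (sw E W l) - h (restrict (sw E W) I) (sw E W (n + l))
          = rsign E l * (g E (W (n + l)) * of_bool (l \<in> {l \<in> T. W (n + l) \<in> B}))
          - rsign E l * (g E (W l) * of_bool (l \<in> {l \<in> T. W l \<in> B}))" if l: "l \<in> T" for l
      proof -
        have nE: "n + l \<notin> E" 
        proof
          assume "n + l \<in> E"
          then have "n + l \<in> {1..n}" "l \<in> {1..n}" using E T(1) l by blast+
          then show False by simp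
        qed
        have lE: "l \<notin> (+) n ` E" 
        proof
          assume "l \<in> (+) n ` E"
          then obtain j where "j \<in> E" "l = n + j" by auto
          moreover have "j \<in> {1..n}" "l \<in> {1..n}" using \<open>j \<in> E\<close> E T(1) l by blast+
          ultimately show False by simp
        qed
        have 1: "sw E W l = W (if l \<in> E then n + l else l)" "sw E W (n + l) = W (if l \<in> E then l else n + l)"
          using TI[OF l] nE lE by (auto simp: sw_def perm_def)
        show ?thesis unfolding 1 by (simp add: h_def g_def rsign_def l indicator_def)
      qed
      then show ?thesis unfolding \<Phi>_def by (intro arg_cong[where f = abs] sum.cong) auto
    qed
    then have "(\<Sum>E\<in>Pow T. \<Phi> (sw E W))
        \<le> (\<Sum>E\<in>Pow T. \<bar>\<Sum>l\<in>T. rsign E l * (g E (W (n + l)) * of_bool (l \<in> {l \<in> T. W (n + l) \<in> B}))\<bar>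
          + \<bar>\<Sum>l\<in>T. rsign E l * (g E (W l) * of_bool (l \<in> {l \<in> T. W l \<in> B}))\<bar>)"
      unfolding sum_subtractf by (intro sum_mono) (simp only: Pow_iff abs_triangle_ineq4)
    also have "\<dots> = (\<Sum>E\<in>Pow T. \<bar>\<Sum>l\<in>T. rsign E l * (g E (W (n + l)) * of_bool (l \<in> {l \<in> T. W (n + l) \<in> B}))\<bar>)
          + (\<Sum>E\<in>Pow T. \<bar>\<Sum>l\<in>T. rsign E l * (g E (W l) * of_bool (l \<in> {l \<in> T. W l \<in> B}))\<bar>)"
      by (rule sum.distrib)
    also have "\<dots> \<le> 2 ^ card T * (20 * sqrt (v * q' W)) + 2 ^ card T * (20 * sqrt (v * q W))"
    proof (rule add_mono)
      show "(\<Sum>E\<in>Pow T. \<bar>\<Sum>l\<in>T. rsign E l * (g E (W (n + l)) * of_bool (l \<in> {l \<in> T. W (n + l) \<in> B}))\<bar>)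
          \<le> 2 ^ card T * (20 * sqrt (v * q' W))"
        unfolding q'_def of_nat_mult[symmetric]
        by (rule R) (use spK(2)[OF W] TI in auto)
      show "(\<Sum>E\<in>Pow T. \<bar>\<Sum>l\<in>T. rsign E l * (g E (W l) * of_bool (l \<in> {l \<in> T. W l \<in> B}))\<bar>)
          \<le> 2 ^ card T * (20 * sqrt (v * q W))"
        unfolding q_def of_nat_mult[symmetric]
        by (rule R) (use spK(2)[OF W] TI in auto)
    qed
    finally show ?thesis by (simp add: algebra_simps)
  qed
  define s where "s = sqrt (v * card T * prob B)"
  have s: "s > 0" "s * s = v * card T * prob B"
    using v T(2) finT B(2) by (auto simp: s_def card_gt_0_iff)
  (* Linearising the square root at the mean s * s of its argument replaces Jensen's inequality. *)
  have amgm: "sqrt x \<le> (x / s + s) / 2" if "x \<ge> 0" for x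
  proof -
    have "sqrt x * s \<le> (x + s * s) / 2"
      using sum_squares_bound[of "sqrt x" s] that by (simp add: power2_eq_square)
    then show ?thesis using s(1) by (simp add: field_simps)
  qed
  have qsum: "q W = (\<Sum>l\<in>T. indicator B (W l))" "q' W = (\<Sum>l\<in>T. indicator B (W (n + l)))" for W
    unfolding q_def q'_def indicator_def using finT
    by (auto simp: sum.If_cases Int_def intro!: arg_cong[where f = card])
  have ind_int: "integrable PK (\<lambda>W. indicator B (W i) :: real)" if "i \<in> K" for i
  proof (rule PK.integrable_bounded[where C = 1])
    show "(\<lambda>W. indicator B (W i) :: real) \<in> borel_measurable PK"
      unfolding PK_def using measurable_compose[OF measurable_component_singleton[OF that, of "\<lambda>_. M"]
        borel_measurable_indicator[OF B(1)]] .
  qed (auto simp: indicator_def)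
  have ind_val: "(LINT W|PK. indicator B (W i)) = prob B" if "i \<in> K" for i
    unfolding PK_def using integral_PiM_component[OF that, of "indicator B"] B(1) by simp
  have intq: "integrable PK q" "integrable PK q'"
    unfolding qsum using ind_int TI by (auto intro!: Bochner_Integration.integrable_sum)
  have Eq: "(LINT W|PK. q W) = card T * prob B" "(LINT W|PK. q' W) = card T * prob B"
    unfolding qsum using ind_int ind_val TI by (auto simp: Bochner_Integration.integral_sum)
  have "2 ^ card T * (LINT W|PK. \<Phi> W) = (\<Sum>E\<in>Pow T. LINT W|PK. \<Phi> (sw E W))"
    using swap by (simp add: card_Pow finT)
  also have "\<dots> = (LINT W|PK. (\<Sum>E\<in>Pow T. \<Phi> (sw E W)))"
    using intsw by (simp add: Bochner_Integration.integral_sum)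
  also have "\<dots> \<le> (LINT W|PK. 2 ^ card T * (20 * ((v / s / 2) * (q W + q' W) + s)))"
  proof (rule Bochner_Integration.integral_mono)
    show "integrable PK (\<lambda>W. \<Sum>E\<in>Pow T. \<Phi> (sw E W))"
      using intsw by (intro Bochner_Integration.integrable_sum) auto
    show "integrable PK (\<lambda>W. 2 ^ card T * (20 * ((v / s / 2) * (q W + q' W) + s)))"
      using intq by auto
    fix W assume W: "W \<in> space PK"
    have "sqrt (v * q W) + sqrt (v * q' W) \<le> (v * q W / s + s) / 2 + (v * q' W / s + s) / 2"
      by (intro add_mono amgm) (auto simp: q_def q'_def)
    also have "\<dots> = (v / s / 2) * (q W + q' W) + s"
      by (simp add: algebra_simps add_divide_distrib)
    finally have "2 ^ card T * (20 * (sqrt (v * q W) + sqrt (v * q' W)))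
        \<le> 2 ^ card T * (20 * ((v / s / 2) * (q W + q' W) + s))"
      by (intro mult_left_mono) auto
    with rad[OF W] show "(\<Sum>E\<in>Pow T. \<Phi> (sw E W)) \<le> 2 ^ card T * (20 * ((v / s / 2) * (q W + q' W) + s))"
      by linarith
  qed
  also have "\<dots> = 2 ^ card T * (20 * ((v / s / 2) * (card T * prob B + card T * prob B) + s))"
    using intq Eq by (simp add: PK.prob_space)
  also have "(v / s / 2) * (card T * prob B + card T * prob B) = (s * s) / s"
    unfolding s(2) by (simp add: field_simps)
  also have "\<dots> = s" using s(1) by simp
  finally have "(LINT W|PK. \<Phi> W) \<le> 40 * s" by simp
  with ghost show ?thesis by (simp add: h_def m_def s_def PI_def I_def)
qed

end

section \<open>Order statistics and measurability of norms\<close>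

definition kth_largest :: "nat \<Rightarrow> nat \<Rightarrow> (nat \<Rightarrow> real) \<Rightarrow> real" where
  "kth_largest n k x = rev (sort (map x [1..<Suc n])) ! (k - 1)"

lemma kth_largest_counts:
  assumes k: "1 \<le> k" "k \<le> n"
  shows "card {l \<in> {1..n}. kth_largest n k x < x l} < k"
    and "k \<le> card {l \<in> {1..n}. kth_largest n k x \<le> x l}"
proof -
  define xs where "xs = sort (map x [1..<Suc n])"
  have len: "length xs = n" and sorted: "sorted xs" by (simp_all add: xs_def)
  have kth: "kth_largest n k x = xs ! (n - k)"
    unfolding kth_largest_def xs_def[symmetric] using k len by (simp add: rev_nth)
  have count: "card {l \<in> {1..n}. Q (x l)} = card {i. i < n \<and> Q (xs ! i)}" for Q
  proof -
    have "card {i. i < n \<and> Q (xs ! i)} = length (filter Q xs)"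
      using len by (simp add: length_filter_conv_card)
    also have "\<dots> = length (filter (Q \<circ> x) [1..<Suc n])"
      unfolding xs_def by (simp add: filter_sort filter_map del: upt_Suc)
    also have "\<dots> = card (set (filter (Q \<circ> x) [1..<Suc n]))"
      by (rule distinct_card[symmetric]) simp
    also have "set (filter (Q \<circ> x) [1..<Suc n]) = {l \<in> {1..n}. Q (x l)}" by auto
    finally show ?thesis by simp
  qed
  have "{i. i < n \<and> xs ! (n - k) < xs ! i} \<subseteq> {n - k + 1..<n}"
  proof
    fix i assume i: "i \<in> {i. i < n \<and> xs ! (n - k) < xs ! i}"
    then have "\<not> i \<le> n - k" using sorted_nth_mono[OF sorted, of i "n - k"] len k by auto
    with i show "i \<in> {n - k + 1..<n}" by simp
  qed
  then have "card {i. i < n \<and> xs ! (n - k) < xs ! i} \<le> card {n - k + 1..<n}"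
    by (intro card_mono) auto
  then show "card {l \<in> {1..n}. kth_largest n k x < x l} < k"
    using k unfolding kth count by simp
  have "{n - k..<n} \<subseteq> {i. i < n \<and> xs ! (n - k) \<le> xs ! i}"
    using sorted_nth_mono[OF sorted] len by auto
  then have "card {n - k..<n} \<le> card {i. i < n \<and> xs ! (n - k) \<le> xs ! i}"
    by (intro card_mono) auto
  then show "k \<le> card {l \<in> {1..n}. kth_largest n k x \<le> x l}"
    using k unfolding kth count by simp
qed

lemma less_kth_largest_iff:
  assumes k: "1 \<le> k" "k \<le> n"
  shows "r < kth_largest n k x \<longleftrightarrow> k \<le> card {l \<in> {1..n}. r < x l}"
proof
  assume "r < kth_largest n k x"
  then have "card {l \<in> {1..n}. kth_largest n k x \<le> x l} \<le> card {l \<in> {1..n}. r < x l}"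
    by (intro card_mono) auto
  with kth_largest_counts(2)[OF k] show "k \<le> card {l \<in> {1..n}. r < x l}" by (rule le_trans)
next
  assume *: "k \<le> card {l \<in> {1..n}. r < x l}"
  show "r < kth_largest n k x"
  proof (rule ccontr)
    assume "\<not> r < kth_largest n k x"
    then have "card {l \<in> {1..n}. r < x l} \<le> card {l \<in> {1..n}. kth_largest n k x < x l}"
      by (intro card_mono) auto
    with * kth_largest_counts(1)[OF k, of x] show False by simp
  qed
qed

lemma kth_largest_mono:
  assumes k: "1 \<le> k" "k \<le> n" and le: "\<And>l. l \<in> {1..n} \<Longrightarrow> x l \<le> y l"
  shows "kth_largest n k x \<le> kth_largest n k y"
proof (rule ccontr)
  assume "\<not> kth_largest n k x \<le> kth_largest n k y"
  then have "k \<le> card {l \<in> {1..n}. kth_largest n k y < x l}"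
    using less_kth_largest_iff[OF k, of "kth_largest n k y" x] by simp
  also have "\<dots> \<le> card {l \<in> {1..n}. kth_largest n k y < y l}"
    using le by (intro card_mono) (auto intro: less_le_trans)
  finally show False using kth_largest_counts(1)[OF k, of y] by simp
qed

lemma kth_largest_eqI:
  assumes k: "1 \<le> k" "k \<le> n"
    and s: "card {l \<in> {1..n}. s < x l} < k" "k \<le> card {l \<in> {1..n}. s \<le> x l}"
  shows "kth_largest n k x = s"
proof (rule antisym)
  show "kth_largest n k x \<le> s" using less_kth_largest_iff[OF k] s(1) by (meson leD leI)
  show "s \<le> kth_largest n k x"
  proof (rule ccontr)
    assume "\<not> s \<le> kth_largest n k x"
    then have "card {l \<in> {1..n}. s \<le> x l} \<le> card {l \<in> {1..n}. kth_largest n k x < x l}"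
      by (intro card_mono) auto
    with s(2) kth_largest_counts(1)[OF k, of x] show False by simp
  qed
qed

text \<open>
  If entry \<open>i\<close> lies above the threshold, moving it to another value above the threshold leaves the
  counts, hence the threshold, unchanged. It even suffices that each of the two values exceeds its
  own threshold, since the smaller of the two thresholds then lies below both values.
\<close>

lemma kth_largest_update_exceeding:
  assumes k: "1 \<le> k" "k \<le> n"
    and x: "kth_largest n k x < x i" and y: "kth_largest n k (x(i := y)) < y"
  shows "kth_largest n k (x(i := y)) = kth_largest n k x"
proof -
  have same: "{l \<in> {1..n}. s < (x(i := y)) l} = {l \<in> {1..n}. s < x l}"
    "{l \<in> {1..n}. s \<le> (x(i := y)) l} = {l \<in> {1..n}. s \<le> x l}" if "s < x i" "s < y" for s
    using that by auto
  show ?thesis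
  proof (cases "kth_largest n k x < y")
    case True
    note same[OF x True]
    then show ?thesis using kth_largest_counts[OF k, of x] by (intro kth_largest_eqI[OF k]) simp_all
  next
    case False
    then have "kth_largest n k (x(i := y)) < x i" using x y by simp
    note same[OF this y]
    then show ?thesis
      using kth_largest_counts[OF k, of "x(i := y)"] by (intro kth_largest_eqI[OF k, symmetric]) simp_all
  qed
qed

text \<open>
  Raising entry \<open>i\<close> to \<open>b\<close> raises the threshold from \<open>u\<close> to \<open>u'\<close>. No other entry lies strictly between:
  together with the at least \<open>k - 1\<close> other entries that reach \<open>u'\<close> it would give \<open>k\<close> entries above
  \<open>u\<close>. Only entries equal to \<open>u'\<close> can change sides.
\<close>

lemma leave_one_out_exceedance:
  fixes x :: "nat \<Rightarrow> real" and b t :: real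
  assumes k: "1 \<le> k" "k \<le> n" and b: "x i \<le> b" and i: "i \<in> {1..n}" and l: "l \<in> {1..n}" "l \<noteq> i"
  defines "u \<equiv> kth_largest n k x" and "u' \<equiv> kth_largest n k (x(i := b))"
  shows "\<bar>of_bool (u' < x l) - of_bool (t \<le> x l)\<bar>
    \<le> \<bar>of_bool (u < x l) - of_bool (t \<le> x l)\<bar> + (of_bool (t \<le> u' \<and> x l = u') :: real)"
proof (cases "u' < x l")
  case True
  have "u \<le> u'" unfolding u_def u'_def using b by (intro kth_largest_mono[OF k]) auto
  with True show ?thesis by simp
next
  case nle: False
  have "u < x l \<Longrightarrow> x l < u' \<Longrightarrow> False"
  proof -
    assume ux: "u < x l" "x l < u'"
    have "k \<le> card {j \<in> {1..n}. u' \<le> (x(i := b)) j}"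
      unfolding u'_def by (rule kth_largest_counts(2)[OF k])
    also have "\<dots> \<le> card (insert i {j \<in> {1..n}. j \<noteq> i \<and> u' \<le> x j})"
      by (intro card_mono) auto
    also have "\<dots> = card (insert l {j \<in> {1..n}. j \<noteq> i \<and> u' \<le> x j})"
      using ux by simp
    also have "\<dots> \<le> card {j \<in> {1..n}. u < x j}"
      using ux l by (intro card_mono) auto
    also have "\<dots> < k" unfolding u_def by (rule kth_largest_counts(1)[OF k])
    finally show False by simp
  qed
  with nle show ?thesis by (auto simp: of_bool_def)
qed

text \<open>
  The sets \<open>{l. u < x l}\<close> and \<open>{l. t \<le> x l}\<close> are nested, so the number of disagreements is the
  difference of their cardinalities; here \<open>u\<close> is the \<open>k\<close>-th largest value. The first has fewer than \<open>k\<close> elements, and exactly \<open>k - 1\<close> when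
  \<open>t \<le> u\<close>, because there are no ties from \<open>t\<close> upwards.
\<close>

lemma sum_exceedance_diff_le:
  fixes x :: "nat \<Rightarrow> real"
  assumes k: "1 \<le> k" "k \<le> n"
    and no_ties: "\<And>i j. i \<in> {1..n} \<Longrightarrow> j \<in> {1..n} \<Longrightarrow> t \<le> x i \<Longrightarrow> x i = x j \<Longrightarrow> i = j"
  shows "(\<Sum>l\<in>{1..n}. \<bar>of_bool (kth_largest n k x < x l) - of_bool (t \<le> x l)\<bar>)
    \<le> \<bar>(\<Sum>l\<in>{1..n}. of_bool (t \<le> x l)) - real k\<bar> + 1"
proof -
  define u where "u = kth_largest n k x"
  define a where "a = card {l \<in> {1..n}. u < x l}"
  define b where "b = card {l \<in> {1..n}. t \<le> x l}"
  have sa: "(\<Sum>l\<in>{1..n}. of_bool (u < x l)) = real a" and sb: "(\<Sum>l\<in>{1..n}. of_bool (t \<le> x l)) = real b"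
    by (simp_all add: a_def b_def Int_def)
  have ak: "a < k" unfolding a_def u_def by (rule kth_largest_counts(1)[OF k])
  show ?thesis
  proof (cases "u < t")
    case True
    then have "(\<Sum>l\<in>{1..n}. \<bar>of_bool (u < x l) - of_bool (t \<le> x l)\<bar>)
        = (\<Sum>l\<in>{1..n}. of_bool (u < x l) - of_bool (t \<le> x l) :: real)"
      by (intro sum.cong) (auto simp: of_bool_def)
    also have "\<dots> = real a - real b" by (simp only: sum_subtractf sa sb)
    finally show ?thesis using ak unfolding u_def[symmetric] sb by linarith
  next
    case False
    then have "(\<Sum>l\<in>{1..n}. \<bar>of_bool (u < x l) - of_bool (t \<le> x l)\<bar>)
        = (\<Sum>l\<in>{1..n}. of_bool (t \<le> x l) - of_bool (u < x l) :: real)"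
      by (intro sum.cong) (auto simp: of_bool_def)
    also have "\<dots> = real b - real a" by (simp only: sum_subtractf sa sb)
    finally have *: "(\<Sum>l\<in>{1..n}. \<bar>of_bool (u < x l) - of_bool (t \<le> x l)\<bar>) = real b - real a" .
    have "card {l \<in> {1..n}. x l = u} \<le> 1"
    proof (rule card_le_Suc0_iff_eq[THEN iffD2, unfolded One_nat_def[symmetric]])
      show "\<forall>y\<in>{l \<in> {1..n}. x l = u}. \<forall>z\<in>{l \<in> {1..n}. x l = u}. y = z"
        using no_ties False by auto
    qed simp
    have "k \<le> card {l \<in> {1..n}. u \<le> x l}" unfolding u_def by (rule kth_largest_counts(2)[OF k])
    also have "{l \<in> {1..n}. u \<le> x l} = {l \<in> {1..n}. u < x l} \<union> {l \<in> {1..n}. x l = u}" by auto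
    also have "card \<dots> \<le> a + card {l \<in> {1..n}. x l = u}" unfolding a_def by (rule card_Un_le)
    also have "\<dots> \<le> a + 1" using \<open>card {l \<in> {1..n}. x l = u} \<le> 1\<close> by simp
    finally show ?thesis unfolding u_def[symmetric] * sb by linarith
  qed
qed

lemma borel_measurable_kth_largest:
  assumes k: "1 \<le> k" "k \<le> n" and X: "\<And>l. l \<in> {1..n} \<Longrightarrow> X l \<in> borel_measurable M"
  shows "(\<lambda>w. kth_largest n k (\<lambda>l. X l w)) \<in> borel_measurable M"
  unfolding borel_measurable_iff_greater
proof
  fix r :: real
  have "{w \<in> space M. r < kth_largest n k (\<lambda>l. X l w)}
      = {w \<in> space M. real k \<le> (\<Sum>l\<in>{1..n}. indicator {w \<in> space M. r < X l w} w)}"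
  proof (rule Collect_cong, rule conj_cong[OF refl])
    fix w assume w: "w \<in> space M"
    have "(\<Sum>l\<in>{1..n}. indicator {w \<in> space M. r < X l w} w) = (\<Sum>l\<in>{1..n}. of_bool (r < X l w) :: real)"
      using w by (intro sum.cong) (auto simp: indicator_def)
    also have "\<dots> = real (card {l \<in> {1..n}. r < X l w})" by (simp add: Int_def)
    finally show "r < kth_largest n k (\<lambda>l. X l w)
        \<longleftrightarrow> real k \<le> (\<Sum>l\<in>{1..n}. indicator {w \<in> space M. r < X l w} w)"
      using less_kth_largest_iff[OF k] by simp
  qed
  also have "\<dots> \<in> sets M"
  proof -
    have "{w \<in> space M. r < X l w} \<in> sets M" if "l \<in> {1..n}" for l
      using X[OF that] borel_measurable_iff_greater by blast
    then have "(\<lambda>w. \<Sum>l\<in>{1..n}. indicator {w \<in> space M. r < X l w} w :: real) \<in> borel_measurable M"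
      by (intro borel_measurable_sum borel_measurable_indicator)
    then show ?thesis by (intro borel_measurable_le) auto
  qed
  finally show "{w \<in> space M. r < kth_largest n k (\<lambda>l. X l w)} \<in> sets M" .
qed

lemma norm_lipschitz:
  assumes N: "is_norm d N" and x: "x \<in> {..<d} \<rightarrow>\<^sub>E UNIV" and y: "y \<in> {..<d} \<rightarrow>\<^sub>E UNIV"
  shows "N x \<le> N y + (\<Sum>i<d. \<bar>x i - y i\<bar> * N (\<lambda>j\<in>{..<d}. of_bool (j = i)))"
proof -
  define e where "e i = (\<lambda>j\<in>{..<d}. of_bool (j = i) :: real)" for i
  (* Move from y to x one coordinate at a time. *)
  have "N (\<lambda>j\<in>{..<d}. y j + of_bool (j \<in> S) * (x j - y j)) \<le> N y + (\<Sum>i\<in>S. \<bar>x i - y i\<bar> * N (e i))"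
    if "finite S" "S \<subseteq> {..<d}" for S
    using that
  proof (induction S rule: finite_induct)
    case empty
    have "(\<lambda>j\<in>{..<d}. y j) = y" using y by (rule PiE_restrict)
    then show ?case by simp
  next
    case (insert i S)
    define z where "z = (\<lambda>j\<in>{..<d}. y j + of_bool (j \<in> S) * (x j - y j))"
    define u where "u = (\<lambda>j\<in>{..<d}. (x i - y i) * e i j)"
    have eq: "(\<lambda>j\<in>{..<d}. y j + of_bool (j \<in> insert i S) * (x j - y j)) = (\<lambda>j\<in>{..<d}. z j + u j)"
      using insert.hyps by (auto simp: z_def u_def e_def fun_eq_iff restrict_def)
    have "N (\<lambda>j\<in>{..<d}. z j + u j) \<le> N z + N u"
    proof -
      have "z \<in> {..<d} \<rightarrow>\<^sub>E UNIV" "u \<in> {..<d} \<rightarrow>\<^sub>E UNIV" by (auto simp: z_def u_def)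
      then show ?thesis using N unfolding is_norm_def by blast
    qed
    moreover have "N u = \<bar>x i - y i\<bar> * N (e i)"
    proof -
      have "e i \<in> {..<d} \<rightarrow>\<^sub>E UNIV" by (auto simp: e_def)
      then show ?thesis using N unfolding is_norm_def u_def by blast
    qed
    moreover have "N z \<le> N y + (\<Sum>i\<in>S. \<bar>x i - y i\<bar> * N (e i))"
      unfolding z_def using insert.prems by (intro insert.IH) simp
    ultimately have "N (\<lambda>j\<in>{..<d}. z j + u j)
        \<le> N y + (\<bar>x i - y i\<bar> * N (e i) + (\<Sum>i\<in>S. \<bar>x i - y i\<bar> * N (e i)))" by linarith
    then show ?case by (simp only: eq sum.insert[OF insert.hyps])
  qed
  from this[of "{..<d}"]
  have "N (\<lambda>j\<in>{..<d}. y j + of_bool (j \<in> {..<d}) * (x j - y j)) \<le> N y + (\<Sum>i<d. \<bar>x i - y i\<bar> * N (e i))"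
    by simp
  also have "(\<lambda>j\<in>{..<d}. y j + of_bool (j \<in> {..<d}) * (x j - y j)) = (\<lambda>j\<in>{..<d}. x j)"
    by (auto simp: restrict_def)
  also have "\<dots> = x" using x by (rule PiE_restrict)
  finally show ?thesis by (simp only: e_def)
qed

text \<open>
  A function that is Lipschitz for a weighted \<open>l\<^sup>1\<close>-distance is the infimum of countably many cones
  with apex over the rational points.
\<close>

lemma borel_measurable_norm:
  assumes N: "is_norm d N"
  shows "N \<in> borel_measurable (Pi\<^sub>M {..<d} (\<lambda>_. borel))"
  unfolding borel_measurable_iff_less
proof
  fix r :: real
  let ?M = "Pi\<^sub>M {..<d} (\<lambda>_. borel :: real measure)"
  define c where "c i = N (\<lambda>j\<in>{..<d}. of_bool (j = i))" for i
  define D where "D = {..<d} \<rightarrow>\<^sub>E (\<rat> :: real set)"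
  have c: "0 \<le> c i" for i using N by (auto simp: is_norm_def c_def)
  have cD: "countable D" unfolding D_def by (intro countable_PiE) (auto simp: countable_rat)
  have sp: "space ?M = {..<d} \<rightarrow>\<^sub>E UNIV" by (simp add: space_PiM)
  have DE: "y \<in> {..<d} \<rightarrow>\<^sub>E UNIV" if "y \<in> D" for y using that by (auto simp: D_def PiE_iff)
  have "{x \<in> space ?M. N x < r} = (\<Union>y\<in>D. {x \<in> space ?M. N y + (\<Sum>i<d. \<bar>x i - y i\<bar> * c i) < r})"
  proof (intro subset_antisym subsetI)
    fix x assume "x \<in> {x \<in> space ?M. N x < r}"
    then have x: "x \<in> {..<d} \<rightarrow>\<^sub>E UNIV" "N x < r" by (auto simp: sp)
    define L where "L = (\<Sum>i<d. c i)"
    have L: "0 \<le> L" unfolding L_def by (intro sum_nonneg c)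
    define \<eta> where "\<eta> = (r - N x) / (2 * (L + 1))"
    have eta: "\<eta> > 0" using x(2) L by (simp add: \<eta>_def)
    have "\<forall>i. \<exists>q\<in>\<rat>. \<bar>x i - q\<bar> < \<eta>"
    proof
      fix i
      obtain q where "q \<in> \<rat>" "x i < q" "q < x i + \<eta>" using Rats_dense_in_real[of "x i" "x i + \<eta>"] eta by auto
      then show "\<exists>q\<in>\<rat>. \<bar>x i - q\<bar> < \<eta>" by (intro bexI[of _ q]) auto
    qed
    then obtain q where q: "\<And>i. q i \<in> \<rat>" "\<And>i. \<bar>x i - q i\<bar> < \<eta>" by metis
    define y where "y = restrict q {..<d}"
    have y: "y \<in> D" using q by (auto simp: y_def D_def)
    have "(\<Sum>i<d. \<bar>x i - y i\<bar> * c i) \<le> (\<Sum>i<d. \<eta> * c i)"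
      using q(2) c by (intro sum_mono mult_right_mono) (auto simp: y_def less_imp_le)
    also have "\<dots> = \<eta> * L" by (simp add: L_def sum_distrib_left)
    finally have 1: "(\<Sum>i<d. \<bar>x i - y i\<bar> * c i) \<le> \<eta> * L" .
    have "N y \<le> N x + (\<Sum>i<d. \<bar>y i - x i\<bar> * c i)"
      using norm_lipschitz[OF N DE[OF y] x(1)] by (simp add: c_def)
    also have "(\<Sum>i<d. \<bar>y i - x i\<bar> * c i) = (\<Sum>i<d. \<bar>x i - y i\<bar> * c i)" by (simp add: abs_minus_commute)
    finally have "N y + (\<Sum>i<d. \<bar>x i - y i\<bar> * c i) \<le> N x + 2 * (\<eta> * L)" using 1 by simp
    also have "\<dots> < N x + 2 * (\<eta> * (L + 1))" using eta by simp
    also have "2 * (\<eta> * (L + 1)) = r - N x" using L by (simp add: \<eta>_def field_simps)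
    finally show "x \<in> (\<Union>y\<in>D. {x \<in> space ?M. N y + (\<Sum>i<d. \<bar>x i - y i\<bar> * c i) < r})"
      using y x by (auto simp: sp)
  next
    fix x assume "x \<in> (\<Union>y\<in>D. {x \<in> space ?M. N y + (\<Sum>i<d. \<bar>x i - y i\<bar> * c i) < r})"
    then obtain y where "y \<in> D" "x \<in> space ?M" "N y + (\<Sum>i<d. \<bar>x i - y i\<bar> * c i) < r" by auto
    moreover from this have "N x \<le> N y + (\<Sum>i<d. \<bar>x i - y i\<bar> * c i)"
      unfolding c_def using sp by (intro norm_lipschitz[OF N _ DE]) auto
    ultimately show "x \<in> {x \<in> space ?M. N x < r}" by simp
  qed
  also have "\<dots> \<in> sets ?M"
  proof (rule sets.countable_UN''[OF cD])
    fix y assume "y \<in> D"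
    have "(\<lambda>x. N y + (\<Sum>i<d. \<bar>x i - y i\<bar> * c i)) \<in> borel_measurable ?M" by measurable
    then show "{x \<in> space ?M. N y + (\<Sum>i<d. \<bar>x i - y i\<bar> * c i) < r} \<in> sets ?M"
      unfolding borel_measurable_iff_less by (rule spec)
  qed
  finally show "{x \<in> space ?M. N x < r} \<in> sets ?M" .
qed

section \<open>The leave-p-out setting\<close>

lemma sum_over_subsets_of_card:
  fixes h :: "'i \<Rightarrow> real"
  assumes I: "finite I" and p: "1 \<le> p"
  shows "(\<Sum>S\<in>{S. S \<subseteq> I \<and> card S = p}. \<Sum>i\<in>S. h i)
     = real (card I - 1 choose (p - 1)) * (\<Sum>i\<in>I. h i)"
proof -
  define \<S> where "\<S> = {S. S \<subseteq> I \<and> card S = p}"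
  have fin: "finite \<S>" unfolding \<S>_def using I by simp
  have count: "card {S \<in> \<S>. i \<in> S} = card I - 1 choose (p - 1)" if "i \<in> I" for i
  proof -
    have "bij_betw (\<lambda>S. S - {i}) {S \<in> \<S>. i \<in> S} {S. S \<subseteq> I - {i} \<and> card S = p - 1}"
    proof (rule bij_betw_byWitness[where f' = "insert i"])
      show "(\<lambda>S. S - {i}) ` {S \<in> \<S>. i \<in> S} \<subseteq> {S. S \<subseteq> I - {i} \<and> card S = p - 1}"
        by (auto simp: \<S>_def)
      show "insert i ` {S. S \<subseteq> I - {i} \<and> card S = p - 1} \<subseteq> {S \<in> \<S>. i \<in> S}"
      proof
        fix U assume "U \<in> insert i ` {S. S \<subseteq> I - {i} \<and> card S = p - 1}"
        then obtain S where S: "U = insert i S" "S \<subseteq> I - {i}" "card S = p - 1" by auto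
        then have "finite S" "i \<notin> S" using I finite_subset by auto
        then show "U \<in> {S \<in> \<S>. i \<in> S}" using S p that by (auto simp: \<S>_def)
      qed
    qed auto
    then have "card {S \<in> \<S>. i \<in> S} = card {S. S \<subseteq> I - {i} \<and> card S = p - 1}"
      by (rule bij_betw_same_card)
    also have "\<dots> = card I - 1 choose (p - 1)" using I that by (simp add: n_subsets)
    finally show ?thesis .
  qed
  have "(\<Sum>S\<in>\<S>. \<Sum>i\<in>S. h i) = (\<Sum>S\<in>\<S>. \<Sum>i\<in>I. of_bool (i \<in> S) * h i)"
  proof (rule sum.cong[OF refl])
    fix S assume "S \<in> \<S>"
    then show "(\<Sum>i\<in>S. h i) = (\<Sum>i\<in>I. of_bool (i \<in> S) * h i)"
      using I by (intro sum.mono_neutral_cong_left) (auto simp: \<S>_def)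
  qed
  also have "\<dots> = (\<Sum>i\<in>I. \<Sum>S\<in>\<S>. of_bool (i \<in> S) * h i)" by (rule sum.swap)
  also have "\<dots> = (\<Sum>i\<in>I. real (card {S \<in> \<S>. i \<in> S}) * h i)"
    using fin by (simp add: Int_def flip: sum_distrib_right)
  also have "\<dots> = real (card I - 1 choose (p - 1)) * (\<Sum>i\<in>I. h i)"
    using count by (simp add: sum_distrib_left)
  finally show ?thesis by (simp add: \<S>_def)
qed

text \<open>
  Every observation is held out equally often, so averages over validation sets and over training
  sets agree with the average over the whole sample. This is where the scheme enters: a single
  validation set may be far too small to carry an average.
\<close>

lemma leave_p_out_average:
  fixes h :: "nat \<Rightarrow> real"
  assumes V: "leave_p_out n p K V" and p: "1 \<le> p" "p < n"
  shows "1 / real K * (\<Sum>j=1..K. (\<Sum>i\<in>V j. h i) / real p) = (\<Sum>i\<in>{1..n}. h i) / real n"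
    and "1 / real K * (\<Sum>j=1..K. (\<Sum>i\<in>{1..n} - V j. h i) / real (n - p)) = (\<Sum>i\<in>{1..n}. h i) / real n"
proof -
  have K: "K = n choose p" and bij: "bij_betw V {1..K} {S. S \<subseteq> {1..n} \<and> card S = p}"
    using V by (auto simp: leave_p_out_def)
  have Kpos: "K > 0" using p K by simp
  have absorb: "real p * real K = real n * real (n - 1 choose (p - 1))"
  proof -
    have "p * K = n * (n - 1 choose (p - 1))"
      using binomial_absorption[of "p - 1" n] p K by simp
    then show ?thesis by (metis of_nat_mult)
  qed
  have "(\<Sum>j=1..K. \<Sum>i\<in>V j. h i) = (\<Sum>S\<in>{S. S \<subseteq> {1..n} \<and> card S = p}. \<Sum>i\<in>S. h i)"
    using bij by (rule sum.reindex_bij_betw)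
  then have "real p * (\<Sum>j=1..K. \<Sum>i\<in>V j. h i) = real p * real (n - 1 choose (p - 1)) * (\<Sum>i\<in>{1..n}. h i)"
    using sum_over_subsets_of_card[of "{1..n}" p h] p by simp
  then have "real n * (\<Sum>j=1..K. \<Sum>i\<in>V j. h i) = real p * real K * (\<Sum>i\<in>{1..n}. h i)"
    unfolding absorb using p by simp
  then have first: "(\<Sum>j=1..K. \<Sum>i\<in>V j. h i) = real p * real K * (\<Sum>i\<in>{1..n}. h i) / n"
    using p by (simp add: field_simps)
  then show "1 / real K * (\<Sum>j=1..K. (\<Sum>i\<in>V j. h i) / real p) = (\<Sum>i\<in>{1..n}. h i) / real n"
    using Kpos p by (simp flip: sum_divide_distrib)
  have "(\<Sum>i\<in>{1..n} - V j. h i) = (\<Sum>i\<in>{1..n}. h i) - (\<Sum>i\<in>V j. h i)" if "j \<in> {1..K}" for j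
    using bij_betwE[OF bij] that by (intro sum_diff) auto
  then have "(\<Sum>j=1..K. \<Sum>i\<in>{1..n} - V j. h i)
      = real K * (\<Sum>i\<in>{1..n}. h i) - (\<Sum>j=1..K. \<Sum>i\<in>V j. h i)"
    by (simp add: sum_subtractf)
  also have "\<dots> = real K * (\<Sum>i\<in>{1..n}. h i) * real (n - p) / real n"
    unfolding first using p by (simp add: field_simps of_nat_diff)
  finally show "1 / real K * (\<Sum>j=1..K. (\<Sum>i\<in>{1..n} - V j. h i) / real (n - p)) = (\<Sum>i\<in>{1..n}. h i) / real n"
    using Kpos p by (simp flip: sum_divide_distrib)
qed

locale lpo_setting = extreme_setting +
  fixes n k :: nat and \<Psi> :: rule and v p K :: nat and V :: "nat \<Rightarrow> nat set"
  assumes k: "1 \<le> k" "k \<le> n" and alpha: "\<alpha> = real k / real n"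
    and rule: "learning_rule P c G n \<Psi>"
    and erm: "cond_erm P N c G n \<alpha> \<Psi>"
    and vc: "vc_dim (subgraph (X \<times> {-1, 1}) c ` G) = enat v"
    and cost_range: "\<forall>g\<in>G. \<forall>z\<in>X \<times> {-1, 1}. 0 \<le> c g z \<and> c g z \<le> 1"
    and p: "1 \<le> p" "p < n"
    and lpo: "leave_p_out n p K V"
begin

definition sample :: "(nat \<Rightarrow> obs) measure" where
  "sample = Pi\<^sub>M {1..n} (\<lambda>_. P)"

definition mag :: "obs \<Rightarrow> real" where
  "mag z = N (fst z)"

definition threshold :: "(nat \<Rightarrow> obs) \<Rightarrow> real" where
  "threshold w = kth_largest n k (\<lambda>l. mag (w l))"

definition tail_event :: "obs set" where
  "tail_event = {z \<in> space P. t \<le> mag z}"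

text \<open>
  The conditional risk times \<open>\<alpha>\<close>, a quantity linear in the law.
\<close>

definition tail_risk :: "(vec \<Rightarrow> real) \<Rightarrow> real" where
  "tail_risk g = (LINT z|P. c g z * indicator tail_event z)"

definition exceeds :: "(nat \<Rightarrow> obs) \<Rightarrow> nat \<Rightarrow> real" where
  "exceeds w l = of_bool (threshold w < mag (w l))"

definition in_tail :: "(nat \<Rightarrow> obs) \<Rightarrow> nat \<Rightarrow> real" where
  "in_tail w l = indicator tail_event (w l)"

definition misfit :: "(nat \<Rightarrow> obs) \<Rightarrow> nat \<Rightarrow> real" where
  "misfit w l = \<bar>exceeds w l - in_tail w l\<bar>"

definition predictor :: "(nat \<Rightarrow> obs) \<Rightarrow> nat set \<Rightarrow> vec \<Rightarrow> real" where
  "predictor w S = \<Psi> S (threshold w) (restrict w S)"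

definition deviation :: "nat set \<Rightarrow> (vec \<Rightarrow> real) \<Rightarrow> (nat \<Rightarrow> obs) \<Rightarrow> real" where
  "deviation T g w = \<bar>(\<Sum>l\<in>T. c g (w l) * in_tail w l) - card T * tail_risk g\<bar>"

sublocale S: prob_space sample
  unfolding sample_def by (rule prob_space_power)

lemma n_pos: "0 < n" using p by simp

lemma alpha_bounds: "0 < \<alpha>" "\<alpha> \<le> 1" "real n * \<alpha> = real k"
  using k n_pos by (auto simp: alpha)

lemma trained_eq: "trained N n \<alpha> \<Psi> w S = predictor w S"
  and emp_threshold_eq: "emp_threshold N n \<alpha> w = threshold w"
proof -
  have "\<alpha> * real n = real k" using alpha_bounds(3) by (simp add: mult.commute)
  then have "nat \<lfloor>\<alpha> * real n\<rfloor> = k" by simp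
  then show *: "emp_threshold N n \<alpha> w = threshold w"
    by (simp add: emp_threshold_def rev_order_stat_def threshold_def kth_largest_def mag_def)
  then show "trained N n \<alpha> \<Psi> w S = predictor w S" by (simp add: trained_def predictor_def)
qed

lemma emp_risk_eq:
  "emp_risk N c n \<alpha> w g S = 1 / (\<alpha> * real (card S)) * (\<Sum>l\<in>S. c g (w l) * exceeds w l)"
  by (simp add: emp_risk_def emp_threshold_eq exceeds_def mag_def)

lemma space_P: "space P = X \<times> {-1, 1}"
proof -
  have "space P = space (obs_space d X)" using sets_P by (rule sets_eq_imp_space_eq)
  also have "\<dots> = X \<times> {-1, 1}"
    using X_subset by (auto simp: obs_space_def space_pair_measure space_restrict_space space_PiM)
  finally show ?thesis .
qed

lemma cost_bounds: "0 \<le> c g z" "c g z \<le> 1" if "g \<in> G" "z \<in> space P"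
  using cost_range that space_P by auto

lemma sample_point: "w l \<in> space P" if "w \<in> space sample" "l \<in> {1..n}"
  using that by (auto simp: sample_def space_PiM)

lemma mag_measurable: "mag \<in> borel_measurable P"
proof -
  have "N \<in> borel_measurable (restrict_space (Pi\<^sub>M {..<d} (\<lambda>_. borel)) X)"
    by (intro measurable_restrict_space1 borel_measurable_norm norm)
  from measurable_compose[OF measurable_fst this]
  have "mag \<in> borel_measurable (obs_space d X)" unfolding obs_space_def mag_def .
  then show ?thesis using measurable_cong_sets[OF sets_P refl] by blast
qed

lemma tail_event_sets: "tail_event \<in> events"
  unfolding tail_event_def using mag_measurable by measurable

lemma prob_tail_event: "prob tail_event = \<alpha>"
  using tail by (simp add: tail_event_def mag_def)

lemma in_tail_eq: "in_tail w l = of_bool (t \<le> mag (w l))" if "w \<in> space sample" "l \<in> {1..n}"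
  using sample_point[OF that] by (simp add: in_tail_def tail_event_def indicator_def)

lemma cond_risk_eq: "cond_risk P N c t g = tail_risk g / \<alpha>"
  unfolding cond_risk_def tail_risk_def set_lebesgue_integral_def tail_event_def mag_def tail[symmetric]
  by (simp add: mult.commute)

lemma component_measurable: "(\<lambda>w. w l) \<in> sample \<rightarrow>\<^sub>M P" if "l \<in> {1..n}"
  unfolding sample_def using that by (rule measurable_component_singleton)

lemma mag_component_measurable: "(\<lambda>w. mag (w l)) \<in> borel_measurable sample" if "l \<in> {1..n}"
  using measurable_compose[OF component_measurable[OF that] mag_measurable] .

lemma threshold_measurable: "threshold \<in> borel_measurable sample"
  unfolding threshold_def by (intro borel_measurable_kth_largest k mag_component_measurable)

lemma exceeds_measurable: "(\<lambda>w. exceeds w l) \<in> borel_measurable sample" if "l \<in> {1..n}"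
  unfolding exceeds_def using threshold_measurable mag_component_measurable[OF that] by measurable

lemma in_tail_measurable: "(\<lambda>w. in_tail w l) \<in> borel_measurable sample" if "l \<in> {1..n}"
  unfolding in_tail_def
  using measurable_compose[OF component_measurable[OF that] borel_measurable_indicator[OF tail_event_sets]] .

lemma misfit_measurable: "(\<lambda>w. misfit w l) \<in> borel_measurable sample" if "l \<in> {1..n}"
  unfolding misfit_def using exceeds_measurable[OF that] in_tail_measurable[OF that] by measurable

lemma misfit_bounds: "0 \<le> misfit w l" "misfit w l \<le> 1"
  by (auto simp: misfit_def exceeds_def in_tail_def indicator_def of_bool_def)

lemma misfit_integrable: "integrable sample (\<lambda>w. misfit w l)" if "l \<in> {1..n}"
  using misfit_bounds by (intro S.integrable_bounded[where C = 1] misfit_measurable that) (simp add: abs_le_iff)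

lemma rule_in_G: "\<Psi> S \<tau> (restrict w S) \<in> G" if "w \<in> space sample" "S \<subseteq> {1..n}"
proof -
  have "restrict w S \<in> space (Pi\<^sub>M S (\<lambda>_. P))"
    using sample_point[OF that(1)] that(2) by (auto simp: space_PiM)
  then show ?thesis using rule that(2) by (simp add: learning_rule_def)
qed

lemma predictor_in_G: "predictor w S \<in> G" if "w \<in> space sample" "S \<subseteq> {1..n}"
  unfolding predictor_def by (rule rule_in_G[OF that])

text \<open>
  Stated for an arbitrary measurable threshold \<open>\<tau>\<close>, since the proof also trains with a threshold
  other than the empirical one.
\<close>

lemma rule_cost_measurable:
  assumes "\<tau> \<in> borel_measurable sample" "S \<subseteq> {1..n}"
  shows "(\<lambda>(w, z). c (\<Psi> S (\<tau> w) (restrict w S)) z) \<in> borel_measurable (sample \<Otimes>\<^sub>M P)"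
proof -
  have m: "(\<lambda>(\<tau>, s, z). c (\<Psi> S \<tau> s) z) \<in> borel_measurable (borel \<Otimes>\<^sub>M (Pi\<^sub>M S (\<lambda>_. P) \<Otimes>\<^sub>M P))"
    using rule assms(2) by (simp add: learning_rule_def)
  have r: "(\<lambda>w. restrict w S) \<in> sample \<rightarrow>\<^sub>M Pi\<^sub>M S (\<lambda>_. P)"
    unfolding sample_def using assms(2) by (rule measurable_restrict_subset)
  have "(\<lambda>(w, z). (\<tau> w, restrict w S, z)) \<in> sample \<Otimes>\<^sub>M P \<rightarrow>\<^sub>M borel \<Otimes>\<^sub>M (Pi\<^sub>M S (\<lambda>_. P) \<Otimes>\<^sub>M P)"
    unfolding case_prod_beta
    by (intro measurable_Pair measurable_compose[OF measurable_fst assms(1)]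
        measurable_compose[OF measurable_fst r] measurable_snd)
  from measurable_compose[OF this m] show ?thesis by (simp add: case_prod_beta)
qed

lemma rule_cost_at_measurable:
  assumes "\<tau> \<in> borel_measurable sample" "S \<subseteq> {1..n}" "l \<in> {1..n}"
  shows "(\<lambda>w. c (\<Psi> S (\<tau> w) (restrict w S)) (w l)) \<in> borel_measurable sample"
proof -
  have "(\<lambda>w. (w, w l)) \<in> sample \<rightarrow>\<^sub>M sample \<Otimes>\<^sub>M P"
    using component_measurable[OF assms(3)] by simp
  from measurable_compose[OF this rule_cost_measurable[OF assms(1,2)]] show ?thesis by simp
qed

lemma tail_risk_measurable:
  assumes "\<tau> \<in> borel_measurable sample" "S \<subseteq> {1..n}"
  shows "(\<lambda>w. tail_risk (\<Psi> S (\<tau> w) (restrict w S))) \<in> borel_measurable sample"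
  unfolding tail_risk_def
proof (rule borel_measurable_lebesgue_integral)
  have "(\<lambda>x. indicator tail_event (snd x) :: real) \<in> borel_measurable (sample \<Otimes>\<^sub>M P)"
    using measurable_compose[OF measurable_snd borel_measurable_indicator[OF tail_event_sets]] .
  with rule_cost_measurable[OF assms]
  show "(\<lambda>(w, z). c (\<Psi> S (\<tau> w) (restrict w S)) z * indicator tail_event z) \<in> borel_measurable (sample \<Otimes>\<^sub>M P)"
    by (simp add: case_prod_beta)
qed

lemma tail_cost_integrable: "integrable P (\<lambda>z. c g z * indicator tail_event z)" if "g \<in> G"
  using cost_bounds[OF that] cost_measurable[OF that] tail_event_sets
  by (intro integrable_bounded[where C = 1]) (auto simp: indicator_def)

lemma tail_risk_bounds: "0 \<le> tail_risk g" "tail_risk g \<le> \<alpha>" if "g \<in> G"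
proof -
  show "0 \<le> tail_risk g" unfolding tail_risk_def
    using cost_bounds[OF that] by (intro integral_nonneg_AE) auto
  have "tail_risk g \<le> (LINT z|P. indicator tail_event z)"
    unfolding tail_risk_def
  proof (rule Bochner_Integration.integral_mono[OF tail_cost_integrable[OF that]])
    show "integrable P (indicator tail_event :: obs \<Rightarrow> real)"
      using tail_event_sets by (intro integrable_bounded[where C = 1]) (auto simp: indicator_def)
  qed (use cost_bounds[OF that] in \<open>auto simp: indicator_def\<close>)
  also have "\<dots> = \<alpha>" using tail_event_sets prob_tail_event by simp
  finally show "tail_risk g \<le> \<alpha>" .
qed

text \<open>
  A set shattered by the level sets at \<open>s\<close>, lifted to height \<open>s\<close>, is shattered by the subgraphs. The
  maximum with 1 serves the chaining bound, which would fail for \<open>v = 0\<close>: a single function has a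
  nonzero deviation.
\<close>

lemma level_vc_costs: "level_vc (space P) (c ` G) (max v 1)"
  unfolding level_vc_def
proof (intro allI impI)
  fix s :: real and A :: "obs set"
  assume A: "finite A" "shatters ((\<lambda>f. {z \<in> space P. s < f z}) ` c ` G) A"
  define j where "j z = (fst z, snd z, s)" for z :: obs
  have inj: "inj_on j A" by (auto simp: inj_on_def j_def prod_eq_iff)
  have AP: "A \<subseteq> space P"
  proof -
    from shattersD[OF A(2) subset_refl] obtain g where "A \<inter> {z \<in> space P. s < c g z} = A" by auto
    then show ?thesis by auto
  qed
  have "shatters (subgraph (X \<times> {-1, 1}) c ` G) (j ` A)"
    unfolding shatters_def
  proof (intro allI impI)
    fix B assume B: "B \<subseteq> j ` A"
    from shattersD[OF A(2), of "{z \<in> A. j z \<in> B}"] obtain g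
      where g: "g \<in> G" "A \<inter> {z \<in> space P. s < c g z} = {z \<in> A. j z \<in> B}" by auto
    have "j z \<in> subgraph (X \<times> {-1, 1}) c g \<longleftrightarrow> j z \<in> B" if "z \<in> A" for z
    proof -
      have "j z \<in> subgraph (X \<times> {-1, 1}) c g \<longleftrightarrow> z \<in> {z \<in> space P. s < c g z}"
        by (cases z) (simp add: j_def subgraph_def space_P)
      also have "\<dots> \<longleftrightarrow> j z \<in> B" using g(2) that by blast
      finally show ?thesis .
    qed
    then have "j ` A \<inter> subgraph (X \<times> {-1, 1}) c g = B" using B by blast
    then show "\<exists>S\<in>subgraph (X \<times> {-1, 1}) c ` G. j ` A \<inter> S = B" using g(1) by blast
  qed
  then have "enat (card (j ` A)) \<le> vc_dim (subgraph (X \<times> {-1, 1}) c ` G)"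
    unfolding vc_dim_def using A(1) by (intro SUP_upper) simp
  then have "card (j ` A) \<le> v" by (simp add: vc)
  then show "card A \<le> max v 1" by (simp add: card_image[OF inj])
qed

lemma deviation_rule:
  assumes T: "T \<subseteq> {1..n}" "T \<noteq> {}" and tau: "\<tau> \<in> borel_measurable sample" and S: "S \<subseteq> {1..n}"
  defines "g \<equiv> \<lambda>w. \<Psi> S (\<tau> w) (restrict w S)"
  shows "integrable sample (\<lambda>w. deviation T (g w) w)"
    and "(LINT w|sample. deviation T (g w) w) \<le> 40 * sqrt (max v 1 * card T * \<alpha>)"
proof -
  have g: "g w \<in> G" if "w \<in> space sample" for w unfolding g_def by (rule rule_in_G[OF that S])
  have "(\<lambda>w. deviation T (g w) w) \<in> borel_measurable sample"
    unfolding deviation_def g_def using T rule_cost_at_measurable[OF tau S] tail_risk_measurable[OF tau S] in_tail_measurable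
    by (intro borel_measurable_abs borel_measurable_diff borel_measurable_sum borel_measurable_times) auto
  then show "integrable sample (\<lambda>w. deviation T (g w) w)"
  proof (rule S.integrable_bounded[where C = "2 * card T"])
    fix w assume w: "w \<in> space sample"
    have "\<bar>\<Sum>l\<in>T. c (g w) (w l) * in_tail w l\<bar> \<le> (\<Sum>l\<in>T. 1)"
    proof (rule order_trans[OF sum_abs sum_mono])
      fix l assume "l \<in> T"
      then have "w l \<in> space P" using sample_point[OF w] T(1) by blast
      from cost_bounds[OF g[OF w] this]
      show "\<bar>c (g w) (w l) * in_tail w l\<bar> \<le> 1" by (simp add: in_tail_def indicator_def)
    qed
    moreover have "0 \<le> card T * tail_risk (g w)" "card T * tail_risk (g w) \<le> card T * 1"
      using tail_risk_bounds[OF g[OF w]] alpha_bounds mult_left_mono[of "tail_risk (g w)" 1 "card T"] by auto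
    ultimately show "\<bar>deviation T (g w) w\<bar> \<le> 2 * card T" by (simp add: deviation_def)
  qed
  have "(LINT w|Pi\<^sub>M {1..n} (\<lambda>_. P). \<bar>(\<Sum>l\<in>T. c (g w) (w l) * indicator tail_event (w l))
      - card T * (LINT z|P. c (g w) z * indicator tail_event z)\<bar>) \<le> 40 * sqrt (max v 1 * card T * prob tail_event)"
  proof (rule symmetrized_deviation[OF T tail_event_sets _ _ _ _ level_vc_costs])
    show "0 < prob tail_event" using prob_tail_event alpha_bounds by simp
    show "(\<lambda>(w, z). c (g w) z) \<in> borel_measurable (Pi\<^sub>M {1..n} (\<lambda>_. P) \<Otimes>\<^sub>M P)"
      using rule_cost_measurable[OF tau S] by (simp add: g_def sample_def)
    show "c (g w) \<in> c ` G" if "w \<in> space (Pi\<^sub>M {1..n} (\<lambda>_. P))" for w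
      using g that by (simp add: sample_def)
  qed (use cost_bounds in auto)
  then show "(LINT w|sample. deviation T (g w) w) \<le> 40 * sqrt (max v 1 * card T * \<alpha>)"
    by (simp add: deviation_def in_tail_def tail_risk_def prob_tail_event sample_def)
qed

text \<open>
  Integrate out observation \<open>i\<close> first: a tie with observation \<open>j\<close> at a level of at
  least \<open>t\<close> has probability zero, because the law of the norm has no atoms there.
\<close>

lemma AE_no_ties:
  "AE w in sample. \<forall>i\<in>{1..n}. \<forall>j\<in>{1..n}. t \<le> mag (w i) \<longrightarrow> mag (w i) = mag (w j) \<longrightarrow> i = j"
proof -
  have "AE w in sample. t \<le> mag (w i) \<longrightarrow> mag (w i) = mag (w j) \<longrightarrow> i = j"
    if ij: "i \<in> {1..n}" "j \<in> {1..n}" for i j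
  proof (cases "i = j")
    case False
    define tie where "tie w = (of_bool (t \<le> mag (w j) \<and> mag (w i) = mag (w j)) :: real)" for w
    have meas: "tie \<in> borel_measurable sample"
    proof -
      define E where "E = {w \<in> space sample. t \<le> mag (w j)} \<inter> {w \<in> space sample. mag (w i) = mag (w j)}"
      have "E \<in> sets sample"
        unfolding E_def
        by (intro sets.Int borel_measurable_le borel_measurable_eq borel_measurable_const
            mag_component_measurable ij)
      then have "(indicator E :: _ \<Rightarrow> real) \<in> borel_measurable sample" by (rule borel_measurable_indicator)
      also have "?this \<longleftrightarrow> ?thesis"
        by (rule measurable_cong) (auto simp: E_def tie_def indicator_def)
      finally show ?thesis .
    qed
    have "(LINT w|sample. tie w) = (LINT w|sample. (LINT z|P. tie (w(i := z))))"
      unfolding sample_def by (rule integral_PiM_resample[OF _ _ meas[unfolded sample_def], where C = 1])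
        (use ij in \<open>auto simp: tie_def\<close>)
    also have "\<dots> = (LINT w|sample. 0)"
    proof (rule Bochner_Integration.integral_cong[OF refl])
      fix w
      have "(LINT z|P. tie (w(i := z))) = (LINT z|P. indicator {z \<in> space P. t \<le> mag (w j) \<and> mag z = mag (w j)} z)"
        using False by (intro Bochner_Integration.integral_cong) (auto simp: tie_def indicator_def)
      also have "\<dots> = prob {z \<in> space P. t \<le> mag (w j) \<and> mag z = mag (w j)}"
        using mag_measurable by (subst Bochner_Integration.integral_indicator) (auto simp: Int_def conj_commute intro!: arg_cong[where f = prob])
      also have "\<dots> = 0"
        using no_atom[of "mag (w j)"] by (cases "t \<le> mag (w j)") (auto simp: mag_def)
      finally show "(LINT z|P. tie (w(i := z))) = 0" .
    qed
    finally have "(LINT w|sample. tie w) = 0" by simp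
    moreover have "integrable sample tie" using meas by (rule S.integrable_bounded[where C = 1]) (simp add: tie_def)
    moreover have "AE w in sample. 0 \<le> tie w" by (simp add: tie_def)
    ultimately have "AE w in sample. tie w = 0" using integral_nonneg_eq_0_iff_AE by blast
    then show ?thesis by (rule AE_mp) (auto simp: tie_def intro!: AE_I2)
  qed simp
  then show ?thesis by (intro AE_finite_allI) auto
qed

end

section \<open>Held-out costs\<close>

context lpo_setting
begin

text \<open>
  The fluctuation of the number of tail observations about its mean \<open>k\<close> is the deviation of the
  class that consists of the constant function 1.
\<close>

lemma expected_misfit:
  "(LINT w|sample. (\<Sum>l\<in>{1..n}. misfit w l)) \<le> 40 * sqrt k + 1"
proof -
  define dv where "dv w = \<bar>(\<Sum>l\<in>{1..n}. in_tail w l) - real k\<bar>" for w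
  have one: "level_vc (space P) {\<lambda>_. 1} 1"
    unfolding level_vc_def
  proof (intro allI impI)
    fix s :: real and A :: "obs set"
    assume A: "shatters ((\<lambda>f. {z \<in> space P. s < f z}) ` {\<lambda>_. 1}) A"
    define Z where "Z = {z \<in> space P. s < 1}"
    have "A \<inter> Z = B" if "B \<subseteq> A" for B using shattersD[OF A that] by (auto simp: Z_def)
    from this[of "{}"] this[of A] have "A = {}" by simp
    then show "card A \<le> 1" by simp
  qed
  have "(LINT w|Pi\<^sub>M {1..n} (\<lambda>_. P). \<bar>(\<Sum>l\<in>{1..n}. 1 * indicator tail_event (w l))
      - card {1..n} * (LINT z|P. 1 * indicator tail_event z)\<bar>) \<le> 40 * sqrt (real (1 * card {1..n}) * prob tail_event)"
    by (rule symmetrized_deviation[where f = "\<lambda>_ _. 1", OF subset_refl _ tail_event_sets _ _ _ _ one])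
      (use n_pos prob_tail_event alpha_bounds in auto)
  then have dev: "(LINT w|sample. dv w) \<le> 40 * sqrt k"
    using tail_event_sets alpha_bounds(3) by (simp add: dv_def in_tail_def sample_def prob_tail_event)
  have dv_int: "integrable sample dv"
  proof (rule S.integrable_bounded[where C = "n + k"])
    show "dv \<in> borel_measurable sample"
      unfolding dv_def using in_tail_measurable
      by (intro borel_measurable_abs borel_measurable_diff borel_measurable_sum borel_measurable_const) auto
    fix w
    have "(\<Sum>l\<in>{1..n}. in_tail w l) \<le> (\<Sum>l\<in>{1..n}. 1)"
      by (intro sum_mono) (simp add: in_tail_def indicator_def)
    moreover have "0 \<le> (\<Sum>l\<in>{1..n}. in_tail w l)" by (intro sum_nonneg) (simp add: in_tail_def)
    ultimately show "\<bar>dv w\<bar> \<le> n + k" by (simp add: dv_def)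
  qed
  have "(LINT w|sample. (\<Sum>l\<in>{1..n}. misfit w l)) \<le> (LINT w|sample. dv w + 1)"
  proof (rule integral_mono_AE)
    show "integrable sample (\<lambda>w. \<Sum>l\<in>{1..n}. misfit w l)"
      using misfit_integrable by (intro Bochner_Integration.integrable_sum) auto
    show "integrable sample (\<lambda>w. dv w + 1)" using dv_int by simp
    show "AE w in sample. (\<Sum>l\<in>{1..n}. misfit w l) \<le> dv w + 1"
      using AE_no_ties AE_space
    proof eventually_elim
      case (elim w)
      have "(\<Sum>l\<in>{1..n}. \<bar>of_bool (threshold w < mag (w l)) - of_bool (t \<le> mag (w l))\<bar>)
          \<le> \<bar>(\<Sum>l\<in>{1..n}. of_bool (t \<le> mag (w l))) - real k\<bar> + 1"
        unfolding threshold_def using elim(1) by (intro sum_exceedance_diff_le k) blast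
      moreover have "(\<Sum>l\<in>{1..n}. misfit w l)
          = (\<Sum>l\<in>{1..n}. \<bar>of_bool (threshold w < mag (w l)) - of_bool (t \<le> mag (w l))\<bar>)"
        by (intro sum.cong refl) (simp only: misfit_def exceeds_def in_tail_eq[OF elim(2)])
      moreover have "(\<Sum>l\<in>{1..n}. in_tail w l) = (\<Sum>l\<in>{1..n}. of_bool (t \<le> mag (w l)))"
        by (intro sum.cong refl) (simp only: in_tail_eq[OF elim(2)])
      ultimately show ?case by (simp only: dv_def)
    qed
  qed
  also have "\<dots> = (LINT w|sample. dv w) + 1" using dv_int by (simp add: S.prob_space)
  finally show ?thesis using dev by simp
qed

lemma sum_exceeds_le: "(\<Sum>l\<in>{1..n}. exceeds w l) \<le> real k"
proof -
  have "(\<Sum>l\<in>{1..n}. exceeds w l) = real (card {l \<in> {1..n}. threshold w < mag (w l)})"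
    by (simp add: exceeds_def Int_def)
  also have "\<dots> \<le> real k"
    unfolding threshold_def using kth_largest_counts(1)[OF k, of "\<lambda>l. mag (w l)"] by simp
  finally show ?thesis .
qed

lemma erm_on_training_set:
  assumes w: "w \<in> space sample" and S: "S \<subseteq> {1..n}" "S \<noteq> {}" and h: "h \<in> G"
  shows "(\<Sum>l\<in>S. c (predictor w S) (w l) * exceeds w l) \<le> (\<Sum>l\<in>S. c h (w l) * exceeds w l)"
proof -
  have "is_arg_min (\<lambda>g. emp_risk N c n \<alpha> w g S) (\<lambda>g. g \<in> G) (predictor w S)"
    using erm w S unfolding cond_erm_def sample_def trained_eq by blast
  then have "\<not> emp_risk N c n \<alpha> w h S < emp_risk N c n \<alpha> w (predictor w S) S"
    using h by (auto simp: is_arg_min_def)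
  moreover have "0 < 1 / (\<alpha> * real (card S))"
    using alpha_bounds S finite_subset[OF S(1)] by (simp add: card_gt_0_iff)
  ultimately show ?thesis
    unfolding emp_risk_eq by (simp only: not_less mult_le_cancel_left_pos)
qed

lemma V_subset: "V j \<subseteq> {1..n}" "card (V j) = p" "{1..n} - V j \<noteq> {}" "card ({1..n} - V j) = n - p"
  if "j \<in> {1..K}"
proof -
  have "V j \<in> {S. S \<subseteq> {1..n} \<and> card S = p}"
    using lpo that unfolding leave_p_out_def by (blast dest: bij_betw_apply)
  then show V: "V j \<subseteq> {1..n}" "card (V j) = p" by simp_all
  then have fin: "finite (V j)" by (meson finite_atLeastAtMost finite_subset)
  show c: "card ({1..n} - V j) = n - p" using V fin by (simp add: card_Diff_subset)
  show "{1..n} - V j \<noteq> {}" using c p by (metis card.empty diff_is_0_eq not_le)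
qed

definition cv_sum :: "(nat \<Rightarrow> obs) \<Rightarrow> real" where
  "cv_sum w = 1 / real K * (\<Sum>j=1..K. (\<Sum>i\<in>V j. c (predictor w ({1..n} - V j)) (w i) * exceeds w i) / real p)"

lemma cv_risk_eq: "cv_risk N c n \<alpha> \<Psi> K V w = cv_sum w / \<alpha>"
proof -
  have "cv_risk N c n \<alpha> \<Psi> K V w = 1 / real K * (\<Sum>j=1..K. 1 / (\<alpha> * real p) *
      (\<Sum>i\<in>V j. c (predictor w ({1..n} - V j)) (w i) * exceeds w i))"
    unfolding cv_risk_def trained_eq emp_risk_eq
    by (intro arg_cong2[where f = times] refl sum.cong) (simp only: V_subset(2))
  then show ?thesis by (simp add: cv_sum_def sum_divide_distrib mult_ac)
qed

lemma cv_sum_measurable: "cv_sum \<in> borel_measurable sample"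
  unfolding cv_sum_def predictor_def
proof (intro borel_measurable_times borel_measurable_const borel_measurable_sum borel_measurable_divide)
  fix i j assume "j \<in> {1..K}" "i \<in> V j"
  then have i: "i \<in> {1..n}" using V_subset(1) by blast
  show "(\<lambda>w. c (\<Psi> ({1..n} - V j) (threshold w) (restrict w ({1..n} - V j))) (w i)) \<in> borel_measurable sample"
    by (rule rule_cost_at_measurable[OF threshold_measurable _ i]) auto
  show "(\<lambda>w. exceeds w i) \<in> borel_measurable sample" by (rule exceeds_measurable[OF i])
qed

lemma cv_sum_bounds:
  assumes w: "w \<in> space sample"
  shows "0 \<le> cv_sum w" "cv_sum w \<le> \<alpha>"
proof -
  have cb: "0 \<le> c (predictor w ({1..n} - V j)) (w i)" "c (predictor w ({1..n} - V j)) (w i) \<le> 1"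
    if "j \<in> {1..K}" "i \<in> V j" for i j
  proof -
    have "w i \<in> space P" using sample_point[OF w] V_subset(1)[OF that(1)] that(2) by blast
    then show "0 \<le> c (predictor w ({1..n} - V j)) (w i)" "c (predictor w ({1..n} - V j)) (w i) \<le> 1"
      using cost_bounds predictor_in_G[OF w] by auto
  qed
  have ex: "0 \<le> exceeds w i" for i by (simp add: exceeds_def)
  show "0 \<le> cv_sum w"
    unfolding cv_sum_def using cb ex by (intro mult_nonneg_nonneg sum_nonneg divide_nonneg_nonneg) auto
  have "cv_sum w \<le> 1 / real K * (\<Sum>j=1..K. (\<Sum>i\<in>V j. exceeds w i) / real p)"
    unfolding cv_sum_def using cb ex
    by (intro mult_left_mono sum_mono divide_right_mono mult_left_le_one_le) auto
  also have "\<dots> = (\<Sum>i\<in>{1..n}. exceeds w i) / real n" by (rule leave_p_out_average(1)[OF lpo p])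
  also have "\<dots> \<le> real k / real n" by (intro divide_right_mono sum_exceeds_le) simp
  finally show "cv_sum w \<le> \<alpha>" by (simp add: alpha)
qed

text \<open>
  Two minimality properties with opposite signs. The predictor trained on \<open>T\<close> wins on \<open>T\<close>, the one
  trained on the whole sample wins there; subtracting, the latter wins on the validation set.
\<close>

lemma cv_sum_ge:
  assumes w: "w \<in> space sample"
  shows "(\<Sum>i\<in>{1..n}. c (predictor w {1..n}) (w i) * exceeds w i) / real n \<le> cv_sum w"
proof -
  define g where "g = predictor w {1..n}"
  have gG: "g \<in> G" unfolding g_def by (rule predictor_in_G[OF w subset_refl])
  have "(\<Sum>i\<in>V j. c g (w i) * exceeds w i) \<le> (\<Sum>i\<in>V j. c (predictor w ({1..n} - V j)) (w i) * exceeds w i)"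
    if j: "j \<in> {1..K}" for j
  proof -
    define T where "T = {1..n} - V j"
    define h where "h = predictor w T"
    have T: "T \<subseteq> {1..n}" "T \<noteq> {}" using V_subset[OF j] by (auto simp: T_def)
    have hG: "h \<in> G" unfolding h_def by (rule predictor_in_G[OF w T(1)])
    have split: "(\<Sum>i\<in>{1..n}. u i) = (\<Sum>i\<in>T. u i) + (\<Sum>i\<in>V j. u i)" for u :: "nat \<Rightarrow> real"
      unfolding T_def using V_subset[OF j] by (intro sum.subset_diff) auto
    have "(\<Sum>i\<in>T. c h (w i) * exceeds w i) \<le> (\<Sum>i\<in>T. c g (w i) * exceeds w i)"
      unfolding h_def by (rule erm_on_training_set[OF w T gG])
    moreover have "(\<Sum>i\<in>{1..n}. c g (w i) * exceeds w i) \<le> (\<Sum>i\<in>{1..n}. c h (w i) * exceeds w i)"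
      unfolding g_def using n_pos by (intro erm_on_training_set[OF w subset_refl _ hG]) auto
    ultimately show ?thesis unfolding split h_def T_def by linarith
  qed
  then have "1 / real K * (\<Sum>j=1..K. (\<Sum>i\<in>V j. c g (w i) * exceeds w i) / real p) \<le> cv_sum w"
    unfolding cv_sum_def by (intro mult_left_mono[OF sum_mono[OF divide_right_mono]]) auto
  then show ?thesis unfolding leave_p_out_average(1)[OF lpo p] g_def .
qed

text \<open>
  The cap exceeds all norms, so observation \<open>i\<close> ranks first. For \<open>2 \<le> k\<close> the value is the
  \<open>(k - 1)\<close>-st largest norm among the other observations.
\<close>

definition capped_threshold :: "nat \<Rightarrow> (nat \<Rightarrow> obs) \<Rightarrow> real" where
  "capped_threshold i w = kth_largest n k ((\<lambda>l. mag (w l))(i := 1 + (\<Sum>l\<in>{1..n}. \<bar>mag (w l)\<bar>)))"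

lemma capped_threshold_measurable:
  assumes "i \<in> {1..n}"
  shows "capped_threshold i \<in> borel_measurable sample"
proof -
  have "(\<lambda>w. kth_largest n k (\<lambda>l. if l = i then 1 + (\<Sum>l\<in>{1..n}. \<bar>mag (w l)\<bar>) else mag (w l)))
      \<in> borel_measurable sample"
  proof (rule borel_measurable_kth_largest[OF k])
    fix l assume l: "l \<in> {1..n}"
    have "(\<lambda>w. 1 + (\<Sum>l\<in>{1..n}. \<bar>mag (w l)\<bar>)) \<in> borel_measurable sample"
      using mag_component_measurable
      by (intro borel_measurable_add borel_measurable_const borel_measurable_sum borel_measurable_abs) auto
    then show "(\<lambda>w. if l = i then 1 + (\<Sum>l\<in>{1..n}. \<bar>mag (w l)\<bar>) else mag (w l)) \<in> borel_measurable sample"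
      using mag_component_measurable[OF l] by (cases "l = i") auto
  qed
  also have "(\<lambda>w. kth_largest n k (\<lambda>l. if l = i then 1 + (\<Sum>l\<in>{1..n}. \<bar>mag (w l)\<bar>) else mag (w l)))
      = capped_threshold i"
    by (rule ext) (simp only: capped_threshold_def fun_upd_def)
  finally show ?thesis .
qed

lemma mag_less_cap: "mag (w l) < 1 + (\<Sum>l\<in>{1..n}. \<bar>mag (w l)\<bar>)" if "l \<in> {1..n}"
  using member_le_sum[OF that, of "\<lambda>l. \<bar>mag (w l)\<bar>"] by simp

text \<open>
  Compare \<open>z\<close> with the cap by \<open>kth_largest_update_exceeding\<close>. The condition on \<open>k\<close> makes the capped
  entry exceed its own threshold.
\<close>

lemma threshold_eq_capped:
  assumes k2: "2 \<le> k" and i: "i \<in> {1..n}" and z: "threshold (w(i := z)) < mag z"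
  shows "threshold (w(i := z)) = capped_threshold i w"
proof -
  define x where "x = (\<lambda>l. mag (w l))"
  define b where "b = 1 + (\<Sum>l\<in>{1..n}. \<bar>mag (w l)\<bar>)"
  have upd: "(\<lambda>l. mag ((w(i := z)) l)) = x(i := mag z)" by (auto simp: x_def)
  have cap: "capped_threshold i w = kth_largest n k ((x(i := mag z))(i := b))"
    by (simp add: capped_threshold_def x_def b_def)
  have "kth_largest n k (x(i := b)) < b"
  proof (rule ccontr)
    assume "\<not> ?thesis"
    then have "{l \<in> {1..n}. kth_largest n k (x(i := b)) \<le> (x(i := b)) l} \<subseteq> {i}"
      using mag_less_cap[of _ w] by (force simp: x_def b_def split: if_splits)
    then have "card {l \<in> {1..n}. kth_largest n k (x(i := b)) \<le> (x(i := b)) l} \<le> card {i}"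
      by (intro card_mono) auto
    with kth_largest_counts(2)[OF k, of "x(i := b)"] k2 show False by simp
  qed
  then have "kth_largest n k ((x(i := mag z))(i := b)) = kth_largest n k (x(i := mag z))"
    using z unfolding threshold_def upd by (intro kth_largest_update_exceeding[OF k]) auto
  then show ?thesis unfolding cap threshold_def upd by simp
qed

lemma capped_misfit_le:
  assumes w: "w \<in> space sample" and i: "i \<in> {1..n}" and T: "T \<subseteq> {1..n}" "i \<notin> T"
    and no_ties: "\<forall>i\<in>{1..n}. \<forall>j\<in>{1..n}. t \<le> mag (w i) \<longrightarrow> mag (w i) = mag (w j) \<longrightarrow> i = j"
  shows "(\<Sum>l\<in>T. \<bar>of_bool (capped_threshold i w < mag (w l)) - in_tail w l\<bar>) \<le> (\<Sum>l\<in>T. misfit w l) + 1"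
proof -
  define u where "u = capped_threshold i w"
  have fin: "finite T" using T(1) by (rule finite_subset) simp
  have "(\<Sum>l\<in>T. \<bar>of_bool (u < mag (w l)) - in_tail w l\<bar>)
      \<le> (\<Sum>l\<in>T. misfit w l + of_bool (t \<le> u \<and> mag (w l) = u))"
  proof (rule sum_mono)
    fix l assume "l \<in> T"
    then have l: "l \<in> {1..n}" "l \<noteq> i" using T by auto
    show "\<bar>of_bool (u < mag (w l)) - in_tail w l\<bar> \<le> misfit w l + of_bool (t \<le> u \<and> mag (w l) = u)"
      unfolding misfit_def exceeds_def in_tail_eq[OF w l(1)] threshold_def u_def capped_threshold_def
      using leave_one_out_exceedance[OF k _ i l, of "\<lambda>l. mag (w l)"] mag_less_cap[OF i, of w]
      by (simp add: less_imp_le)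
  qed
  also have "\<dots> = (\<Sum>l\<in>T. misfit w l) + real (card {l \<in> T. t \<le> u \<and> mag (w l) = u})"
    using fin by (simp add: sum.distrib Int_def)
  also have "card {l \<in> T. t \<le> u \<and> mag (w l) = u} \<le> Suc 0"
    using fin no_ties T(1) by (subst card_le_Suc0_iff_eq) (auto simp: subset_iff)
  then have "real (card {l \<in> T. t \<le> u \<and> mag (w l) = u}) \<le> 1" by simp
  finally show ?thesis by (simp add: u_def)
qed

text \<open>
  With the other observations fixed, all \<open>z\<close> with a nonzero cost produce the same predictor \<open>g\<close>, so
  the integral over \<open>z\<close> is at most the tail risk of \<open>g\<close>. If such a \<open>z\<close> exists, \<open>g\<close> is an empirical
  risk minimiser on \<open>T\<close> for the threshold \<open>u\<close>, and a comparison with \<open>h\<close> through the empirical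
  risks on \<open>T\<close> bounds its tail risk. If there is none, the integral vanishes.
\<close>

lemma held_out_cost_resampled_le:
  assumes k2: "2 \<le> k" and i: "i \<in> {1..n}" and T: "T \<subseteq> {1..n}" "T \<noteq> {}" "i \<notin> T"
    and w: "w \<in> space sample" and h: "h \<in> G"
  defines "u \<equiv> capped_threshold i w"
  defines "g \<equiv> \<Psi> T u (restrict w T)"
  shows "(LINT z|P. c (predictor (w(i := z)) T) z * exceeds (w(i := z)) i * in_tail (w(i := z)) i)
    \<le> tail_risk h + (deviation T g w + deviation T h w
        + 2 * (\<Sum>l\<in>T. \<bar>of_bool (u < mag (w l)) - in_tail w l\<bar>)) / card T"
proof -
  define D where "D = (\<Sum>l\<in>T. \<bar>of_bool (u < mag (w l)) - in_tail w l\<bar>)"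
  have fin: "finite T" using T(1) by (rule finite_subset) simp
  have cT: "0 < real (card T)" using fin T(2) by (simp add: card_gt_0_iff)
  have gG: "g \<in> G" unfolding g_def by (rule rule_in_G[OF w T(1)])
  have rest: "restrict (w(i := z)) T = restrict w T" for z using T(3) by (auto simp: restrict_def fun_eq_iff)
  have pred_eq: "predictor (w(i := z)) T = g" if "threshold (w(i := z)) < mag z" for z
    unfolding predictor_def g_def u_def rest threshold_eq_capped[OF k2 i that] ..
  (* cond_erm speaks of thresholds that a sample attains, so minimality of g needs a witness z0. *)
  show ?thesis
  proof (cases "\<exists>z\<in>space P. threshold (w(i := z)) < mag z")
    case False
    then have "(LINT z|P. c (predictor (w(i := z)) T) z * exceeds (w(i := z)) i * in_tail (w(i := z)) i) = (LINT z|P. 0)"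
      by (intro Bochner_Integration.integral_cong) (auto simp: exceeds_def)
    also have "\<dots> \<le> tail_risk h + (deviation T g w + deviation T h w + 2 * D) / card T"
      using tail_risk_bounds(1)[OF h] by (simp add: deviation_def D_def sum_nonneg)
    finally show ?thesis by (simp add: D_def)
  next
    case True
    then obtain z0 where z0: "z0 \<in> space P" "threshold (w(i := z0)) < mag z0" by blast
    have "(LINT z|P. c (predictor (w(i := z)) T) z * exceeds (w(i := z)) i * in_tail (w(i := z)) i) \<le> tail_risk g"
      unfolding tail_risk_def
    proof (rule integral_mono_AE')
      show "integrable P (\<lambda>z. c g z * indicator tail_event z)" by (rule tail_cost_integrable[OF gG])
      show "AE z in P. c (predictor (w(i := z)) T) z * exceeds (w(i := z)) i * in_tail (w(i := z)) i
          \<le> c g z * indicator tail_event z"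
        using cost_bounds(1)[OF gG] pred_eq by (intro AE_I2) (auto simp: exceeds_def in_tail_def indicator_def)
      show "AE z in P. 0 \<le> c g z * indicator tail_event z"
        using cost_bounds(1)[OF gG] by (intro AE_I2) auto
    qed
    also have "\<dots> \<le> tail_risk h + (deviation T g w + deviation T h w + 2 * D) / card T"
    proof -
      have wz: "w(i := z0) \<in> space sample"
        using w z0(1) i by (auto simp: sample_def space_PiM PiE_def extensional_def Pi_def)
      have "(\<Sum>l\<in>T. c (predictor (w(i := z0)) T) ((w(i := z0)) l) * exceeds (w(i := z0)) l)
          \<le> (\<Sum>l\<in>T. c h ((w(i := z0)) l) * exceeds (w(i := z0)) l)"
        by (rule erm_on_training_set[OF wz T(1,2) h])
      moreover have "(\<Sum>l\<in>T. c f ((w(i := z0)) l) * exceeds (w(i := z0)) l)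
          = (\<Sum>l\<in>T. c f (w l) * of_bool (u < mag (w l)))" for f
        using T(3) unfolding exceeds_def threshold_eq_capped[OF k2 i z0(2)] u_def
        by (intro sum.cong) auto
      ultimately have min: "(\<Sum>l\<in>T. c g (w l) * of_bool (u < mag (w l)))
          \<le> (\<Sum>l\<in>T. c h (w l) * of_bool (u < mag (w l)))"
        unfolding pred_eq[OF z0(2)] by simp
      have swap: "\<bar>(\<Sum>l\<in>T. c f (w l) * of_bool (u < mag (w l))) - (\<Sum>l\<in>T. c f (w l) * in_tail w l)\<bar> \<le> D"
        if f: "f \<in> G" for f
      proof -
        have "\<bar>(\<Sum>l\<in>T. c f (w l) * of_bool (u < mag (w l))) - (\<Sum>l\<in>T. c f (w l) * in_tail w l)\<bar>
            = \<bar>\<Sum>l\<in>T. c f (w l) * (of_bool (u < mag (w l)) - in_tail w l)\<bar>"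
          by (simp add: sum_subtractf right_diff_distrib)
        also have "\<dots> \<le> D"
          unfolding D_def
        proof (rule order_trans[OF sum_abs sum_mono])
          fix l assume "l \<in> T"
          then have "w l \<in> space P" using sample_point[OF w] T(1) by blast
          then show "\<bar>c f (w l) * (of_bool (u < mag (w l)) - in_tail w l)\<bar> \<le> \<bar>of_bool (u < mag (w l)) - in_tail w l\<bar>"
            using cost_bounds[OF f] by (simp add: abs_mult mult_left_le_one_le)
        qed
        finally show ?thesis .
      qed
      have "card T * tail_risk g \<le> card T * tail_risk h + (deviation T g w + deviation T h w + 2 * D)"
        using min swap[OF gG] swap[OF h] unfolding deviation_def by linarith
      then have "card T * (tail_risk g - tail_risk h) \<le> deviation T g w + deviation T h w + 2 * D"
        by (simp add: algebra_simps)
      then have "tail_risk g - tail_risk h \<le> (deviation T g w + deviation T h w + 2 * D) / card T"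
        using cT by (simp add: pos_le_divide_eq mult.commute)
      then show ?thesis by linarith
    qed
    finally show ?thesis by (simp add: D_def)
  qed
qed

text \<open>
  Resampling observation \<open>i\<close> preserves the law of the sample. The comparison predictor is the one
  trained on the whole original sample, which may depend on the observation that is replaced.
\<close>

lemma expected_held_out_cost_le:
  assumes k2: "2 \<le> k" and i: "i \<in> {1..n}" and T: "T \<subseteq> {1..n}" "T \<noteq> {}" "i \<notin> T"
  shows "(LINT w|sample. c (predictor w T) (w i) * exceeds w i)
    \<le> (LINT w|sample. misfit w i) + (LINT w|sample. tail_risk (predictor w {1..n}))
      + (80 * sqrt (max v 1 * card T * \<alpha>) + 2 * (\<Sum>l\<in>T. LINT w|sample. misfit w l) + 2) / card T"
proof -
  define F where "F w = c (predictor w T) (w i) * exceeds w i * in_tail w i" for w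
  define h where "h w = predictor w {1..n}" for w
  define g where "g w = \<Psi> T (capped_threshold i w) (restrict w T)" for w
  define H where "H w = tail_risk (h w) + (deviation T (g w) w + deviation T (h w) w
    + 2 * ((\<Sum>l\<in>T. misfit w l) + 1)) / card T" for w
  have cb: "0 \<le> c (predictor w T) (w i)" "c (predictor w T) (w i) \<le> 1" if "w \<in> space sample" for w
    using cost_bounds[OF predictor_in_G[OF that T(1)] sample_point[OF that i]] by auto
  have cm: "(\<lambda>w. c (predictor w T) (w i)) \<in> borel_measurable sample"
    unfolding predictor_def by (rule rule_cost_at_measurable[OF threshold_measurable T(1) i])
  have Fm: "F \<in> borel_measurable sample"
    unfolding F_def by (intro borel_measurable_times cm exceeds_measurable in_tail_measurable i)
  have Fb: "0 \<le> F w" "F w \<le> 1" if "w \<in> space sample" for w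
    using cb[OF that] by (auto simp: F_def exceeds_def in_tail_def indicator_def)
  have Fi: "integrable sample F" using Fm Fb by (intro S.integrable_bounded[where C = 1]) auto
  have ci: "integrable sample (\<lambda>w. c (predictor w T) (w i) * exceeds w i)"
    using cb by (intro S.integrable_bounded[where C = 1] borel_measurable_times cm exceeds_measurable i)
      (auto simp: exceeds_def)
  have risk_int: "integrable sample (\<lambda>w. tail_risk (h w))"
  proof (rule S.integrable_bounded[where C = 1])
    show "(\<lambda>w. tail_risk (h w)) \<in> borel_measurable sample"
      unfolding h_def predictor_def by (rule tail_risk_measurable[OF threshold_measurable subset_refl])
    fix w assume "w \<in> space sample"
    then show "\<bar>tail_risk (h w)\<bar> \<le> 1"
      using tail_risk_bounds[OF predictor_in_G[of w "{1..n}"]] alpha_bounds by (auto simp: h_def)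
  qed
  have dev_g: "integrable sample (\<lambda>w. deviation T (g w) w)"
    "(LINT w|sample. deviation T (g w) w) \<le> 40 * sqrt (max v 1 * card T * \<alpha>)"
    unfolding g_def by (rule deviation_rule[OF T(1,2) capped_threshold_measurable[OF i] T(1)])+
  have dev_h: "integrable sample (\<lambda>w. deviation T (h w) w)"
    "(LINT w|sample. deviation T (h w) w) \<le> 40 * sqrt (max v 1 * card T * \<alpha>)"
    unfolding h_def predictor_def by (rule deviation_rule[OF T(1,2) threshold_measurable subset_refl])+
  have mis_int: "integrable sample (\<lambda>w. \<Sum>l\<in>T. misfit w l)"
    using misfit_integrable T(1) by (intro Bochner_Integration.integrable_sum) auto
  have mis: "(LINT w|sample. (\<Sum>l\<in>T. misfit w l)) = (\<Sum>l\<in>T. LINT w|sample. misfit w l)"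
    using misfit_integrable T(1) by (intro Bochner_Integration.integral_sum) auto
  have Hi: "integrable sample H"
    unfolding H_def using risk_int dev_g(1) dev_h(1) mis_int by simp
  have "(LINT w|sample. H w) = (LINT w|sample. tail_risk (h w)) + ((LINT w|sample. deviation T (g w) w)
      + (LINT w|sample. deviation T (h w) w) + 2 * ((\<Sum>l\<in>T. LINT w|sample. misfit w l) + 1)) / card T"
    unfolding H_def mis[symmetric] using risk_int dev_g(1) dev_h(1) mis_int by (simp add: S.prob_space)
  also have "\<dots> \<le> (LINT w|sample. tail_risk (h w))
      + (80 * sqrt (max v 1 * card T * \<alpha>) + 2 * (\<Sum>l\<in>T. LINT w|sample. misfit w l) + 2) / card T"
    using dev_g(2) dev_h(2) by (intro add_left_mono divide_right_mono) auto
  finally have EH: "(LINT w|sample. H w) \<le> (LINT w|sample. tail_risk (h w))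
      + (80 * sqrt (max v 1 * card T * \<alpha>) + 2 * (\<Sum>l\<in>T. LINT w|sample. misfit w l) + 2) / card T" .
  have "(LINT w|sample. c (predictor w T) (w i) * exceeds w i) \<le> (LINT w|sample. misfit w i + F w)"
  proof (rule Bochner_Integration.integral_mono[OF ci])
    show "integrable sample (\<lambda>w. misfit w i + F w)" using misfit_integrable[OF i] Fi by simp
    fix w assume "w \<in> space sample"
    from cb[OF this] show "c (predictor w T) (w i) * exceeds w i \<le> misfit w i + F w"
      by (auto simp: F_def misfit_def exceeds_def in_tail_def indicator_def)
  qed
  also have "\<dots> = (LINT w|sample. misfit w i) + (LINT w|sample. F w)"
    using misfit_integrable[OF i] Fi by simp
  (* F keeps only the held-out costs inside the tail event, so that after resampling the integral
     is at most a tail risk. *)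
  also have "(LINT w|sample. F w) = (LINT w|sample. (LINT z|P. F (w(i := z))))"
    unfolding sample_def using Fm Fb
    by (intro integral_PiM_resample[where C = 1] i) (auto simp: sample_def)
  also have "\<dots> \<le> (LINT w|sample. H w)"
  proof (rule integral_mono_AE')
    show "integrable sample H" by (rule Hi)
    show "AE w in sample. (LINT z|P. F (w(i := z))) \<le> H w"
      using AE_no_ties AE_space
    proof eventually_elim
      case (elim w)
      have hG: "h w \<in> G" unfolding h_def by (rule predictor_in_G[OF elim(2) subset_refl])
      have "(LINT z|P. F (w(i := z))) \<le> tail_risk (h w) + (deviation T (g w) w + deviation T (h w) w
          + 2 * (\<Sum>l\<in>T. \<bar>of_bool (capped_threshold i w < mag (w l)) - in_tail w l\<bar>)) / card T"
        unfolding F_def g_def using held_out_cost_resampled_le[OF k2 i T elim(2) hG] by simp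
      also have "\<dots> \<le> H w"
        unfolding H_def using capped_misfit_le[OF elim(2) i T(1,3) elim(1)]
        by (intro add_left_mono divide_right_mono mult_left_mono) auto
      finally show ?case .
    qed
    show "AE w in sample. 0 \<le> H w"
      using AE_space
    proof eventually_elim
      case (elim w)
      then have "0 \<le> tail_risk (h w)" unfolding h_def by (intro tail_risk_bounds predictor_in_G) auto
      moreover have "0 \<le> deviation T (g w) w" "0 \<le> deviation T (h w) w" by (auto simp: deviation_def)
      moreover have "0 \<le> (\<Sum>l\<in>T. misfit w l)" by (intro sum_nonneg misfit_bounds)
      ultimately show ?case by (simp add: H_def)
    qed
  qed
  finally show ?thesis using EH unfolding h_def by linarith
qed

end

section \<open>The error of cross-validation\<close>

context lpo_setting
begin

lemma K_pos: "0 < K"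
  using lpo p by (simp add: leave_p_out_def)

lemma final_risk_integrable: "integrable sample (\<lambda>w. tail_risk (predictor w {1..n}))"
proof (rule S.integrable_bounded[where C = 1])
  show "(\<lambda>w. tail_risk (predictor w {1..n})) \<in> borel_measurable sample"
    unfolding predictor_def by (rule tail_risk_measurable[OF threshold_measurable subset_refl])
  fix w assume "w \<in> space sample"
  then show "\<bar>tail_risk (predictor w {1..n})\<bar> \<le> 1"
    using tail_risk_bounds[OF predictor_in_G[of w "{1..n}"]] alpha_bounds by auto
qed

lemma cv_sum_integrable: "integrable sample cv_sum"
  using cv_sum_measurable cv_sum_bounds by (intro S.integrable_bounded[where C = \<alpha>]) auto

lemma expected_cv_sum_le:
  assumes k2: "2 \<le> k"
  shows "(LINT w|sample. cv_sum w) \<le> (LINT w|sample. tail_risk (predictor w {1..n}))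
    + 3 * (LINT w|sample. (\<Sum>l\<in>{1..n}. misfit w l)) / n
    + (80 * sqrt (real (max v 1 * (n - p)) * \<alpha>) + 2) / real (n - p)"
proof -
  define m where "m = real (n - p)"
  define R where "R = 80 * sqrt (real (max v 1 * (n - p)) * \<alpha>)"
  define Eh where "Eh = (LINT w|sample. tail_risk (predictor w {1..n}))"
  define a where "a l = (LINT w|sample. misfit w l)" for l
  have m: "m > 0" using p by (simp add: m_def)
  have suma: "(LINT w|sample. (\<Sum>l\<in>{1..n}. misfit w l)) = (\<Sum>l\<in>{1..n}. a l)"
    unfolding a_def using misfit_integrable by (intro Bochner_Integration.integral_sum) auto
  have int: "integrable sample (\<lambda>w. c (predictor w ({1..n} - V j)) (w i) * exceeds w i)"
    if "j \<in> {1..K}" "i \<in> V j" for i j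
  proof (rule S.integrable_bounded[where C = 1])
    have i: "i \<in> {1..n}" using V_subset(1) that by blast
    show "(\<lambda>w. c (predictor w ({1..n} - V j)) (w i) * exceeds w i) \<in> borel_measurable sample"
      unfolding predictor_def
      by (intro borel_measurable_times exceeds_measurable rule_cost_at_measurable threshold_measurable i) auto
    fix w assume w: "w \<in> space sample"
    from cost_bounds[OF predictor_in_G[OF w, of "{1..n} - V j"] sample_point[OF w i]]
    show "\<bar>c (predictor w ({1..n} - V j)) (w i) * exceeds w i\<bar> \<le> 1" by (simp add: exceeds_def)
  qed
  have "(LINT w|sample. cv_sum w) = 1 / real K * (\<Sum>j=1..K.
      (\<Sum>i\<in>V j. LINT w|sample. c (predictor w ({1..n} - V j)) (w i) * exceeds w i) / real p)"
  proof -
    have "(LINT w|sample. cv_sum w) = 1 / real K * (LINT w|sample. (\<Sum>j=1..K.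
      (\<Sum>i\<in>V j. c (predictor w ({1..n} - V j)) (w i) * exceeds w i) / real p))"
      unfolding cv_sum_def by (rule Bochner_Integration.integral_mult_right_zero)
    also have "(LINT w|sample. (\<Sum>j=1..K. (\<Sum>i\<in>V j. c (predictor w ({1..n} - V j)) (w i) * exceeds w i) / real p))
        = (\<Sum>j=1..K. LINT w|sample. (\<Sum>i\<in>V j. c (predictor w ({1..n} - V j)) (w i) * exceeds w i) / real p)"
      using int by (intro Bochner_Integration.integral_sum integrable_divide_zero Bochner_Integration.integrable_sum) auto
    also have "\<dots> = (\<Sum>j=1..K. (\<Sum>i\<in>V j. LINT w|sample. c (predictor w ({1..n} - V j)) (w i) * exceeds w i) / real p)"
    proof (rule sum.cong[OF refl])
      fix j assume "j \<in> {1..K}"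
      then have "(LINT w|sample. (\<Sum>i\<in>V j. c (predictor w ({1..n} - V j)) (w i) * exceeds w i))
          = (\<Sum>i\<in>V j. LINT w|sample. c (predictor w ({1..n} - V j)) (w i) * exceeds w i)"
        using int by (intro Bochner_Integration.integral_sum) auto
      then show "(LINT w|sample. (\<Sum>i\<in>V j. c (predictor w ({1..n} - V j)) (w i) * exceeds w i) / real p)
          = (\<Sum>i\<in>V j. LINT w|sample. c (predictor w ({1..n} - V j)) (w i) * exceeds w i) / real p" by simp
    qed
    finally show ?thesis .
  qed
  also have "\<dots> \<le> 1 / real K * (\<Sum>j=1..K. (\<Sum>i\<in>V j. a i + Eh + (R + 2 * (\<Sum>l\<in>{1..n} - V j. a l) + 2) / m) / real p)"
  proof (rule mult_left_mono[OF sum_mono[OF divide_right_mono[OF sum_mono]]])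
    fix j i assume j: "j \<in> {1..K}" and i: "i \<in> V j"
    have "(LINT w|sample. c (predictor w ({1..n} - V j)) (w i) * exceeds w i)
      \<le> a i + Eh + (80 * sqrt (real (max v 1 * card ({1..n} - V j)) * \<alpha>)
          + 2 * (\<Sum>l\<in>{1..n} - V j. a l) + 2) / real (card ({1..n} - V j))"
      unfolding a_def Eh_def using V_subset[OF j] i by (intro expected_held_out_cost_le k2) auto
    then show "(LINT w|sample. c (predictor w ({1..n} - V j)) (w i) * exceeds w i)
        \<le> a i + Eh + (R + 2 * (\<Sum>l\<in>{1..n} - V j. a l) + 2) / m"
      unfolding V_subset(4)[OF j] R_def m_def .
  qed auto
  also have "\<dots> = 1 / real K * (\<Sum>j=1..K. (\<Sum>i\<in>V j. a i) / real p
      + 2 * ((\<Sum>l\<in>{1..n} - V j. a l) / real (n - p)) + (Eh + (R + 2) / m))"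
  proof (rule arg_cong[where f = "\<lambda>x. 1 / real K * x"], rule sum.cong[OF refl])
    fix j assume j: "j \<in> {1..K}"
    define b where "b = (\<Sum>l\<in>{1..n} - V j. a l)"
    have "(\<Sum>i\<in>V j. a i + Eh + (R + 2 * b + 2) / m) = (\<Sum>i\<in>V j. a i) + real p * (Eh + (R + 2 * b + 2) / m)"
      by (simp add: sum.distrib V_subset[OF j] algebra_simps)
    then have "(\<Sum>i\<in>V j. a i + Eh + (R + 2 * b + 2) / m) / real p
        = (\<Sum>i\<in>V j. a i) / real p + (Eh + (R + 2 * b + 2) / m)"
      using p by (simp add: add_divide_distrib)
    also have "\<dots> = (\<Sum>i\<in>V j. a i) / real p + 2 * (b / m) + (Eh + (R + 2) / m)"
      by (simp add: add_divide_distrib)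
    finally show "(\<Sum>i\<in>V j. a i + Eh + (R + 2 * b + 2) / m) / real p
        = (\<Sum>i\<in>V j. a i) / real p + 2 * (b / real (n - p)) + (Eh + (R + 2) / m)" unfolding m_def .
  qed
  also have "\<dots> = 1 / real K * (\<Sum>j=1..K. (\<Sum>i\<in>V j. a i) / real p)
      + 2 * (1 / real K * (\<Sum>j=1..K. (\<Sum>l\<in>{1..n} - V j. a l) / real (n - p))) + (Eh + (R + 2) / m)"
  proof -
    define A B where "A j = (\<Sum>i\<in>V j. a i) / real p" and "B j = (\<Sum>l\<in>{1..n} - V j. a l) / real (n - p)" for j
    define e where "e = Eh + (R + 2) / m"
    have "(\<Sum>j=1..K. A j + 2 * B j + e) = (\<Sum>j=1..K. A j) + 2 * (\<Sum>j=1..K. B j) + real K * e"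
      by (simp add: sum.distrib sum_distrib_left)
    then have "1 / real K * (\<Sum>j=1..K. A j + 2 * B j + e)
        = 1 / real K * (\<Sum>j=1..K. A j) + 2 * (1 / real K * (\<Sum>j=1..K. B j)) + e"
      using K_pos by (simp add: field_simps)
    then show ?thesis unfolding A_def B_def e_def .
  qed
  also have "\<dots> = 3 * (\<Sum>l\<in>{1..n}. a l) / n + (Eh + (R + 2) / m)"
    unfolding leave_p_out_average[OF lpo p] by simp
  finally show ?thesis unfolding suma Eh_def R_def m_def by (simp only: ac_simps)
qed

text \<open>
  The identity \<open>\<bar>x\<bar> = x + 2 * max 0 (- x)\<close> with the pathwise lower bound \<open>cv_sum_ge\<close> for the negative
  part.
\<close>

lemma abs_cv_error_le:
  assumes w: "w \<in> space sample"
  defines "g \<equiv> predictor w {1..n}"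
  shows "\<bar>cv_sum w - tail_risk g\<bar>
    \<le> cv_sum w - tail_risk g + 2 * ((deviation {1..n} g w + (\<Sum>l\<in>{1..n}. misfit w l)) / n)"
proof -
  have gG: "g \<in> G" unfolding g_def by (rule predictor_in_G[OF w subset_refl])
  define e where "e = (\<Sum>l\<in>{1..n}. c g (w l) * exceeds w l)"
  have "\<bar>e - (\<Sum>l\<in>{1..n}. c g (w l) * in_tail w l)\<bar> = \<bar>\<Sum>l\<in>{1..n}. c g (w l) * (exceeds w l - in_tail w l)\<bar>"
    by (simp add: e_def sum_subtractf right_diff_distrib)
  also have "\<dots> \<le> (\<Sum>l\<in>{1..n}. misfit w l)"
  proof (rule order_trans[OF sum_abs sum_mono])
    fix l assume "l \<in> {1..n}"
    from cost_bounds[OF gG sample_point[OF w this]]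
    show "\<bar>c g (w l) * (exceeds w l - in_tail w l)\<bar> \<le> misfit w l"
      by (simp add: misfit_def abs_mult mult_left_le_one_le)
  qed
  finally have "real n * tail_risk g - e \<le> deviation {1..n} g w + (\<Sum>l\<in>{1..n}. misfit w l)"
    unfolding deviation_def by simp
  then have "tail_risk g - e / n \<le> (deviation {1..n} g w + (\<Sum>l\<in>{1..n}. misfit w l)) / n"
  proof -
    assume "real n * tail_risk g - e \<le> deviation {1..n} g w + (\<Sum>l\<in>{1..n}. misfit w l)"
    then have "(real n * tail_risk g - e) / n \<le> (deviation {1..n} g w + (\<Sum>l\<in>{1..n}. misfit w l)) / n"
      by (intro divide_right_mono) auto
    then show ?thesis using n_pos by (simp add: diff_divide_distrib)
  qed
  moreover have "e / n \<le> cv_sum w" unfolding e_def g_def by (rule cv_sum_ge[OF w])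
  moreover have "0 \<le> (deviation {1..n} g w + (\<Sum>l\<in>{1..n}. misfit w l)) / n"
    by (intro divide_nonneg_nonneg add_nonneg_nonneg sum_nonneg misfit_bounds) (auto simp: deviation_def)
  ultimately show ?thesis by linarith
qed

lemma expected_abs_cv_error_le:
  assumes k2: "2 \<le> k"
  shows "(LINT w|sample. \<bar>cv_sum w - tail_risk (predictor w {1..n})\<bar>)
    \<le> 5 * (40 * sqrt k + 1) / n + (80 * sqrt (real (max v 1 * (n - p)) * \<alpha>) + 2) / real (n - p)
      + 80 * sqrt (real (max v 1 * n) * \<alpha>) / n"
proof -
  define h where "h w = tail_risk (predictor w {1..n})" for w
  define dv where "dv w = deviation {1..n} (predictor w {1..n}) w" for w
  define H where "H w = (\<Sum>l\<in>{1..n}. misfit w l)" for w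
  have dv: "integrable sample dv" "(LINT w|sample. dv w) \<le> 40 * sqrt (real (max v 1 * n) * \<alpha>)"
    using deviation_rule[OF subset_refl _ threshold_measurable subset_refl] n_pos
    by (simp_all add: dv_def[abs_def] predictor_def)
  have Hint: "integrable sample H"
    unfolding H_def using misfit_integrable by (intro Bochner_Integration.integrable_sum) auto
  have hint: "integrable sample h" unfolding h_def by (rule final_risk_integrable)
  have "(LINT w|sample. \<bar>cv_sum w - h w\<bar>) \<le> (LINT w|sample. cv_sum w - h w + 2 * ((dv w + H w) / n))"
  proof (rule Bochner_Integration.integral_mono)
    show "integrable sample (\<lambda>w. \<bar>cv_sum w - h w\<bar>)" using cv_sum_integrable hint by simp
    show "integrable sample (\<lambda>w. cv_sum w - h w + 2 * ((dv w + H w) / n))"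
      using cv_sum_integrable hint dv(1) Hint by simp
    fix w assume "w \<in> space sample"
    then show "\<bar>cv_sum w - h w\<bar> \<le> cv_sum w - h w + 2 * ((dv w + H w) / n)"
      unfolding h_def dv_def H_def by (rule abs_cv_error_le)
  qed
  also have "\<dots> = (LINT w|sample. cv_sum w) - (LINT w|sample. h w)
      + 2 * (((LINT w|sample. dv w) + (LINT w|sample. H w)) / n)"
    using cv_sum_integrable hint dv(1) Hint by simp
  also have "\<dots> \<le> 3 * (LINT w|sample. H w) / n
      + (80 * sqrt (real (max v 1 * (n - p)) * \<alpha>) + 2) / real (n - p)
      + 2 * ((40 * sqrt (real (max v 1 * n) * \<alpha>) + (LINT w|sample. H w)) / n)"
  proof -
    have "((LINT w|sample. dv w) + (LINT w|sample. H w)) / n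
        \<le> (40 * sqrt (real (max v 1 * n) * \<alpha>) + (LINT w|sample. H w)) / n"
      using dv(2) by (intro divide_right_mono) auto
    moreover have "x - y + 2 * z \<le> u + e + 2 * z'" if "x \<le> y + u + e" "z \<le> z'" for x y z z' u e :: real
      using that by linarith
    ultimately show ?thesis using expected_cv_sum_le[OF k2] unfolding h_def H_def by blast
  qed
  also have "\<dots> = 5 * (LINT w|sample. H w) / n
      + (80 * sqrt (real (max v 1 * (n - p)) * \<alpha>) + 2) / real (n - p)
      + 80 * sqrt (real (max v 1 * n) * \<alpha>) / n"
    by (simp add: add_divide_distrib)
  also have "5 * (LINT w|sample. H w) / n \<le> 5 * (40 * sqrt k + 1) / n"
    using expected_misfit unfolding H_def by (intro divide_right_mono mult_left_mono) auto
  finally show ?thesis unfolding h_def by simp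
qed

text \<open>
  The bound \<open>expected_abs_cv_error_le\<close> in terms of \<open>s = sqrt (m * \<alpha>)\<close> and \<open>r = sqrt k\<close>, where
  \<open>1 \<le> s \<le> r\<close>; every term is at most a multiple of \<open>sqrt (max v 1) / s\<close>, and the multiples add up to 367.
\<close>

lemma expected_cv_error_rate:
  assumes s1: "1 \<le> real (n - p) * \<alpha>"
  shows "(LINT w|sample. \<bar>cv_sum w - tail_risk (predictor w {1..n})\<bar>)
    \<le> \<alpha> * (367 * (sqrt v + 1) / sqrt (real (n - p) * \<alpha>))"
proof -
  define m where "m = real (n - p)"
  define s where "s = sqrt (m * \<alpha>)"
  define q where "q = sqrt (real (max v 1))"
  define r where "r = sqrt (real k)"
  have m: "0 < m" "m < n" using p by (auto simp: m_def)
  have "m * \<alpha> < n * \<alpha>" using m(2) alpha_bounds(1) by (rule mult_strict_right_mono)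
  then have "1 < real n * \<alpha>" using s1[folded m_def] by (rule le_less_trans[rotated])
  then have k2: "2 \<le> k" unfolding alpha_bounds(3) by simp
  have s: "1 \<le> s" "s * s = m * \<alpha>" using s1[folded m_def] by (simp_all add: s_def)
  have r: "s \<le> r" "r * r = real k" "n * \<alpha> = r * r"
    using \<open>m * \<alpha> < n * \<alpha>\<close> alpha_bounds(3) by (simp_all add: s_def r_def)
  have q: "1 \<le> q" "q \<le> sqrt v + 1"
  proof -
    show "1 \<le> q" by (simp add: q_def)
    show "q \<le> sqrt v + 1" by (cases "v = 0") (auto simp: q_def max_def)
  qed
  have sq: "sqrt (real (max v 1 * (n - p)) * \<alpha>) = q * s" "sqrt (real (max v 1 * n) * \<alpha>) = q * r"
    unfolding of_nat_mult m_def[symmetric] mult.assoc alpha_bounds(3) q_def s_def r_def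
    by (simp_all only: real_sqrt_mult)
  have inv: "x / n = \<alpha> * (x / (r * r))" "x / m = \<alpha> * (x / (s * s))" for x
    unfolding r(3)[symmetric] s(2) using alpha_bounds(1) by simp_all
  have "(LINT w|sample. \<bar>cv_sum w - tail_risk (predictor w {1..n})\<bar>)
      \<le> 5 * (40 * r + 1) / n + (80 * (q * s) + 2) / m + 80 * (q * r) / n"
    using expected_abs_cv_error_le[OF k2] unfolding sq m_def r_def .
  also have "\<dots> = \<alpha> * (5 * (40 * r + 1) / (r * r) + (80 * (q * s) + 2) / (s * s) + 80 * (q * r) / (r * r))"
    unfolding inv by (simp add: algebra_simps)
  also have "\<dots> \<le> \<alpha> * (205 * q / s + 82 * q / s + 80 * q / s)"
  proof (intro mult_left_mono add_mono)
    have r1: "1 \<le> r" using r(1) s(1) by simp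
    have "5 * (40 * r + 1) / (r * r) \<le> 205 * r / (r * r)" using r1 by (intro divide_right_mono) auto
    also have "\<dots> = 205 / r" using r1 by simp
    also have "\<dots> \<le> 205 * q / s" using r(1) s(1) q(1) by (intro frac_le) auto
    finally show "5 * (40 * r + 1) / (r * r) \<le> 205 * q / s" .
    have "1 \<le> q * s" using q(1) s(1) mult_mono[of 1 q 1 s] by simp
    then have "(80 * (q * s) + 2) / (s * s) \<le> 82 * (q * s) / (s * s)" by (intro divide_right_mono) auto
    also have "\<dots> = 82 * q / s" using s(1) by simp
    finally show "(80 * (q * s) + 2) / (s * s) \<le> 82 * q / s" .
    have "80 * (q * r) / (r * r) = 80 * q / r" using r1 by simp
    also have "\<dots> \<le> 80 * q / s" using r(1) s(1) q(1) by (intro frac_le) auto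
    finally show "80 * (q * r) / (r * r) \<le> 80 * q / s" .
  qed (use alpha_bounds in auto)
  also have "\<dots> = \<alpha> * (367 * q / s)" by (simp add: field_simps)
  also have "\<dots> \<le> \<alpha> * (367 * (sqrt v + 1) / s)"
    using q(2) s(1) alpha_bounds by (intro mult_left_mono divide_right_mono) auto
  finally show ?thesis unfolding s_def m_def .
qed

lemma cv_error_probability:
  assumes \<delta>: "0 < \<delta>" "\<delta> < 1"
    and b: "367 * (sqrt v + 1) / (\<delta> * sqrt (real (n - p) * \<alpha>)) \<le> b"
  shows "1 - \<delta> \<le> measure sample {w \<in> space sample.
    \<bar>cv_risk N c n \<alpha> \<Psi> K V w - cond_risk P N c t (trained N n \<alpha> \<Psi> w {1..n})\<bar> \<le> b}"
proof -
  define D where "D w = \<bar>cv_sum w - tail_risk (predictor w {1..n})\<bar>" for w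
  define s where "s = sqrt (real (n - p) * \<alpha>)"
  have s: "0 < s" using p alpha_bounds by (simp add: s_def)
  have Dint: "integrable sample D"
    unfolding D_def using cv_sum_integrable final_risk_integrable by simp
  have set_eq: "{w \<in> space sample.
    \<bar>cv_risk N c n \<alpha> \<Psi> K V w - cond_risk P N c t (trained N n \<alpha> \<Psi> w {1..n})\<bar> \<le> b}
    = {w \<in> space sample. D w \<le> \<alpha> * b}"
  proof -
    have "\<bar>cv_risk N c n \<alpha> \<Psi> K V w - cond_risk P N c t (trained N n \<alpha> \<Psi> w {1..n})\<bar> = D w / \<alpha>" for w
      unfolding cv_risk_eq cond_risk_eq trained_eq D_def
      using alpha_bounds(1) by (simp add: abs_divide flip: diff_divide_distrib)
    then show ?thesis using alpha_bounds(1) by (simp add: pos_divide_le_eq mult.commute)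
  qed
  show ?thesis
  proof (cases "1 \<le> real (n - p) * \<alpha>")
    case True
    define y where "y = \<alpha> * (367 * (sqrt v + 1) / (\<delta> * s))"
    have y: "0 < y" unfolding y_def using alpha_bounds \<delta> s by (simp add: add_nonneg_pos)
    have "measure sample {w \<in> space sample. y \<le> D w} \<le> (LINT w|sample. D w) / y"
      by (rule integral_Markov_inequality_measure[OF Dint]) (use y in \<open>auto simp: D_def\<close>)
    also have "\<dots> \<le> (\<delta> * y) / y"
    proof (rule divide_right_mono)
      have "(LINT w|sample. D w) \<le> \<alpha> * (367 * (sqrt v + 1) / s)"
        unfolding D_def s_def by (rule expected_cv_error_rate[OF True])
      also have "\<dots> = \<delta> * y" using \<delta> by (simp add: y_def)
      finally show "(LINT w|sample. D w) \<le> \<delta> * y" .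
    qed (use y in simp)
    also have "\<dots> = \<delta>" using y by simp
    finally have small: "measure sample {w \<in> space sample. y \<le> D w} \<le> \<delta>" .
    have sets1: "{w \<in> space sample. y \<le> D w} \<in> sets sample" using Dint by measurable
    have sets2: "{w \<in> space sample. D w \<le> \<alpha> * b} \<in> sets sample" using Dint by measurable
    have "y \<le> \<alpha> * b" unfolding y_def s_def using b alpha_bounds by (intro mult_left_mono) auto
    then have sub: "space sample - {w \<in> space sample. y \<le> D w} \<subseteq> {w \<in> space sample. D w \<le> \<alpha> * b}" by auto
    have "1 - \<delta> \<le> 1 - measure sample {w \<in> space sample. y \<le> D w}" using small by simp
    also have "\<dots> = measure sample (space sample - {w \<in> space sample. y \<le> D w})"
      using S.prob_compl[OF sets1] by simp
    also have "\<dots> \<le> measure sample {w \<in> space sample. D w \<le> \<alpha> * b}"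
      by (rule S.finite_measure_mono[OF sub sets2])
    finally show ?thesis unfolding set_eq .
  next
    case False
    then have "s < 1" by (simp add: s_def real_sqrt_less_iff)
    then have "\<delta> * s \<le> 1" using \<delta> s by (intro mult_le_one) auto
    then have "1 \<le> 367 * (sqrt v + 1) / (\<delta> * s)"
      using \<delta> s by (simp add: pos_le_divide_eq) (smt (verit) real_sqrt_ge_zero of_nat_0_le_iff)
    then have "\<alpha> * 1 \<le> \<alpha> * b" using b alpha_bounds unfolding s_def by (intro mult_left_mono) auto
    moreover have "D w \<le> \<alpha>" if "w \<in> space sample" for w
      using cv_sum_bounds[OF that] tail_risk_bounds[OF predictor_in_G[OF that subset_refl]]
      unfolding D_def by linarith
    ultimately have "{w \<in> space sample. D w \<le> \<alpha> * b} = space sample" by fastforce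
    then show ?thesis unfolding set_eq using \<delta> by (simp add: S.prob_space)
  qed
qed

end

theorem corollary4p1:
  shows "\<exists>M M\<^sub>5 :: real. 0 < M \<and> 0 < M\<^sub>5 \<and>
    (\<forall>(P :: obs measure) (d :: nat) (X :: vec set) (N :: vec \<Rightarrow> real) (G :: (vec \<Rightarrow> real) set)
      (c :: (vec \<Rightarrow> real) \<Rightarrow> obs \<Rightarrow> real) (n :: nat) (k :: nat) (\<alpha> :: real) (t :: real)
      (\<Psi> :: rule) (v :: nat) (p :: nat) (K :: nat) (V :: nat \<Rightarrow> nat set) (\<delta> :: real).
        1 \<le> k \<longrightarrow> k \<le> n \<longrightarrow> \<alpha> = real k / real n \<longrightarrow>
        extreme_setting P d X N G c \<alpha> t \<longrightarrow>
        learning_rule P c G n \<Psi> \<longrightarrow>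
        cond_erm P N c G n \<alpha> \<Psi> \<longrightarrow>
        vc_dim (subgraph (X \<times> {-1, 1}) c ` G) = enat v \<longrightarrow>
        (\<forall>g\<in>G. \<forall>z\<in>X \<times> {-1, 1}. 0 \<le> c g z \<and> c g z \<le> 1) \<longrightarrow>
        1 \<le> p \<longrightarrow> p < n \<longrightarrow>
        leave_p_out n p K V \<longrightarrow>
        0 < \<delta> \<longrightarrow> \<delta> < 1 \<longrightarrow>
        measure (Pi\<^sub>M {1..n} (\<lambda>_. P))
          {\<omega> \<in> space (Pi\<^sub>M {1..n} (\<lambda>_. P)).
            \<bar>cv_risk N c n \<alpha> \<Psi> K V \<omega> - cond_risk P N c t (trained N n \<alpha> \<Psi> \<omega> {1..n})\<bar>
              \<le> E_lpo M v n p \<alpha>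
                 + 1 / (\<delta> * sqrt (real (n - p) * \<alpha>)) * (5 * M * sqrt (real v) + M\<^sub>5)}
          \<ge> 1 - 17 * \<delta>)"
proof (rule exI[of _ 367], rule exI[of _ 367], intro conjI allI impI)
  fix P :: "obs measure" and d :: nat and X :: "vec set" and N :: "vec \<Rightarrow> real"
    and G :: "(vec \<Rightarrow> real) set" and c :: "(vec \<Rightarrow> real) \<Rightarrow> obs \<Rightarrow> real" and n k :: nat
    and \<alpha> t :: real and \<Psi> :: rule and v p K :: nat and V :: "nat \<Rightarrow> nat set" and \<delta> :: real
  assume "1 \<le> k" "k \<le> n" "\<alpha> = real k / real n" "extreme_setting P d X N G c \<alpha> t"
    "learning_rule P c G n \<Psi>" "cond_erm P N c G n \<alpha> \<Psi>"
    "vc_dim (subgraph (X \<times> {-1, 1}) c ` G) = enat v"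
    "\<forall>g\<in>G. \<forall>z\<in>X \<times> {-1, 1}. 0 \<le> c g z \<and> c g z \<le> 1" "1 \<le> p" "p < n" "leave_p_out n p K V"
    and \<delta>: "0 < \<delta>" "\<delta> < 1"
  then interpret lpo_setting P d X N G c \<alpha> t n k \<Psi> v p K V
    by (intro lpo_setting.intro lpo_setting_axioms.intro)
  define s where "s = sqrt (real (n - p) * \<alpha>)"
  define b where "b = E_lpo 367 v n p \<alpha> + 1 / (\<delta> * s) * (5 * 367 * sqrt (real v) + 367)"
  have "367 * (sqrt v + 1) / (\<delta> * s) \<le> 1 / (\<delta> * s) * (5 * 367 * sqrt (real v) + 367)"
    using \<delta> alpha_bounds by (simp add: s_def divide_right_mono)
  moreover have "0 \<le> E_lpo 367 v n p \<alpha>"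
    using alpha_bounds by (simp add: E_lpo_def)
  ultimately have "367 * (sqrt v + 1) / (\<delta> * s) \<le> b" by (simp add: b_def)
  from cv_error_probability[OF \<delta> this[unfolded s_def]] \<delta>
  show "1 - 17 * \<delta> \<le> measure (Pi\<^sub>M {1..n} (\<lambda>_. P))
      {\<omega> \<in> space (Pi\<^sub>M {1..n} (\<lambda>_. P)).
        \<bar>cv_risk N c n \<alpha> \<Psi> K V \<omega> - cond_risk P N c t (trained N n \<alpha> \<Psi> \<omega> {1..n})\<bar>
          \<le> E_lpo 367 v n p \<alpha> + 1 / (\<delta> * sqrt (real (n - p) * \<alpha>)) * (5 * 367 * sqrt (real v) + 367)}"
    by (simp add: b_def s_def sample_def)
qed auto

end
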